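(* Let $d\geq 2$, $s>\frac12$, $\frac d2<\alpha<d-\frac12$, and let $$p_{rad}=\frac{2(\alpha-\frac d2)+2s(d-1)}{-(2s-1)(\alpha-\frac d2)+2s(d-1)}.$$ Then $p_{rad}<2$, and every $u\in X_{s,\alpha,d}$ belongs to $L^p(\mathbb{R}^d)$ for all $$p\in\left(p_{rad},\tfrac{2d}{d-2s}\right]\ \text{ if } s<\tfrac d2,\qquad p\in(p_{rad},\infty)\ \text{ if } s\geq\tfrac d2.$$ Moreover, for each such $p$ there is a constant $C(\alpha,s,p,d)$ such that for all $u\in X_{s,\alpha,d}$ $$\|u\|_{L^p(\mathbb{R}^d)}\leq C(\alpha,s,p,d)\,\left\|\tfrac{1}{|x|^\alpha}\star|u|\right\|_{L^2(\mathbb{R}^d)}^{1-\theta}\,\|D^su\|_{L^2(\mathbb{R}^d)}^{\theta},$$ where $\theta$ is determined by $\frac dp=(1-\theta)\left((d-\alpha)+\frac d2\right)+\theta\left(-s+\frac d2\right)$.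
   Context: $D^s$ denotes the Fourier multiplier $\widehat{D^s u}(\xi)=|\xi|^s\widehat u(\xi)$; $\dot H^s(\mathbb{R}^d)$ is the homogeneous Sobolev space with norm $\|D^su\|_{L^2}$, and $\dot H^s_{rad}(\mathbb{R}^d)$ its subset of radially symmetric functions. $\star$ denotes convolution. For $d\geq2$, $0<\alpha<d$, $s>\frac12$, $X_{s,\alpha,d}=\{u\in\dot H^s_{rad}(\mathbb{R}^d):\ \|\frac{1}{|x|^\alpha}\star|u|\|_{L^2(\mathbb{R}^d)}<\infty\}$. *)

theory Defs
  imports "HOL-Analysis.Analysis"
begin

text \<open>C-infinity functions on a Euclidean space: all partial derivatives of all
orders exist and are continuous (a class closed under partial differentiation).\<close>
definition smooth_fun :: "('a::euclidean_space \<Rightarrow> complex) \<Rightarrow> bool" where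
  "smooth_fun f \<longleftrightarrow> (\<exists>S. f \<in> S \<and>
     (\<forall>g\<in>S. continuous_on UNIV g \<and>
        (\<forall>i\<in>Basis. \<exists>g'\<in>S. \<forall>x. ((\<lambda>t. g (x + t *\<^sub>R i)) has_vector_derivative g' x) (at 0))))"

definition freq_test :: "('a::euclidean_space \<Rightarrow> complex) \<Rightarrow> bool" where
  "freq_test \<psi> \<longleftrightarrow> smooth_fun \<psi> \<and>
     (\<exists>K. compact K \<and> 0 \<notin> K \<and> (\<forall>\<xi>. \<xi> \<notin> K \<longrightarrow> \<psi> \<xi> = 0))"

definition fourier :: "('a::euclidean_space \<Rightarrow> complex) \<Rightarrow> 'a \<Rightarrow> complex" where
  "fourier \<phi> x = (LINT \<xi>|lborel. \<phi> \<xi> * cis (- 2 * pi * (x \<bullet> \<xi>)))"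

text \<open>uh is (a representative of) the distributional Fourier transform of u,
tested against Schwartz functions whose Fourier transform is compactly supported
away from 0 (so it is defined modulo polynomials, as for homogeneous spaces).\<close>
definition is_fourier_transform ::
  "('a::euclidean_space \<Rightarrow> complex) \<Rightarrow> ('a \<Rightarrow> complex) \<Rightarrow> bool" where
  "is_fourier_transform u uh \<longleftrightarrow> uh \<in> borel_measurable lborel \<and>
     (\<forall>\<psi>. freq_test \<psi> \<longrightarrow>
        integrable lborel (\<lambda>\<xi>. uh \<xi> * \<psi> \<xi>) \<and>
        integrable lborel (\<lambda>x. u x * fourier \<psi> x) \<and>
        (LINT x|lborel. u x * fourier \<psi> x) = (LINT \<xi>|lborel. uh \<xi> * \<psi> \<xi>))"

definition hdot_sq :: "real \<Rightarrow> ('a::euclidean_space \<Rightarrow> complex) \<Rightarrow> ennreal" where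
  "hdot_sq s uh = (\<integral>\<^sup>+ \<xi>. ennreal (norm \<xi> powr (2 * s) * (cmod (uh \<xi>))\<^sup>2) \<partial>lborel)"

definition radial :: "('a::real_normed_vector \<Rightarrow> complex) \<Rightarrow> bool" where
  "radial u \<longleftrightarrow> (\<forall>x y. norm x = norm y \<longrightarrow> u x = u y)"

definition riesz_conv :: "real \<Rightarrow> ('a::euclidean_space \<Rightarrow> complex) \<Rightarrow> 'a \<Rightarrow> ennreal" where
  "riesz_conv \<alpha> u x = (\<integral>\<^sup>+ y. ennreal (norm (x - y) powr (- \<alpha>) * cmod (u y)) \<partial>lborel)"

definition conv_sq :: "real \<Rightarrow> ('a::euclidean_space \<Rightarrow> complex) \<Rightarrow> ennreal" where
  "conv_sq \<alpha> u = (\<integral>\<^sup>+ x. (riesz_conv \<alpha> u x)\<^sup>2 \<partial>lborel)"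

definition lp_pow :: "real \<Rightarrow> ('a::euclidean_space \<Rightarrow> complex) \<Rightarrow> ennreal" where
  "lp_pow p u = (\<integral>\<^sup>+ x. ennreal (cmod (u x) powr p) \<partial>lborel)"

definition p_rad :: "real \<Rightarrow> real \<Rightarrow> real \<Rightarrow> real" where
  "p_rad d s \<alpha> = (2 * (\<alpha> - d/2) + 2 * s * (d - 1)) / (- (2 * s - 1) * (\<alpha> - d/2) + 2 * s * (d - 1))"

end

theory Submission
  imports Defs "HOL-Probability.Characteristic_Functions"
begin

text \<open>
  Finiteness of \<open>|x|\<^bsup>-\<alpha>\<^esup> * |u|\<close> in \<open>L\<^sup>2\<close> bounds the mass of \<open>|u|\<close> on balls. If \<open>u\<close> is radial, a ball of
  radius \<open>\<rho>\<close> centred at distance \<open>R\<close> from the origin has about \<open>(R/\<rho>)\<^bsup>d-1\<^esup>\<close> disjoint rotated copies,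
  so it carries only a small share of the mass of the surrounding shell. Let \<open>T\<close> be the average over
  balls of radius \<open>\<rho>\<close>. The part \<open>(1 - T)\<^sup>k u\<close> has \<open>L\<^sup>2\<close> norm \<open>O(\<rho>\<^sup>s)\<close> by Plancherel, and the
  remaining part is bounded pointwise by the masses of balls of radius \<open>\<rho>\<close>. Taking \<open>\<rho> = R\<^bsup>-\<sigma>\<^esup>\<close> on the
  annulus at distance \<open>R\<close> balances the two contributions to the local \<open>L\<^sup>2\<close> norm. For \<open>p \<le> 2\<close>
  interpolation with the mass bounds \<open>\<integral>|u|\<^sup>p\<close> over the annulus by a power of \<open>R\<close>, whose exponent is
  negative exactly when \<open>p > p_rad\<close>, so that the dyadic annuli can be summed. For \<open>p > 2\<close> a fixed
  radius suffices: the rough part is controlled by the Sobolev inequality, the smooth part is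
  bounded.

  Scaling turns the normalised bound into the interpolation inequality. A general \<open>u\<close> is the limit
  almost everywhere of its frequency bands \<open>1/n \<le> |\<xi>| \<le> n\<close>, because the discarded low frequencies
  are dominated by \<open>n\<^bsup>\<alpha>-d\<^esup>\<close> times the Riesz potential of \<open>|u|\<close>.
\<close>

section \<open>Integration over Euclidean spaces\<close>

lemma ball_in_sets_borel [measurable]: "ball (x :: 'a::euclidean_space) r \<in> sets borel"
  and cball_in_sets_borel [measurable]: "cball (x :: 'a::euclidean_space) r \<in> sets borel"
  by auto

subsection \<open>Affine changes of variables\<close>

lemma nn_integral_lborel_affine:
  fixes f :: "'a::euclidean_space \<Rightarrow> ennreal"
  assumes [measurable]: "f \<in> borel_measurable borel" and c: "c \<noteq> 0"
  shows "(\<integral>\<^sup>+x. f x \<partial>lborel) = ennreal (\<bar>c\<bar> ^ DIM('a)) * (\<integral>\<^sup>+x. f (t + c *\<^sub>R x) \<partial>lborel)"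
  by (subst lborel_affine[OF c, of t])
     (simp add: nn_integral_density nn_integral_distr nn_integral_cmult)

lemma nn_integral_lborel_translate:
  fixes f :: "'a::euclidean_space \<Rightarrow> ennreal"
  assumes "f \<in> borel_measurable borel"
  shows "(\<integral>\<^sup>+x. f (x + t) \<partial>lborel) = (\<integral>\<^sup>+x. f x \<partial>lborel)"
  using nn_integral_lborel_affine[OF assms, of 1 t] by (simp add: add.commute)

lemma nn_integral_lborel_reflect:
  fixes f :: "'a::euclidean_space \<Rightarrow> ennreal"
  assumes "f \<in> borel_measurable borel"
  shows "(\<integral>\<^sup>+x. f (t - x) \<partial>lborel) = (\<integral>\<^sup>+x. f x \<partial>lborel)"
  using nn_integral_lborel_affine[OF assms, of "-1" t] by simp

lemma nn_integral_lborel_scale: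
  fixes f :: "'a::euclidean_space \<Rightarrow> ennreal"
  assumes [measurable]: "f \<in> borel_measurable borel" and c: "c > 0"
  shows "(\<integral>\<^sup>+x. f (c *\<^sub>R x) \<partial>lborel) = ennreal (c powr - real DIM('a)) * (\<integral>\<^sup>+x. f x \<partial>lborel)"
proof -
  have "ennreal (c powr - real DIM('a)) * (\<integral>\<^sup>+x. f x \<partial>lborel) =
      (ennreal (c powr - real DIM('a)) * ennreal (c ^ DIM('a))) * (\<integral>\<^sup>+x. f (c *\<^sub>R x) \<partial>lborel)"
    using nn_integral_lborel_affine[of f c 0] c by (simp add: mult.assoc)
  also have "ennreal (c powr - real DIM('a)) * ennreal (c ^ DIM('a)) = 1"
    using c by (simp add: ennreal_mult'[symmetric] powr_minus powr_realpow)
  finally show ?thesis by simp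
qed

lemma integral_lborel_affine:
  fixes f :: "'a::euclidean_space \<Rightarrow> 'b::{banach, second_countable_topology}"
  assumes [measurable]: "f \<in> borel_measurable borel" and c: "c \<noteq> 0"
  shows "(LINT x|lborel. f x) = \<bar>c\<bar> ^ DIM('a) *\<^sub>R (LINT x|lborel. f (t + c *\<^sub>R x))"
  by (subst lborel_affine[OF c, of t]) (simp add: integral_density integral_distr)

lemma integral_lborel_translate:
  fixes f :: "'a::euclidean_space \<Rightarrow> 'b::{banach, second_countable_topology}"
  assumes "f \<in> borel_measurable borel"
  shows "(LINT x|lborel. f (x + t)) = (LINT x|lborel. f x)"
  using integral_lborel_affine[OF assms, of 1 t] by (simp add: add.commute)

lemma integrable_lborel_affine:
  fixes f :: "'a::euclidean_space \<Rightarrow> 'b::{banach, second_countable_topology}"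
  assumes f: "integrable lborel f" and c: "c \<noteq> 0"
  shows "integrable lborel (\<lambda>x. f (t + c *\<^sub>R x))"
proof (rule integrableI_bounded)
  have [measurable]: "f \<in> borel_measurable borel" using f by auto
  show "(\<lambda>x. f (t + c *\<^sub>R x)) \<in> borel_measurable lborel" by measurable
  have "ennreal (\<bar>c\<bar> ^ DIM('a)) * (\<integral>\<^sup>+x. norm (f (t + c *\<^sub>R x)) \<partial>lborel) < \<infinity>"
    using nn_integral_lborel_affine[of "\<lambda>x. ennreal (norm (f x))" c t] c f
    by (simp add: integrable_iff_bounded)
  then show "(\<integral>\<^sup>+x. norm (f (t + c *\<^sub>R x)) \<partial>lborel) < \<infinity>"
    using c by (auto simp: ennreal_mult_less_top)
qed

lemma integrable_lborel_translate:
  fixes f :: "'a::euclidean_space \<Rightarrow> 'b::{banach, second_countable_topology}"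
  shows "integrable lborel f \<Longrightarrow> integrable lborel (\<lambda>x. f (x + t))"
  using integrable_lborel_affine[of f 1 t] by (simp add: add.commute)

subsection \<open>Double integrals and convolutions\<close>

lemma lborel_integrable_pairI:
  fixes f :: "'a::euclidean_space \<Rightarrow> 'b::euclidean_space \<Rightarrow> 'c::{banach, second_countable_topology}"
  assumes "case_prod f \<in> borel_measurable (lborel \<Otimes>\<^sub>M lborel)"
    and "(\<integral>\<^sup>+x. \<integral>\<^sup>+y. norm (f x y) \<partial>lborel \<partial>lborel) < \<infinity>"
  shows "integrable (lborel \<Otimes>\<^sub>M lborel) (case_prod f)"
proof (rule integrableI_bounded)
  have "(\<integral>\<^sup>+z. norm (case_prod f z) \<partial>(lborel \<Otimes>\<^sub>M lborel)) =
      (\<integral>\<^sup>+x. \<integral>\<^sup>+y. norm (f x y) \<partial>lborel \<partial>lborel)"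
    using assms(1) by (subst lborel.nn_integral_fst[symmetric]) auto
  then show "(\<integral>\<^sup>+z. norm (case_prod f z) \<partial>(lborel \<Otimes>\<^sub>M lborel)) < \<infinity>"
    using assms(2) by simp
qed fact

lemma integral_norm_bound_nn_integral:
  fixes f :: "'a \<Rightarrow> 'b::{banach, second_countable_topology}"
  shows "ennreal (norm (integral\<^sup>L M f)) \<le> (\<integral>\<^sup>+x. norm (f x) \<partial>M)"
  by (cases "integrable M f") (auto simp: integral_norm_bound_ennreal not_integrable_integral_eq)

lemma integrable_pair_translate:
  fixes f k :: "'a::euclidean_space \<Rightarrow> 'b::{banach, real_normed_algebra, second_countable_topology}"
  assumes f: "integrable lborel f" and k: "integrable lborel k"
  shows "integrable (lborel \<Otimes>\<^sub>M lborel) (\<lambda>(w, x). f (x + r *\<^sub>R w) * k w)"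
proof (rule lborel_integrable_pairI)
  have [measurable]: "f \<in> borel_measurable borel" "k \<in> borel_measurable borel" using f k by auto
  show "(\<lambda>(w, x). f (x + r *\<^sub>R w) * k w) \<in> borel_measurable (lborel \<Otimes>\<^sub>M lborel)"
    by measurable
  have "(\<integral>\<^sup>+w. \<integral>\<^sup>+x. norm (f (x + r *\<^sub>R w) * k w) \<partial>lborel \<partial>lborel) \<le>
      (\<integral>\<^sup>+w. \<integral>\<^sup>+x. ennreal (norm (f (x + r *\<^sub>R w))) * ennreal (norm (k w)) \<partial>lborel \<partial>lborel)"
    by (intro nn_integral_mono) (simp add: norm_mult_ineq ennreal_leI flip: ennreal_mult)
  also have "\<dots> = (\<integral>\<^sup>+x. norm (f x) \<partial>lborel) * (\<integral>\<^sup>+w. norm (k w) \<partial>lborel)"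
    by (simp add: nn_integral_multc nn_integral_cmult
        nn_integral_lborel_translate[of "\<lambda>x. ennreal (norm (f x))"])
  also have "\<dots> < \<infinity>"
    using f k by (simp add: integrable_iff_bounded ennreal_mult_less_top)
  finally show "(\<integral>\<^sup>+w. \<integral>\<^sup>+x. norm (f (x + r *\<^sub>R w) * k w) \<partial>lborel \<partial>lborel) < \<infinity>" .
qed

lemma Cauchy_Schwarz_nn_integral_weighted:
  fixes k f :: "'a \<Rightarrow> ennreal"
  assumes [measurable]: "k \<in> borel_measurable M" "f \<in> borel_measurable M"
  shows "(\<integral>\<^sup>+z. k z * f z \<partial>M)\<^sup>2 \<le> (\<integral>\<^sup>+z. k z \<partial>M) * (\<integral>\<^sup>+z. k z * (f z)\<^sup>2 \<partial>M)"
  using Cauchy_Schwarz_nn_integral[of "\<lambda>_. 1" "density M k" f]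
  by (simp add: nn_integral_density emeasure_density)

lemma nn_integral_convolution_square_le:
  fixes k f :: "'a::euclidean_space \<Rightarrow> ennreal"
  assumes [measurable]: "k \<in> borel_measurable borel" "f \<in> borel_measurable borel"
  shows "(\<integral>\<^sup>+x. (\<integral>\<^sup>+z. k z * f (x + z) \<partial>lborel)\<^sup>2 \<partial>lborel)
    \<le> (\<integral>\<^sup>+z. k z \<partial>lborel)\<^sup>2 * (\<integral>\<^sup>+x. (f x)\<^sup>2 \<partial>lborel)"
proof -
  define I where "I = (\<integral>\<^sup>+z. k z \<partial>lborel)"
  have "(\<integral>\<^sup>+x. (\<integral>\<^sup>+z. k z * f (x + z) \<partial>lborel)\<^sup>2 \<partial>lborel) \<le>
      (\<integral>\<^sup>+x. I * (\<integral>\<^sup>+z. k z * (f (x + z))\<^sup>2 \<partial>lborel) \<partial>lborel)"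
    unfolding I_def by (intro nn_integral_mono Cauchy_Schwarz_nn_integral_weighted) measurable
  also have "\<dots> = I * (\<integral>\<^sup>+z. \<integral>\<^sup>+x. k z * (f (x + z))\<^sup>2 \<partial>lborel \<partial>lborel)"
    by (subst lborel_pair.Fubini') (auto intro: nn_integral_cmult)
  also have "\<dots> = I * (I * (\<integral>\<^sup>+x. (f x)\<^sup>2 \<partial>lborel))"
    by (simp add: I_def nn_integral_cmult nn_integral_multc
        nn_integral_lborel_translate[of "\<lambda>x. (f x)\<^sup>2"])
  finally show ?thesis by (simp add: I_def power2_eq_square mult.assoc)
qed

subsection \<open>Rotation invariance\<close>

lemma translation_invariant_emeasure_proportional:
  fixes N :: "'a::euclidean_space measure"
  assumes "sigma_finite_measure N" and [measurable_cong]: "sets N = sets borel"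
    and trans: "\<And>x. distr N borel (\<lambda>y. y + x) = N"
    and [measurable]: "E \<in> sets borel" "B \<in> sets borel"
  shows "emeasure N E * emeasure lborel B = emeasure lborel E * emeasure N B"
proof -
  interpret N: sigma_finite_measure N by fact
  interpret pair_sigma_finite N "lborel :: 'a measure" ..
  have trans_nn: "(\<integral>\<^sup>+y. f y \<partial>N) = (\<integral>\<^sup>+y. f (y + x) \<partial>N)"
    if [measurable]: "f \<in> borel_measurable borel" for f :: "'a \<Rightarrow> ennreal" and x
    by (subst trans[of x, symmetric]) (simp add: nn_integral_distr)
  have "(\<integral>\<^sup>+x. indicator B (y - x) \<partial>lborel) = emeasure lborel B" for y
    using nn_integral_lborel_reflect[of "indicator B" y] by simp
  then have "emeasure N E * emeasure lborel B =
      (\<integral>\<^sup>+y. \<integral>\<^sup>+x. indicator E y * indicator B (y - x) \<partial>lborel \<partial>N)"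
    by (simp add: nn_integral_cmult nn_integral_multc)
  also have "\<dots> = (\<integral>\<^sup>+x. \<integral>\<^sup>+y. indicator E y * indicator B (y - x) \<partial>N \<partial>lborel)"
    by (rule Fubini'[symmetric]) measurable
  also have "\<dots> = (\<integral>\<^sup>+x. \<integral>\<^sup>+y. indicator E (y + x) * indicator B y \<partial>N \<partial>lborel)"
  proof (rule nn_integral_cong)
    fix x :: 'a
    show "(\<integral>\<^sup>+y. indicator E y * indicator B (y - x) \<partial>N) =
        (\<integral>\<^sup>+y. indicator E (y + x) * indicator B y \<partial>N)"
      by (subst trans_nn[where x=x]) auto
  qed
  also have "\<dots> = (\<integral>\<^sup>+y. \<integral>\<^sup>+x. indicator E (y + x) * indicator B y \<partial>lborel \<partial>N)"
    by (rule Fubini') measurable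
  also have "\<dots> = emeasure lborel E * emeasure N B"
  proof -
    have "(\<integral>\<^sup>+x. indicator E (y + x) \<partial>lborel) = emeasure lborel E" for y
      using nn_integral_lborel_translate[of "indicator E" y] by (simp add: add.commute)
    then show ?thesis by (simp add: nn_integral_multc nn_integral_cmult)
  qed
  finally show ?thesis .
qed

lemma orthogonal_transformation_measurable:
  fixes T :: "'a::euclidean_space \<Rightarrow> 'a"
  assumes "orthogonal_transformation T"
  shows "T \<in> borel_measurable borel"
  using orthogonal_transformation_linear[OF assms]
  by (intro borel_measurable_continuous_onI linear_continuous_on)
     (simp add: linear_conv_bounded_linear)

lemma distr_orthogonal_lborel:
  fixes T :: "'a::euclidean_space \<Rightarrow> 'a"
  assumes T: "orthogonal_transformation T"
  shows "distr lborel borel T = lborel"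
proof (rule measure_eqI)
  let ?N = "distr lborel borel T"
  note [measurable] = orthogonal_transformation_measurable[OF T]
  have vimage_ball: "T -` ball 0 r = ball 0 r" for r
    by (auto simp: orthogonal_transformation_norm[OF T])
  have emeasure_N_ball: "emeasure ?N (ball 0 r) = emeasure lborel (ball (0::'a) r)" for r
    by (simp add: emeasure_distr vimage_ball)
  have "sigma_finite_measure ?N"
  proof
    have "\<Union>(range (\<lambda>n::nat. ball (0::'a) (real n))) = UNIV"
      using reals_Archimedean2 by auto
    then show "\<exists>\<B>. countable \<B> \<and> \<B> \<subseteq> sets ?N \<and> \<Union>\<B> = space ?N \<and> (\<forall>B\<in>\<B>. emeasure ?N B \<noteq> \<infinity>)"
      by (intro exI[of _ "range (\<lambda>n::nat. ball (0::'a) (real n))"])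
         (auto simp: emeasure_N_ball emeasure_ball)
  qed
  moreover have "distr ?N borel (\<lambda>y. y + x) = ?N" for x
  proof -
    obtain x' where x: "x = T x'" using orthogonal_transformation_surj[OF T] by (metis surjD)
    have "distr ?N borel (\<lambda>y. y + x) = distr (distr lborel borel ((+) x')) borel T"
      by (simp add: distr_distr o_def x add.commute
          linear_add[OF orthogonal_transformation_linear[OF T]])
    then show ?thesis by (simp add: lborel_distr_plus)
  qed
  ultimately have "emeasure ?N E * emeasure lborel (ball (0::'a) 1) =
      emeasure lborel E * emeasure lborel (ball (0::'a) 1)" if "E \<in> sets borel" for E
    using translation_invariant_emeasure_proportional[of ?N E "ball 0 1"] that
    by (simp add: emeasure_N_ball)
  moreover have "\<not> unit_ball_vol (real DIM('a)) \<le> 0"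
    by (simp add: not_le)
  ultimately show "emeasure ?N E = emeasure lborel E" if "E \<in> sets ?N" for E
    using that
    by (simp add: mult.commute[of _ "ennreal _"] ennreal_mult_cancel_left emeasure_ball
        ennreal_eq_0_iff)
qed simp

lemma nn_integral_orthogonal:
  fixes f :: "'a::euclidean_space \<Rightarrow> ennreal" and T :: "'a \<Rightarrow> 'a"
  assumes T: "orthogonal_transformation T" and [measurable]: "f \<in> borel_measurable borel"
  shows "(\<integral>\<^sup>+x. f (T x) \<partial>lborel) = (\<integral>\<^sup>+x. f x \<partial>lborel)"
  by (subst (2) distr_orthogonal_lborel[OF T, symmetric])
     (simp add: nn_integral_distr orthogonal_transformation_measurable[OF T])

lemma integral_orthogonal:
  fixes f :: "'a::euclidean_space \<Rightarrow> 'b::{banach, second_countable_topology}" and T :: "'a \<Rightarrow> 'a"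
  assumes T: "orthogonal_transformation T" and [measurable]: "f \<in> borel_measurable borel"
  shows "(LINT x|lborel. f (T x)) = (LINT x|lborel. f x)"
  by (subst (2) distr_orthogonal_lborel[OF T, symmetric])
     (simp add: integral_distr orthogonal_transformation_measurable[OF T])

lemma orthogonal_transformation_swap:
  fixes x y :: "'a::euclidean_space"
  assumes "norm x = norm y"
  obtains T where "orthogonal_transformation T" "T x = y"
proof (cases "x = y")
  case True
  then show ?thesis using that[of "\<lambda>x. x"] by simp
next
  case False
  define w where "w = x - y"
  define T where "T z = z - (2 * (z \<bullet> w) / (w \<bullet> w)) *\<^sub>R w" for z
  have w: "w \<bullet> w \<noteq> 0" using False by (simp add: w_def)
  have "linear T"
    by (rule linearI) (auto simp: T_def inner_left_distrib algebra_simps add_divide_distrib)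
  moreover have "T a \<bullet> T b = a \<bullet> b" for a b
    using w by (simp add: T_def inner_simps field_simps inner_commute)
  ultimately have "orthogonal_transformation T"
    by (simp add: orthogonal_transformation_def)
  moreover have "T x = y"
  proof -
    have "x \<bullet> x = y \<bullet> y" using assms by (simp add: norm_eq)
    then have "2 * (x \<bullet> w) = w \<bullet> w"
      by (simp add: w_def inner_simps inner_commute)
    then show ?thesis using w by (simp add: T_def) (simp add: w_def)
  qed
  ultimately show ?thesis by (rule that)
qed

subsection \<open>Polar coordinates for radial integrands\<close>

lemma distr_norm_lborel:
  fixes d :: nat and V :: real
  defines "d \<equiv> DIM('a::euclidean_space)" and "V \<equiv> unit_ball_vol (real DIM('a))"
  shows "distr lborel borel (norm :: 'a \<Rightarrow> real) =
    density lborel (\<lambda>r. ennreal (real d * V * r ^ (d - 1)) * indicator {0..} r)"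
    (is "?M = ?N")
proof (rule measure_eqI_generator_eq[where E="range (\<lambda>a. {..a})" and A="\<lambda>n. {..real n}"])
  have "d > 0" "V > 0" by (auto simp: d_def V_def)
  have emeasure_M: "emeasure ?M {..a} = ennreal (if 0 \<le> a then V * a ^ d else 0)" for a
  proof -
    have "(norm :: 'a \<Rightarrow> real) -` {..a} = cball 0 a" by auto
    then show ?thesis by (simp add: emeasure_distr emeasure_cball V_def d_def)
  qed
  have emeasure_N: "emeasure ?N {..a} = ennreal (if 0 \<le> a then V * a ^ d else 0)" for a
  proof -
    have "emeasure ?N {..a} =
        (\<integral>\<^sup>+r. ennreal (real d * V * r ^ (d - 1)) * indicator {0..a} r \<partial>lborel)"
      by (subst emeasure_density) (auto intro!: nn_integral_cong split: split_indicator)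
    also have "\<dots> = ennreal (if 0 \<le> a then V * a ^ d else 0)"
    proof (cases "0 \<le> a")
      case True
      then have "(\<integral>\<^sup>+r. ennreal (real d * V * r ^ (d - 1)) * indicator {0..a} r \<partial>lborel) =
          ennreal (V * a ^ d - V * 0 ^ d)"
        using \<open>V > 0\<close>
        by (intro nn_integral_FTC_Icc) (auto intro!: derivative_eq_intros)
      then show ?thesis using True \<open>d > 0\<close> by (simp add: zero_power)
    qed simp
    finally show ?thesis .
  qed
  show "emeasure ?M X = emeasure ?N X" if "X \<in> range (\<lambda>a. {..a})" for X
    using that by (elim rangeE) (simp only: emeasure_M emeasure_N)
  show "sets ?M = sigma_sets UNIV (range (\<lambda>a. {..a}))"
    and "sets ?N = sigma_sets UNIV (range (\<lambda>a. {..a}))"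
    by (auto simp: borel_eq_atMost)
  show "emeasure ?M {..real n} \<noteq> \<infinity>" for n by (simp add: emeasure_M)
  show "(\<Union>n. {..real n}) = UNIV" using real_arch_simple by auto
qed (auto simp: Int_stable_def)

lemma nn_integral_radial:
  fixes f :: "real \<Rightarrow> ennreal"
  assumes [measurable]: "f \<in> borel_measurable borel"
  shows "(\<integral>\<^sup>+x. f (norm (x::'a::euclidean_space)) \<partial>lborel) =
    (\<integral>\<^sup>+r\<in>{0..}. ennreal (DIM('a) * unit_ball_vol (real DIM('a)) * r ^ (DIM('a) - 1)) * f r \<partial>lborel)"
proof -
  have "(\<integral>\<^sup>+x. f (norm (x::'a)) \<partial>lborel) = (\<integral>\<^sup>+r. f r \<partial>distr lborel borel (norm :: 'a \<Rightarrow> real))"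
    by (simp add: nn_integral_distr)
  then show ?thesis
    by (simp add: distr_norm_lborel nn_integral_density mult_ac)
qed

lemma nn_integral_powr_Icc:
  fixes a q :: real
  assumes "q > -1" "a \<ge> 0"
  shows "(\<integral>\<^sup>+t. ennreal (t powr q) * indicator {0..a} t \<partial>lborel) =
      ennreal (a powr (q + 1) / (q + 1))"
  by (rule nn_integral_has_integral_lebesgue') (use has_integral_powr_from_0[OF assms] in auto)

lemma nn_integral_powr_atLeast:
  fixes a q :: real
  assumes "q < -1" "a > 0"
  shows "(\<integral>\<^sup>+t. ennreal (t powr q) * indicator {a..} t \<partial>lborel) =
      ennreal (a powr (q + 1) / - (q + 1))"
proof -
  have "(\<integral>\<^sup>+t. ennreal (t powr q) * indicator {a..} t \<partial>lborel) =
      ennreal (0 - a powr (q + 1) / (q + 1))"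
  proof (rule nn_integral_FTC_atLeast)
    show "((\<lambda>t. t powr (q + 1) / (q + 1)) has_real_derivative t powr q) (at t)" if "a \<le> t" for t
      using that assms by (auto intro!: derivative_eq_intros)
    have "((\<lambda>t. t powr (q + 1)) \<longlongrightarrow> 0) at_top"
      using assms by (intro tendsto_neg_powr filterlim_ident) auto
    from tendsto_divide[OF this tendsto_const, of "q + 1"]
    show "((\<lambda>t. t powr (q + 1) / (q + 1)) \<longlongrightarrow> 0) at_top" using assms by simp
  qed auto
  then show ?thesis by (simp only: divide_minus_right diff_0)
qed

lemma nn_integral_norm_powr_cball:
  fixes b \<Lambda> :: real
  assumes "b < real DIM('a::euclidean_space)" "\<Lambda> \<ge> 0"
  shows "(\<integral>\<^sup>+\<xi>\<in>cball (0::'a) \<Lambda>. norm \<xi> powr - b \<partial>lborel) =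
    ennreal (DIM('a) * unit_ball_vol (real DIM('a)) *
        (\<Lambda> powr (real DIM('a) - b) / (real DIM('a) - b)))"
proof -
  define d where "d = DIM('a)"
  define V where "V = unit_ball_vol (real d)"
  have d: "real (d - 1) = real d - 1" using DIM_positive[where 'a='a] by (simp add: d_def)
  have "(\<integral>\<^sup>+\<xi>\<in>cball (0::'a) \<Lambda>. norm \<xi> powr - b \<partial>lborel) =
      (\<integral>\<^sup>+(\<xi>::'a). ennreal (norm \<xi> powr - b) * indicator {..\<Lambda>} (norm \<xi>) \<partial>lborel)"
    by (intro nn_integral_cong) (auto split: split_indicator)
  also have "\<dots> = (\<integral>\<^sup>+r\<in>{0..}. ennreal (d * V * r ^ (d - 1)) *
      (ennreal (r powr - b) * indicator {..\<Lambda>} r) \<partial>lborel)"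
    unfolding d_def V_def by (rule nn_integral_radial) measurable
  also have "\<dots> = (\<integral>\<^sup>+r. ennreal (d * V) *
      (ennreal (r powr (d - 1 - b)) * indicator {0..\<Lambda>} r) \<partial>lborel)"
  proof (intro nn_integral_cong_AE, use AE_lborel_singleton[of 0] in eventually_elim)
    case (elim r)
    then show ?case
      by (auto simp: ennreal_mult'[symmetric] powr_realpow[symmetric] powr_add[symmetric] d V_def
          mult.assoc algebra_simps split: split_indicator)
  qed
  also have "\<dots> = ennreal (d * V) * ennreal (\<Lambda> powr (d - b) / (d - b))"
    using assms by (subst nn_integral_cmult) (auto simp: nn_integral_powr_Icc d_def)
  also have "\<dots> = ennreal (d * V * (\<Lambda> powr (d - b) / (d - b)))"
    by (rule ennreal_mult'[symmetric]) (simp add: V_def)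
  finally show ?thesis by (simp add: d_def V_def)
qed

lemma nn_integral_norm_powr_outside:
  fixes b \<Lambda> :: real
  assumes "b > real DIM('a::euclidean_space)" "\<Lambda> > 0"
  shows "(\<integral>\<^sup>+x\<in>-ball (0::'a) \<Lambda>. norm x powr - b \<partial>lborel) =
    ennreal (DIM('a) * unit_ball_vol (real DIM('a)) *
        (\<Lambda> powr (real DIM('a) - b) / (b - real DIM('a))))"
proof -
  define d where "d = DIM('a)"
  define V where "V = unit_ball_vol (real d)"
  have d: "real (d - 1) = real d - 1" using DIM_positive[where 'a='a] by (simp add: d_def)
  have "(\<integral>\<^sup>+x\<in>-ball (0::'a) \<Lambda>. norm x powr - b \<partial>lborel) =
      (\<integral>\<^sup>+(x::'a). ennreal (norm x powr - b) * indicator {\<Lambda>..} (norm x) \<partial>lborel)"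
    by (intro nn_integral_cong) (auto split: split_indicator)
  also have "\<dots> = (\<integral>\<^sup>+r\<in>{0..}. ennreal (d * V * r ^ (d - 1)) *
      (ennreal (r powr - b) * indicator {\<Lambda>..} r) \<partial>lborel)"
    unfolding d_def V_def by (rule nn_integral_radial) measurable
  also have "\<dots> = (\<integral>\<^sup>+r. ennreal (d * V) *
      (ennreal (r powr (d - 1 - b)) * indicator {\<Lambda>..} r) \<partial>lborel)"
  proof (rule nn_integral_cong)
    fix r :: real
    show "ennreal (d * V * r ^ (d - 1)) * (ennreal (r powr - b) * indicator {\<Lambda>..} r) *
        indicator {0..} r =
        ennreal (d * V) * (ennreal (r powr (d - 1 - b)) * indicator {\<Lambda>..} r)"
      using assms(2)
      by (auto simp: ennreal_mult'[symmetric] powr_realpow[symmetric] powr_add[symmetric] d V_def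
          mult.assoc algebra_simps split: split_indicator)
  qed
  also have "\<dots> = ennreal (d * V) * ennreal (\<Lambda> powr (d - b) / (b - d))"
    using assms by (subst nn_integral_cmult) (auto simp: nn_integral_powr_atLeast d_def)
  also have "\<dots> = ennreal (d * V * (\<Lambda> powr (d - b) / (b - d)))"
    by (rule ennreal_mult'[symmetric]) (simp add: V_def)
  finally show ?thesis by (simp add: d_def V_def)
qed

lemma integrable_norm_powr_decay:
  fixes f :: "'a::euclidean_space \<Rightarrow> 'b::{banach, second_countable_topology}"
  assumes [measurable]: "f \<in> borel_measurable borel" and b: "b > real DIM('a)"
    and bounded: "\<And>x. norm (f x) \<le> C" and decay: "\<And>x. 1 \<le> norm x \<Longrightarrow> norm (f x) \<le> C * norm x powr - b"
  shows "integrable lborel f"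
proof (rule integrableI_bounded)
  have C: "C \<ge> 0" using order_trans[OF norm_ge_zero bounded] .
  have "(\<integral>\<^sup>+x. norm (f x) \<partial>lborel) \<le> (\<integral>\<^sup>+(x::'a). ennreal C * indicator (cball 0 1) x +
      ennreal C * (ennreal (norm x powr - b) * indicator (- ball 0 1) x) \<partial>lborel)"
  proof (rule nn_integral_mono)
    fix x :: 'a
    show "ennreal (norm (f x)) \<le> ennreal C * indicator (cball 0 1) x +
        ennreal C * (ennreal (norm x powr - b) * indicator (- ball 0 1) x)"
      using bounded[of x] decay[of x] C
      by (cases "norm x \<le> 1")
         (auto intro!: ennreal_leI add_increasing2 simp: ennreal_mult'[symmetric]
             split: split_indicator)
  qed
  also have "\<dots> = ennreal C * emeasure lborel (cball (0::'a) 1) +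
      ennreal C * (\<integral>\<^sup>+x\<in>-ball (0::'a) 1. norm x powr - b \<partial>lborel)"
    by (simp add: nn_integral_add nn_integral_cmult)
  also have "\<dots> < \<infinity>"
    by (simp add: nn_integral_norm_powr_outside[OF b] emeasure_cball ennreal_mult_less_top)
  finally show "(\<integral>\<^sup>+x. norm (f x) \<partial>lborel) < \<infinity>" .
qed simp

section \<open>Approximate identities in \<open>L\<^sup>1\<close>\<close>

definition L1_modulus :: "('a::euclidean_space \<Rightarrow> 'b::real_normed_vector) \<Rightarrow> 'a \<Rightarrow> ennreal" where
  "L1_modulus f z = (\<integral>\<^sup>+x. norm (f (x + z) - f x) \<partial>lborel)"

lemma L1_modulus_le:
  fixes f g :: "'a::euclidean_space \<Rightarrow> 'b::{banach, second_countable_topology}"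
  assumes [measurable]: "f \<in> borel_measurable borel" "g \<in> borel_measurable borel"
  shows "L1_modulus f z \<le> 2 * (\<integral>\<^sup>+x. norm (g x - f x) \<partial>lborel) + L1_modulus g z"
proof -
  have "L1_modulus f z \<le>
      (\<integral>\<^sup>+x. (ennreal (norm (g (x + z) - f (x + z))) + ennreal (norm (g x - f x))) +
      ennreal (norm (g (x + z) - g x)) \<partial>lborel)"
    unfolding L1_modulus_def
  proof (rule nn_integral_mono)
    fix x
    have "norm (f (x + z) - f x) \<le>
        norm (g (x + z) - f (x + z)) + norm (g x - f x) + norm (g (x + z) - g x)"
      by norm
    then show "ennreal (norm (f (x + z) - f x)) \<le>
        (ennreal (norm (g (x + z) - f (x + z))) + ennreal (norm (g x - f x))) +
        ennreal (norm (g (x + z) - g x))"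
      by (simp flip: ennreal_plus)
  qed
  also have "\<dots> = ((\<integral>\<^sup>+x. norm (g (x + z) - f (x + z)) \<partial>lborel) +
      (\<integral>\<^sup>+x. norm (g x - f x) \<partial>lborel)) + L1_modulus g z"
    by (simp add: L1_modulus_def nn_integral_add)
  also have "(\<integral>\<^sup>+x. norm (g (x + z) - f (x + z)) \<partial>lborel) = (\<integral>\<^sup>+x. norm (g x - f x) \<partial>lborel)"
    by (rule nn_integral_lborel_translate[of "\<lambda>x. ennreal (norm (g x - f x))"]) simp
  finally show ?thesis by (simp add: mult_2)
qed

lemma L1_modulus_le_norm:
  fixes f :: "'a::euclidean_space \<Rightarrow> 'b::{banach, second_countable_topology}"
  assumes "f \<in> borel_measurable borel"
  shows "L1_modulus f z \<le> 2 * (\<integral>\<^sup>+x. norm (f x) \<partial>lborel)"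
  using L1_modulus_le[of f "\<lambda>_. 0" z] assms by (simp add: L1_modulus_def)

lemma L1_modulus_add_le:
  fixes f g :: "'a::euclidean_space \<Rightarrow> 'b::{banach, second_countable_topology}"
  assumes [measurable]: "f \<in> borel_measurable borel" "g \<in> borel_measurable borel"
  shows "L1_modulus (\<lambda>x. f x + g x) z \<le> L1_modulus f z + L1_modulus g z"
proof -
  have "L1_modulus (\<lambda>x. f x + g x) z \<le>
      (\<integral>\<^sup>+x. ennreal (norm (f (x + z) - f x)) + ennreal (norm (g (x + z) - g x)) \<partial>lborel)"
    unfolding L1_modulus_def by (intro nn_integral_mono) (simp flip: ennreal_plus, norm)
  then show ?thesis by (simp add: L1_modulus_def nn_integral_add)
qed

lemma ennreal_tendsto_0I:
  fixes f :: "'a \<Rightarrow> ennreal"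
  assumes "\<And>e::real. e > 0 \<Longrightarrow> \<forall>\<^sub>F n in F. f n \<le> ennreal e"
  shows "(f \<longlongrightarrow> 0) F"
proof (rule order_tendstoI)
  fix a :: ennreal assume "0 < a"
  then obtain b where b: "0 < b" "b < a" using dense by blast
  have "b < \<infinity>" by (rule less_le_trans[OF b(2)]) simp
  then have "b = ennreal (enn2real b)" "enn2real b > 0"
    using b by (auto simp: enn2real_positive_iff)
  with assms[of "enn2real b"] b(2) show "\<forall>\<^sub>F n in F. f n < a"
    by (auto elim: eventually_mono)
qed simp

lemma L1_modulus_tendsto_0_approx:
  fixes f :: "'a::euclidean_space \<Rightarrow> 'b::{banach, second_countable_topology}"
  assumes f: "f \<in> borel_measurable borel"
    and approx: "\<And>e::real. e > 0 \<Longrightarrow> \<exists>g. g \<in> borel_measurable borel \<and>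
      (\<integral>\<^sup>+x. norm (g x - f x) \<partial>lborel) \<le> ennreal e \<and> ((\<lambda>n. L1_modulus g (X n)) \<longlongrightarrow> 0) F"
  shows "((\<lambda>n. L1_modulus f (X n)) \<longlongrightarrow> 0) F"
proof (rule ennreal_tendsto_0I)
  fix e :: real assume e: "e > 0"
  obtain g where g: "g \<in> borel_measurable borel" "(\<integral>\<^sup>+x. norm (g x - f x) \<partial>lborel) \<le> ennreal (e/4)"
    and g_lim: "((\<lambda>n. L1_modulus g (X n)) \<longlongrightarrow> 0) F"
    using approx[of "e/4"] e by auto
  have "\<forall>\<^sub>F n in F. L1_modulus g (X n) < ennreal (e/2)"
    using order_tendstoD(2)[OF g_lim, of "ennreal (e/2)"] e by simp
  then show "\<forall>\<^sub>F n in F. L1_modulus f (X n) \<le> ennreal e"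
  proof eventually_elim
    case (elim n)
    have "L1_modulus f (X n) \<le> 2 * (\<integral>\<^sup>+x. norm (g x - f x) \<partial>lborel) + L1_modulus g (X n)"
      by (rule L1_modulus_le[OF f g(1)])
    also have "\<dots> \<le> 2 * ennreal (e/4) + ennreal (e/2)"
      using g(2) elim by (intro add_mono mult_left_mono) auto
    also have "\<dots> = ennreal (2 * (e/4) + e/2)"
      using e ennreal_mult[of 2 "e/4"] by (subst ennreal_plus) auto
    finally show ?case by simp
  qed
qed

text \<open>The parts of \<open>U\<close> lost and gained under a translation have the same measure.\<close>

lemma L1_modulus_indicator:
  fixes c :: "'b::{banach, second_countable_topology}"
  assumes [measurable]: "U \<in> sets borel" and finite: "emeasure lborel U < \<infinity>"
  shows "L1_modulus (\<lambda>x. indicator U x *\<^sub>R c) z = ennreal (norm c * 2) *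
    (\<integral>\<^sup>+x. max (indicator U x - indicator U (x + z)) (0::real) \<partial>lborel)"
proof -
  define lost where "lost x = max (indicator U x - indicator U (x + z)) (0::real)" for x
  have [measurable]: "lost \<in> borel_measurable borel" unfolding lost_def by measurable
  define difference where
    "difference = (\<integral>\<^sup>+x. ennreal \<bar>indicator U (x + z) - indicator U x\<bar> \<partial>lborel)"
  have "difference + emeasure lborel U =
      (\<integral>\<^sup>+x. ennreal \<bar>indicator U (x + z) - indicator U x\<bar> + indicator U x \<partial>lborel)"
    by (simp add: difference_def nn_integral_add)
  also have "\<dots> = (\<integral>\<^sup>+x. (ennreal (lost x) + ennreal (lost x)) + indicator U (x + z) \<partial>lborel)"
    by (intro nn_integral_cong)
       (auto simp: lost_def ennreal_neg simp flip: ennreal_plus split: split_indicator)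
  also have "\<dots> = 2 * (\<integral>\<^sup>+x. lost x \<partial>lborel) + emeasure lborel U"
    by (simp add: nn_integral_add nn_integral_lborel_translate[of "indicator U"] mult_2)
  finally have "difference = 2 * (\<integral>\<^sup>+x. lost x \<partial>lborel)" using finite by auto
  moreover have "L1_modulus (\<lambda>x. indicator U x *\<^sub>R c) z = ennreal (norm c) * difference"
    unfolding L1_modulus_def difference_def
    by (subst nn_integral_cmult[symmetric])
       (auto intro!: nn_integral_cong simp flip: ennreal_mult split: split_indicator)
  ultimately show ?thesis by (simp add: lost_def ennreal_mult mult.assoc)
qed

lemma L1_modulus_open_tendsto_0:
  fixes U :: "'a::euclidean_space set" and c :: "'b::{banach, second_countable_topology}"
  assumes U: "open U" and finite: "emeasure lborel U < \<infinity>" and X: "X \<longlonglongrightarrow> 0"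
  shows "(\<lambda>n. L1_modulus (\<lambda>x. indicator U x *\<^sub>R c) (X n)) \<longlonglongrightarrow> 0"
proof -
  have [measurable]: "U \<in> sets borel" using U by simp
  define lost where "lost z x = max (indicator U x - indicator U (x + z)) (0::real)" for z x
  have [measurable]: "lost z \<in> borel_measurable borel" for z
    unfolding lost_def by measurable
  have "(\<lambda>n. \<integral>\<^sup>+x. lost (X n) x \<partial>lborel) \<longlonglongrightarrow> (\<integral>\<^sup>+(x::'a). 0 \<partial>lborel)"
  proof (rule nn_integral_dominated_convergence[where w="indicator U"])
    show "AE x in lborel. ennreal (lost (X n) x) \<le> indicator U x" for n
      by (auto simp: lost_def ennreal_neg split: split_indicator)
    show "AE x in lborel. (\<lambda>n. ennreal (lost (X n) x)) \<longlonglongrightarrow> 0"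
    proof (rule AE_I2)
      fix x
      show "(\<lambda>n. ennreal (lost (X n) x)) \<longlonglongrightarrow> 0"
      proof (cases "x \<in> U")
        case True
        have "(\<lambda>n. x + X n) \<longlonglongrightarrow> x + 0" by (intro tendsto_intros X)
        then have "\<forall>\<^sub>F n in sequentially. x + X n \<in> U"
          using U True by (simp add: topological_tendstoD)
        then have "\<forall>\<^sub>F n in sequentially. ennreal (lost (X n) x) = 0"
          by eventually_elim (simp add: lost_def True)
        then show ?thesis by (simp add: tendsto_eventually)
      qed (simp add: lost_def)
    qed
  qed (use finite in auto)
  then have "(\<lambda>n. ennreal (norm c * 2) * (\<integral>\<^sup>+x. lost (X n) x \<partial>lborel)) \<longlonglongrightarrow> ennreal (norm c * 2) * 0"
    by (intro ennreal_tendsto_cmult) auto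
  then show ?thesis using finite by (simp add: L1_modulus_indicator lost_def)
qed

lemma L1_modulus_indicator_tendsto_0:
  fixes c :: "'b::{banach, second_countable_topology}"
  assumes A: "A \<in> sets borel" and finite: "emeasure lborel A < \<infinity>"
    and X: "X \<longlonglongrightarrow> (0::'a::euclidean_space)"
  shows "(\<lambda>n. L1_modulus (\<lambda>x. indicator A x *\<^sub>R c) (X n)) \<longlonglongrightarrow> 0"
proof (rule L1_modulus_tendsto_0_approx)
  show "(\<lambda>x. indicator A x *\<^sub>R c) \<in> borel_measurable borel" using A by measurable
  fix e :: real assume e: "e > 0"
  define e' where "e' = e / (norm c + 1)"
  have e': "e' > 0" "norm c * e' \<le> e"
    using e by (auto simp: e'_def field_simps add_pos_nonneg intro: less_imp_le)
  obtain U where U: "open U" "A \<subseteq> U" "emeasure lborel (U - A) < ennreal e'"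
    using outer_regular_lborel[of A e'] e' A by auto
  then have [measurable]: "U \<in> sets borel" "A \<in> sets borel" using A by auto
  have "emeasure lborel U = emeasure lborel ((U - A) \<union> A)"
    using U(2) by (simp add: Un_absorb2)
  also have "\<dots> \<le> emeasure lborel (U - A) + emeasure lborel A"
    by (rule emeasure_subadditive) auto
  also have "\<dots> < \<infinity>"
    using less_trans[OF U(3) ennreal_less_top] finite by simp
  finally have "(\<lambda>n. L1_modulus (\<lambda>x. indicator U x *\<^sub>R c) (X n)) \<longlonglongrightarrow> 0"
    by (rule L1_modulus_open_tendsto_0[OF U(1) _ X])
  moreover have "(\<integral>\<^sup>+x. norm (indicator U x *\<^sub>R c - indicator A x *\<^sub>R c) \<partial>lborel) \<le> ennreal e"
  proof -
    have "(\<integral>\<^sup>+x. norm (indicator U x *\<^sub>R c - indicator A x *\<^sub>R c) \<partial>lborel) =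
        (\<integral>\<^sup>+x. ennreal (norm c) * indicator (U - A) x \<partial>lborel)"
      using U(2) by (intro nn_integral_cong) (auto split: split_indicator)
    also have "\<dots> \<le> ennreal (norm c) * ennreal e'"
      using U(3) by (simp add: nn_integral_cmult mult_left_mono)
    also have "\<dots> \<le> ennreal e" using e' by (simp add: ennreal_leI flip: ennreal_mult)
    finally show ?thesis .
  qed
  moreover have "(\<lambda>x. indicator U x *\<^sub>R c) \<in> borel_measurable borel" by measurable
  ultimately show "\<exists>g. g \<in> borel_measurable borel \<and>
      (\<integral>\<^sup>+x. norm (g x - indicator A x *\<^sub>R c) \<partial>lborel) \<le> ennreal e \<and>
      (\<lambda>n. L1_modulus g (X n)) \<longlonglongrightarrow> 0"
    by blast
qed

theorem L1_modulus_tendsto_0: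
  fixes f :: "'a::euclidean_space \<Rightarrow> 'b::{banach, second_countable_topology}"
  assumes f: "integrable lborel f" and X: "X \<longlonglongrightarrow> 0"
  shows "(\<lambda>n. L1_modulus f (X n)) \<longlonglongrightarrow> 0"
  using f
proof (induct rule: integrable_induct)
  case (base A c)
  then show ?case by (intro L1_modulus_indicator_tendsto_0 X) auto
next
  case (add f g)
  then have "(\<lambda>n. L1_modulus f (X n) + L1_modulus g (X n)) \<longlonglongrightarrow> 0 + 0"
    by (intro tendsto_add)
  then have sum_lim: "(\<lambda>n. L1_modulus f (X n) + L1_modulus g (X n)) \<longlonglongrightarrow> 0" by simp
  show ?case
    by (rule tendsto_sandwich[OF _ _ tendsto_const sum_lim])
       (use add in \<open>auto intro!: always_eventually L1_modulus_add_le\<close>)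
next
  case (lim f s)
  show ?case
  proof (rule L1_modulus_tendsto_0_approx)
    show "f \<in> borel_measurable borel" using lim by auto
    fix e :: real assume e: "e > 0"
    have "(\<lambda>i. \<integral>\<^sup>+x. norm (f x - s i x) \<partial>lborel) \<longlonglongrightarrow> 0"
    proof (rule nn_integral_dominated_convergence_norm[where w="\<lambda>x. 2 * norm (f x)"])
      show "(\<integral>\<^sup>+x. ennreal (2 * norm (f x)) \<partial>lborel) < \<infinity>"
        using lim(5)
        by (auto simp: integrable_iff_bounded ennreal_mult nn_integral_cmult ennreal_mult_less_top)
    qed (use lim in auto)
    then have "\<forall>\<^sub>F i in sequentially. (\<integral>\<^sup>+x. norm (f x - s i x) \<partial>lborel) < ennreal e"
      using order_tendstoD(2)[of _ 0 sequentially "ennreal e"] e by simp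
    then obtain i where "(\<integral>\<^sup>+x. norm (f x - s i x) \<partial>lborel) < ennreal e"
      using eventually_happens by fastforce
    then show "\<exists>g. g \<in> borel_measurable borel \<and> (\<integral>\<^sup>+x. norm (g x - f x) \<partial>lborel) \<le> ennreal e \<and>
        (\<lambda>n. L1_modulus g (X n)) \<longlonglongrightarrow> 0"
      using lim by (intro exI[of _ "s i"]) (auto simp: norm_minus_commute)
  qed
qed

lemma L1_dist_convolution_le:
  fixes f k :: "'a::euclidean_space \<Rightarrow> complex"
  assumes f: "integrable lborel f" and k: "integrable lborel k"
    and k_mass: "(LINT w|lborel. k w) = 1"
  shows "(\<integral>\<^sup>+x. norm ((LINT w|lborel. f (x + r *\<^sub>R w) * k w) - f x) \<partial>lborel)
    \<le> (\<integral>\<^sup>+w. norm (k w) * L1_modulus f (r *\<^sub>R w) \<partial>lborel)"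
proof -
  have [measurable]: "f \<in> borel_measurable borel" "k \<in> borel_measurable borel" using f k by auto
  have "AE x in lborel. integrable lborel (\<lambda>w. f (x + r *\<^sub>R w) * k w)"
    by (rule lborel_pair.AE_integrable_snd) (rule integrable_pair_translate[OF f k])
  then have "AE x in lborel. ennreal (norm ((LINT w|lborel. f (x + r *\<^sub>R w) * k w) - f x)) \<le>
      (\<integral>\<^sup>+w. norm (k w) * ennreal (norm (f (x + r *\<^sub>R w) - f x)) \<partial>lborel)"
  proof eventually_elim
    case (elim x)
    have "(LINT w|lborel. f (x + r *\<^sub>R w) * k w) - f x =
        (LINT w|lborel. f (x + r *\<^sub>R w) * k w) - (LINT w|lborel. f x * k w)"
      by (simp add: k_mass)
    also have "\<dots> = (LINT w|lborel. (f (x + r *\<^sub>R w) - f x) * k w)"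
      using elim k by (simp add: left_diff_distrib)
    finally have "ennreal (norm ((LINT w|lborel. f (x + r *\<^sub>R w) * k w) - f x)) \<le>
        (\<integral>\<^sup>+w. norm ((f (x + r *\<^sub>R w) - f x) * k w) \<partial>lborel)"
      by (simp only: integral_norm_bound_nn_integral)
    also have "\<dots> = (\<integral>\<^sup>+w. norm (k w) * ennreal (norm (f (x + r *\<^sub>R w) - f x)) \<partial>lborel)"
      by (simp add: norm_mult ennreal_mult' mult.commute)
    finally show ?case .
  qed
  then have "(\<integral>\<^sup>+x. norm ((LINT w|lborel. f (x + r *\<^sub>R w) * k w) - f x) \<partial>lborel) \<le>
      (\<integral>\<^sup>+x. \<integral>\<^sup>+w. norm (k w) * ennreal (norm (f (x + r *\<^sub>R w) - f x)) \<partial>lborel \<partial>lborel)"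
    by (rule nn_integral_mono_AE)
  also have "\<dots> = (\<integral>\<^sup>+w. \<integral>\<^sup>+x. norm (k w) * ennreal (norm (f (x + r *\<^sub>R w) - f x)) \<partial>lborel \<partial>lborel)"
    by (rule lborel_pair.Fubini') measurable
  also have "\<dots> = (\<integral>\<^sup>+w. norm (k w) * L1_modulus f (r *\<^sub>R w) \<partial>lborel)"
    by (simp add: nn_integral_cmult L1_modulus_def)
  finally show ?thesis .
qed

theorem L1_approximate_identity:
  fixes f k :: "'a::euclidean_space \<Rightarrow> complex"
  assumes f: "integrable lborel f" and k: "integrable lborel k"
    and k_mass: "(LINT w|lborel. k w) = 1"
    and r: "r \<longlonglongrightarrow> 0"
  shows "(\<lambda>n. \<integral>\<^sup>+x. norm ((LINT w|lborel. f (x + r n *\<^sub>R w) * k w) - f x) \<partial>lborel) \<longlonglongrightarrow> 0"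
proof -
  have [measurable]: "f \<in> borel_measurable borel" "k \<in> borel_measurable borel" using f k by auto
  have [measurable]: "(\<lambda>w. L1_modulus f (r n *\<^sub>R w)) \<in> borel_measurable borel" for n
    unfolding L1_modulus_def by measurable
  have "(\<lambda>n. \<integral>\<^sup>+w. norm (k w) * L1_modulus f (r n *\<^sub>R w) \<partial>lborel) \<longlonglongrightarrow> (\<integral>\<^sup>+(w::'a). 0 \<partial>lborel)"
  proof (rule nn_integral_dominated_convergence[
        where w="\<lambda>w. norm (k w) * (2 * (\<integral>\<^sup>+x. norm (f x) \<partial>lborel))"])
    show "AE w in lborel. norm (k w) * L1_modulus f (r n *\<^sub>R w)
        \<le> norm (k w) * (2 * (\<integral>\<^sup>+x. norm (f x) \<partial>lborel))" for n
      by (intro AE_I2 mult_left_mono L1_modulus_le_norm) auto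
    show "(\<integral>\<^sup>+w. norm (k w) * (2 * (\<integral>\<^sup>+x. norm (f x) \<partial>lborel)) \<partial>lborel) < \<infinity>"
      using f k by (simp add: integrable_iff_bounded nn_integral_multc ennreal_mult_less_top)
    show "AE w in lborel. (\<lambda>n. norm (k w) * L1_modulus f (r n *\<^sub>R w)) \<longlonglongrightarrow> 0"
    proof (rule AE_I2)
      fix w :: 'a
      have "(\<lambda>n. r n *\<^sub>R w) \<longlonglongrightarrow> 0 *\<^sub>R w" by (rule tendsto_scaleR[OF r tendsto_const])
      then have "(\<lambda>n. L1_modulus f (r n *\<^sub>R w)) \<longlonglongrightarrow> 0" by (intro L1_modulus_tendsto_0 f) simp
      then have "(\<lambda>n. norm (k w) * L1_modulus f (r n *\<^sub>R w)) \<longlonglongrightarrow> ennreal (norm (k w)) * 0"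
        by (intro ennreal_tendsto_cmult) auto
      then show "(\<lambda>n. norm (k w) * L1_modulus f (r n *\<^sub>R w)) \<longlonglongrightarrow> 0" by simp
    qed
  qed auto
  then have upper_lim: "(\<lambda>n. \<integral>\<^sup>+w. norm (k w) * L1_modulus f (r n *\<^sub>R w) \<partial>lborel) \<longlonglongrightarrow> 0"
    by simp
  show ?thesis
    by (rule tendsto_sandwich[OF _ _ tendsto_const upper_lim])
       (auto intro!: always_eventually L1_dist_convolution_le[OF f k k_mass])
qed

section \<open>The Fourier transform of integrable functions\<close>

subsection \<open>Elementary properties\<close>

lemma norm_mult_cis [simp]: "cmod (z * cis t) = cmod z"
  by (simp add: norm_mult)

lemma measurable_cis [measurable (raw)]:
  "f \<in> borel_measurable M \<Longrightarrow> (\<lambda>x. cis (f x)) \<in> borel_measurable M"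
  unfolding cis_conv_exp by measurable

lemma measurable_cnj [measurable (raw)]:
  "f \<in> borel_measurable M \<Longrightarrow> (\<lambda>x. cnj (f x)) \<in> borel_measurable M"
  by (rule borel_measurable_continuous_on[where f=cnj]) (auto intro: continuous_intros)

lemma integrable_bounded_mult:
  fixes g h :: "'a \<Rightarrow> 'b::{banach, real_normed_algebra, second_countable_topology}"
  assumes h: "integrable M h" and [measurable]: "g \<in> borel_measurable M"
    and bounded: "\<And>x. norm (g x) \<le> B"
  shows "integrable M (\<lambda>x. g x * h x)"
proof (rule Bochner_Integration.integrable_bound)
  show "integrable M (\<lambda>x. B * norm (h x))" using h by simp
  show "(\<lambda>x. g x * h x) \<in> borel_measurable M" using h by measurable
  have "norm (g x * h x) \<le> B * norm (h x)" for x
    by (rule order_trans[OF norm_mult_ineq mult_right_mono[OF bounded]]) simp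
  then show "AE x in M. norm (g x * h x) \<le> norm (B * norm (h x))"
    by (auto intro: order_trans[OF _ abs_ge_self])
qed

lemma integrable_mult_cis:
  "integrable M h \<Longrightarrow> t \<in> borel_measurable M \<Longrightarrow> integrable M (\<lambda>\<xi>. h \<xi> * cis (t \<xi>))"
  by (rule Bochner_Integration.integrable_bound[of _ h]) auto

lemma fourier_measurable [measurable]:
  assumes [measurable]: "h \<in> borel_measurable borel"
  shows "fourier h \<in> borel_measurable borel"
  unfolding fourier_def by measurable

lemma norm_fourier_le: "ennreal (cmod (fourier h x)) \<le> (\<integral>\<^sup>+\<xi>. cmod (h \<xi>) \<partial>lborel)"
  using integral_norm_bound_nn_integral[of lborel "\<lambda>\<xi>. h \<xi> * cis (- 2 * pi * (x \<bullet> \<xi>))"]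
  by (simp add: fourier_def)

lemma norm_fourier_le_integral: "cmod (fourier h x) \<le> (LINT \<xi>|lborel. cmod (h \<xi>))"
  using integral_norm_bound[of lborel "\<lambda>\<xi>. h \<xi> * cis (- 2 * pi * (x \<bullet> \<xi>))"]
  by (simp add: fourier_def)

lemma fourier_add:
  "integrable lborel f \<Longrightarrow> integrable lborel g \<Longrightarrow>
    fourier (\<lambda>\<xi>. f \<xi> + g \<xi>) x = fourier f x + fourier g x"
  by (simp add: fourier_def distrib_right integrable_mult_cis)

lemma fourier_diff:
  "integrable lborel f \<Longrightarrow> integrable lborel g \<Longrightarrow>
    fourier (\<lambda>\<xi>. f \<xi> - g \<xi>) x = fourier f x - fourier g x"
  by (simp add: fourier_def left_diff_distrib integrable_mult_cis)

lemma fourier_cmult: "fourier (\<lambda>\<xi>. c * f \<xi>) x = c * fourier f x"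
  by (simp add: fourier_def mult.assoc)

lemma fourier_scale:
  fixes f :: "'a::euclidean_space \<Rightarrow> complex"
  assumes [measurable]: "f \<in> borel_measurable borel" and c: "c > 0"
  shows "fourier (\<lambda>\<xi>. f (c *\<^sub>R \<xi>)) x = complex_of_real (c powr - real DIM('a)) * fourier f (x /\<^sub>R c)"
proof -
  have "fourier f (x /\<^sub>R c) = \<bar>c\<bar> ^ DIM('a) *\<^sub>R
      (LINT \<xi>|lborel. f (0 + c *\<^sub>R \<xi>) * cis (- 2 * pi * ((x /\<^sub>R c) \<bullet> (0 + c *\<^sub>R \<xi>))))"
    unfolding fourier_def by (rule integral_lborel_affine) (use c in auto)
  also have "\<dots> = complex_of_real (c ^ DIM('a)) * fourier (\<lambda>\<xi>. f (c *\<^sub>R \<xi>)) x"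
    using c by (simp add: fourier_def scaleR_conv_of_real mult.assoc[symmetric])
  finally show ?thesis
    using c by (simp add: powr_minus powr_realpow)
qed

lemma fourier_modulate: "fourier (\<lambda>\<xi>. f \<xi> * cis (2 * pi * (a \<bullet> \<xi>))) x = fourier f (x - a)"
proof -
  have "cis (2 * pi * (a \<bullet> \<xi>)) * cis (- 2 * pi * (x \<bullet> \<xi>)) = cis (- 2 * pi * ((x - a) \<bullet> \<xi>))" for \<xi>
    by (simp add: cis_mult inner_diff_left algebra_simps)
  then show ?thesis by (simp add: fourier_def mult.assoc)
qed

lemma fourier_translate:
  fixes f :: "'a::euclidean_space \<Rightarrow> complex"
  assumes [measurable]: "f \<in> borel_measurable borel"
  shows "fourier (\<lambda>\<xi>. f (\<xi> + a)) x = cis (2 * pi * (x \<bullet> a)) * fourier f x"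
proof -
  have "cis (- 2 * pi * (x \<bullet> (\<xi> - a))) = cis (2 * pi * (x \<bullet> a)) * cis (- 2 * pi * (x \<bullet> \<xi>))" for \<xi>
    by (simp add: cis_mult inner_diff_right algebra_simps)
  then have "cis (2 * pi * (x \<bullet> a)) * fourier f x =
      (LINT \<xi>|lborel. f \<xi> * cis (- 2 * pi * (x \<bullet> (\<xi> - a))))"
    by (simp add: fourier_def mult.left_commute flip: integral_mult_right_zero)
  also have "\<dots> = (LINT \<xi>|lborel. f (\<xi> + a) * cis (- 2 * pi * (x \<bullet> (\<xi> + a - a))))"
    by (rule integral_lborel_translate[symmetric]) measurable
  finally show ?thesis by (simp add: fourier_def)
qed

lemma radialD: "radial f \<Longrightarrow> norm x = norm y \<Longrightarrow> f x = f y"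
  unfolding radial_def by blast

lemma fourier_radial:
  fixes f :: "'a::euclidean_space \<Rightarrow> complex"
  assumes [measurable]: "f \<in> borel_measurable borel" and f: "radial f"
  shows "radial (fourier f)"
  unfolding radial_def
proof (intro allI impI)
  fix x y :: 'a assume "norm x = norm y"
  then obtain T where T: "orthogonal_transformation T" "T x = y"
    by (rule orthogonal_transformation_swap)
  have "fourier f y = (LINT \<xi>|lborel. f (T \<xi>) * cis (- 2 * pi * (y \<bullet> T \<xi>)))"
    unfolding fourier_def by (rule integral_orthogonal[OF T(1), symmetric]) measurable
  also have "\<dots> = fourier f x"
    unfolding fourier_def
  proof (rule Bochner_Integration.integral_cong[OF refl])
    fix \<xi>
    have "f (T \<xi>) = f \<xi>" by (rule radialD[OF f orthogonal_transformation_norm[OF T(1)]])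
    moreover have "y \<bullet> T \<xi> = x \<bullet> \<xi>" using T by (metis orthogonal_transformation_def)
    ultimately show "f (T \<xi>) * cis (- 2 * pi * (y \<bullet> T \<xi>)) = f \<xi> * cis (- 2 * pi * (x \<bullet> \<xi>))" by simp
  qed
  finally show "fourier f x = fourier f y" by simp
qed

lemma fourier_multiplication_formula:
  fixes f g :: "'a::euclidean_space \<Rightarrow> complex"
  assumes f: "integrable lborel f" and g: "integrable lborel g"
  shows "(LINT x|lborel. fourier f x * g x) = (LINT \<xi>|lborel. f \<xi> * fourier g \<xi>)"
proof -
  have [measurable]: "f \<in> borel_measurable borel" "g \<in> borel_measurable borel" using f g by auto
  have "(LINT x|lborel. fourier f x * g x) =
      (LINT x|lborel. LINT \<xi>|lborel. f \<xi> * cis (- 2 * pi * (x \<bullet> \<xi>)) * g x)"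
    by (simp add: fourier_def)
  also have "\<dots> = (LINT \<xi>|lborel. LINT x|lborel. f \<xi> * cis (- 2 * pi * (x \<bullet> \<xi>)) * g x)"
  proof (rule lborel_pair.Fubini_integral[symmetric], rule lborel_integrable_pairI)
    have "(\<integral>\<^sup>+x. \<integral>\<^sup>+\<xi>. norm (f \<xi> * cis (- 2 * pi * (x \<bullet> \<xi>)) * g x) \<partial>lborel \<partial>lborel) =
        (\<integral>\<^sup>+\<xi>. norm (f \<xi>) \<partial>lborel) * (\<integral>\<^sup>+x. norm (g x) \<partial>lborel)"
      by (simp add: norm_mult ennreal_mult nn_integral_multc nn_integral_cmult)
    also have "\<dots> < \<infinity>" using f g by (simp add: integrable_iff_bounded ennreal_mult_less_top)
    finally show "(\<integral>\<^sup>+x. \<integral>\<^sup>+\<xi>. norm (f \<xi> * cis (- 2 * pi * (x \<bullet> \<xi>)) * g x) \<partial>lborel \<partial>lborel) < \<infinity>" .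
  qed measurable
  also have "\<dots> = (LINT \<xi>|lborel. f \<xi> * (LINT x|lborel. g x * cis (- 2 * pi * (\<xi> \<bullet> x))))"
    by (simp add: mult.assoc mult.commute[of "cis _"] inner_commute)
  finally show ?thesis by (simp add: fourier_def)
qed

lemma fourier_mult_cnj_fourier:
  fixes g h :: "'a::euclidean_space \<Rightarrow> complex"
  assumes g: "integrable lborel g" and h: "integrable lborel h"
  shows "fourier (\<lambda>x. g x * cnj (fourier h x)) \<xi> =
    cnj (LINT \<eta>|lborel. h \<eta> * fourier (\<lambda>x. cnj (g x)) (\<eta> - \<xi>))"
proof -
  have modulated: "integrable lborel (\<lambda>x. cnj (g x) * cis (2 * pi * (\<xi> \<bullet> x)))"
    using g by (intro integrable_mult_cis) auto
  have "fourier (\<lambda>x. g x * cnj (fourier h x)) \<xi> =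
      (LINT x|lborel. cnj (fourier h x * (cnj (g x) * cis (2 * pi * (\<xi> \<bullet> x)))))"
    by (simp add: fourier_def[of _ \<xi>] cis_cnj mult_ac)
  also have "\<dots> = cnj (LINT x|lborel. fourier h x * (cnj (g x) * cis (2 * pi * (\<xi> \<bullet> x))))"
    by (rule Bochner_Integration.integral_cnj)
  finally show ?thesis
    by (simp add: fourier_multiplication_formula[OF h modulated] fourier_modulate)
qed

subsection \<open>Gaussians\<close>

lemma std_normal_fourier:
  "has_bochner_integral lborel (\<lambda>y. std_normal_density y *\<^sub>R cis (t * y))
    (complex_of_real (exp (- (t\<^sup>2) / 2)))"
proof -
  have "integrable lborel (\<lambda>y. std_normal_density y *\<^sub>R cis (t * y))"
    by (rule Bochner_Integration.integrable_bound[OF integrable_std_normal_moment[of 0]])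
       (auto simp: normal_density_nonneg)
  moreover have "char std_normal_distribution t =
      (LINT y|lborel. std_normal_density y *\<^sub>R cis (t * y))"
    unfolding char_def by (subst integral_density) (auto simp: normal_density_nonneg cis_conv_exp)
  ultimately show ?thesis
    by (simp add: has_bochner_integral_iff char_std_normal_distribution)
qed

lemma gaussian_fourier_real:
  fixes e x :: real
  assumes e: "e > 0"
  shows "has_bochner_integral lborel
    (\<lambda>t. complex_of_real (exp (- pi * e\<^sup>2 * t\<^sup>2)) * cis (- 2 * pi * (x * t)))
    (complex_of_real (exp (- pi * x\<^sup>2 / e\<^sup>2) / e))"
proof -
  define c where "c = sqrt (2 * pi) * e"
  define \<tau> where "\<tau> = - 2 * pi * x / c"
  define F where "F y = std_normal_density y *\<^sub>R cis (\<tau> * y)" for y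
  have c: "c > 0" using e by (simp add: c_def)
  have "has_bochner_integral lborel F (complex_of_real (exp (- (\<tau>\<^sup>2) / 2)))"
    unfolding F_def by (rule std_normal_fourier)
  then have "has_bochner_integral lborel (\<lambda>t. F (0 + c * t))
      (complex_of_real (exp (- (\<tau>\<^sup>2) / 2)) /\<^sub>R \<bar>c\<bar>)"
    using c by (subst (asm) lborel_has_bochner_integral_real_affine_iff[of c _ _ 0]) auto
  then have "has_bochner_integral lborel (\<lambda>t. complex_of_real (sqrt (2 * pi)) * F (c * t))
      (complex_of_real (sqrt (2 * pi)) * (complex_of_real (exp (- (\<tau>\<^sup>2) / 2)) /\<^sub>R \<bar>c\<bar>))"
    by (intro has_bochner_integral_mult_right) auto
  moreover have "complex_of_real (sqrt (2 * pi)) * F (c * t) =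
      complex_of_real (exp (- pi * e\<^sup>2 * t\<^sup>2)) * cis (- 2 * pi * (x * t))" for t
  proof -
    have "\<tau> * (c * t) = - 2 * pi * (x * t)" using c by (simp add: \<tau>_def)
    moreover have "sqrt (2 * pi) * std_normal_density (c * t) = exp (- pi * e\<^sup>2 * t\<^sup>2)"
      by (simp add: std_normal_density_def c_def power_mult_distrib real_sqrt_mult field_simps)
    ultimately show ?thesis unfolding F_def scaleR_conv_of_real
      by (metis mult.assoc of_real_mult)
  qed
  moreover have "complex_of_real (sqrt (2 * pi)) * (complex_of_real (exp (- (\<tau>\<^sup>2) / 2)) /\<^sub>R \<bar>c\<bar>) =
      complex_of_real (exp (- pi * x\<^sup>2 / e\<^sup>2) / e)"
  proof -
    have "\<tau>\<^sup>2 / 2 = pi * x\<^sup>2 / e\<^sup>2"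
      using e by (simp add: \<tau>_def c_def power_mult_distrib power_divide power2_eq_square
          field_simps)
    then have "exp (- (\<tau>\<^sup>2) / 2) = exp (- pi * x\<^sup>2 / e\<^sup>2)" by simp
    moreover have "sqrt (2 * pi) / \<bar>c\<bar> = 1 / e" using e by (simp add: c_def)
    ultimately have "sqrt (2 * pi) * (exp (- (\<tau>\<^sup>2) / 2) / \<bar>c\<bar>) = exp (- pi * x\<^sup>2 / e\<^sup>2) / e"
      by (metis (no_types, lifting) mult.commute mult_1 times_divide_eq_left times_divide_eq_right)
    then show ?thesis
      unfolding scaleR_conv_of_real of_real_mult[symmetric] of_real_eq_iff
      by (simp add: field_simps)
  qed
  ultimately show ?thesis by simp
qed

lemma has_bochner_integral_lborel_prod:
  fixes f :: "'a::euclidean_space \<Rightarrow> real \<Rightarrow> 'b::{real_normed_field, banach, second_countable_topology}"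
  assumes "\<And>b. b \<in> Basis \<Longrightarrow> has_bochner_integral lborel (f b) (I b)"
  shows "has_bochner_integral lborel (\<lambda>x. \<Prod>b\<in>Basis. f b (x \<bullet> b)) (\<Prod>b\<in>Basis. I b)"
proof -
  interpret product_sigma_finite "\<lambda>b::'a. lborel :: real measure" ..
  have f: "integrable lborel (f b)" "integral\<^sup>L lborel (f b) = I b" if "b \<in> Basis" for b
    using assms[OF that] by (auto simp: has_bochner_integral_iff)
  then have [measurable]: "f b \<in> borel_measurable borel" if "b \<in> Basis" for b
    using that by auto
  have coords: "(\<lambda>g. \<Sum>b\<in>Basis. g b *\<^sub>R b) \<in> (\<Pi>\<^sub>M b\<in>Basis. lborel) \<rightarrow>\<^sub>M (borel :: 'a measure)"
    and prod_meas: "(\<lambda>x. \<Prod>b\<in>Basis. f b (x \<bullet> b)) \<in> borel_measurable (borel :: 'a measure)"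
    by measurable
  have prod_coords: "(\<Prod>b\<in>Basis. f b ((\<Sum>c\<in>Basis. g c *\<^sub>R c) \<bullet> b)) = (\<Prod>b\<in>Basis. f b (g b))" for g
    by (intro prod.cong) auto
  have "integrable (\<Pi>\<^sub>M b\<in>Basis. lborel) (\<lambda>g. \<Prod>b\<in>(Basis :: 'a set). f b (g b))"
    by (rule product_integrable_prod) (use f in auto)
  moreover have "integral\<^sup>L (\<Pi>\<^sub>M b\<in>Basis. lborel) (\<lambda>g. \<Prod>b\<in>(Basis :: 'a set). f b (g b)) =
      (\<Prod>b\<in>Basis. I b)"
    by (subst product_integral_prod) (use f in auto)
  ultimately show ?thesis
    unfolding has_bochner_integral_iff
    by (subst (1 2) lborel_eq)
       (simp add: integrable_distr_eq[OF coords prod_meas] integral_distr[OF coords prod_meas]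
           prod_coords)
qed

definition gaussian :: "real \<Rightarrow> 'a::euclidean_space \<Rightarrow> real" where
  "gaussian e x = exp (- pi * e\<^sup>2 * (norm x)\<^sup>2)"

definition heat_kernel :: "real \<Rightarrow> 'a::euclidean_space \<Rightarrow> real" where
  "heat_kernel e x = gaussian (1 / e) x / e ^ DIM('a)"

lemma gaussian_nonneg [simp]: "gaussian e x \<ge> 0"
  and gaussian_le_1: "gaussian e x \<le> 1"
  and gaussian_0 [simp]: "gaussian e 0 = 1"
  by (auto simp: gaussian_def)

lemma gaussian_measurable [measurable]: "gaussian e \<in> borel_measurable borel"
  unfolding gaussian_def[abs_def] by measurable

lemma heat_kernel_nonneg: "e > 0 \<Longrightarrow> heat_kernel e x \<ge> 0"
  by (simp add: heat_kernel_def)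

lemma heat_kernel_measurable [measurable]: "heat_kernel e \<in> borel_measurable borel"
  unfolding heat_kernel_def[abs_def] by measurable

lemma gaussian_tendsto_1:
  assumes "e \<longlonglongrightarrow> 0"
  shows "(\<lambda>n. gaussian (e n) x) \<longlonglongrightarrow> 1"
proof -
  have "(\<lambda>n. exp (- pi * (e n)\<^sup>2 * (norm x)\<^sup>2)) \<longlonglongrightarrow> exp (- pi * 0\<^sup>2 * (norm x)\<^sup>2)"
    by (intro tendsto_intros assms)
  then show ?thesis by (simp add: gaussian_def)
qed

lemma has_bochner_integral_gaussian_fourier:
  fixes x :: "'a::euclidean_space"
  assumes e: "e > 0"
  shows "has_bochner_integral lborel
    (\<lambda>\<xi>. complex_of_real (gaussian e \<xi>) * cis (- 2 * pi * (x \<bullet> \<xi>)))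
       (complex_of_real (heat_kernel e x))"
proof -
  have norm_square: "(norm z)\<^sup>2 = (\<Sum>b\<in>Basis. (z \<bullet> b)\<^sup>2)" for z :: 'a
    by (simp add: norm_eq_sqrt_inner euclidean_inner[of z z] power2_eq_square sum_nonneg)
  have "has_bochner_integral lborel
      (\<lambda>\<xi>::'a. \<Prod>b\<in>Basis. complex_of_real (exp (- pi * e\<^sup>2 * (\<xi> \<bullet> b)\<^sup>2)) *
        cis (- 2 * pi * ((x \<bullet> b) * (\<xi> \<bullet> b))))
      (\<Prod>b\<in>Basis. complex_of_real (exp (- pi * (x \<bullet> b)\<^sup>2 / e\<^sup>2) / e))"
    by (rule has_bochner_integral_lborel_prod) (rule gaussian_fourier_real[OF e])
  moreover have "(\<Prod>b\<in>Basis. complex_of_real (exp (- pi * e\<^sup>2 * (\<xi> \<bullet> b)\<^sup>2)) *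
        cis (- 2 * pi * ((x \<bullet> b) * (\<xi> \<bullet> b)))) =
      complex_of_real (gaussian e \<xi>) * cis (- 2 * pi * (x \<bullet> \<xi>))" for \<xi>
    by (simp add: gaussian_def norm_square euclidean_inner[of x \<xi>] prod.distrib cis_conv_exp
        exp_sum[symmetric] sum_distrib_left of_real_exp mult_ac exp_of_real[symmetric]
        del: of_real_power)
  moreover have "(\<Prod>b\<in>Basis. complex_of_real (exp (- pi * (x \<bullet> b)\<^sup>2 / e\<^sup>2) / e)) =
      complex_of_real (heat_kernel e x)"
  proof -
    have "(\<Prod>b\<in>Basis. exp (- pi * (x \<bullet> b)\<^sup>2 / e\<^sup>2) / e) = heat_kernel e x"
      by (simp add: heat_kernel_def gaussian_def norm_square prod_dividef exp_sum[symmetric]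
          power_divide sum_distrib_left sum_divide_distrib sum_negf)
    then show ?thesis by (simp only: of_real_prod[symmetric])
  qed
  ultimately show ?thesis by simp
qed

lemma fourier_gaussian:
  assumes "e > 0"
  shows "fourier (\<lambda>\<xi>. complex_of_real (gaussian e \<xi>)) x = complex_of_real (heat_kernel e x)"
  using has_bochner_integral_gaussian_fourier[OF assms, of x]
  by (simp add: fourier_def has_bochner_integral_iff)

lemma
  assumes "e > 0"
  shows integrable_gaussian: "integrable lborel (gaussian e :: 'a::euclidean_space \<Rightarrow> real)"
    and integral_gaussian: "(LINT x|lborel. gaussian e (x::'a)) = 1 / e ^ DIM('a)"
proof -
  have "has_bochner_integral lborel (\<lambda>x::'a. complex_of_real (gaussian e x))
      (complex_of_real (1 / e ^ DIM('a)))"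
    using has_bochner_integral_gaussian_fourier[OF assms, of "0::'a"] by (simp add: heat_kernel_def)
  then show "integrable lborel (gaussian e :: 'a \<Rightarrow> real)"
      and "(LINT x|lborel. gaussian e (x::'a)) = 1 / e ^ DIM('a)"
    by (simp_all add: has_bochner_integral_iff complex_of_real_integrable_eq
        flip: of_real_divide of_real_power)
qed

lemma nn_integral_heat_kernel:
  assumes "e > 0"
  shows "(\<integral>\<^sup>+x. ennreal (heat_kernel e (x::'a::euclidean_space)) \<partial>lborel) = 1"
proof -
  have "(\<integral>\<^sup>+x. ennreal (heat_kernel e (x::'a)) \<partial>lborel) =
      ennreal (LINT x|lborel. heat_kernel e (x::'a))"
    using assms
    by (intro nn_integral_eq_integral) (auto simp: heat_kernel_def integrable_gaussian)
  also have "\<dots> = 1" using assms by (simp add: heat_kernel_def integral_gaussian power_divide)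
  finally show ?thesis .
qed

subsection \<open>Inversion at the origin\<close>

lemma integral_fourier_mult_gaussian:
  fixes h :: "'a::euclidean_space \<Rightarrow> complex"
  assumes h: "integrable lborel h" and e: "e > 0"
  shows "(LINT x|lborel. fourier h x * complex_of_real (gaussian e x)) =
    (LINT w|lborel. h (e *\<^sub>R w) * complex_of_real (gaussian 1 w))"
proof -
  have [measurable]: "h \<in> borel_measurable borel" using h by auto
  have "integrable lborel (\<lambda>x::'a. complex_of_real (gaussian e x))"
    using integrable_gaussian[where 'a='a, OF e] by (simp add: complex_of_real_integrable_eq)
  then have "(LINT x|lborel. fourier h x * complex_of_real (gaussian e x)) =
      (LINT \<xi>|lborel. h \<xi> * complex_of_real (heat_kernel e \<xi>))"
    by (simp add: fourier_multiplication_formula[OF h] fourier_gaussian[OF e])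
  also have "\<dots> = \<bar>e\<bar> ^ DIM('a) *\<^sub>R
      (LINT w|lborel. h (0 + e *\<^sub>R w) * complex_of_real (heat_kernel e (0 + e *\<^sub>R w)))"
    by (rule integral_lborel_affine) (use e in auto)
  also have "\<dots> = (LINT w|lborel. h (e *\<^sub>R w) * complex_of_real (gaussian 1 w))"
    using e by (simp add: heat_kernel_def gaussian_def power_mult_distrib power_divide
        scaleR_conv_of_real)
  finally show ?thesis .
qed

lemma integral_mult_gaussian_tendsto:
  fixes f :: "'a::euclidean_space \<Rightarrow> complex"
  assumes f: "integrable lborel f" and e: "e \<longlonglongrightarrow> 0"
  shows "(\<lambda>n. LINT x|lborel. f x * complex_of_real (gaussian (e n) x)) \<longlonglongrightarrow> (LINT x|lborel. f x)"
proof (rule integral_dominated_convergence[where w="\<lambda>x. cmod (f x)"])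
  have [measurable]: "f \<in> borel_measurable borel" using f by auto
  have "(\<lambda>n. f x * complex_of_real (gaussian (e n) x)) \<longlonglongrightarrow> f x * complex_of_real 1" for x
    by (intro tendsto_mult tendsto_const tendsto_of_real gaussian_tendsto_1 e)
  then show "AE x in lborel. (\<lambda>n. f x * complex_of_real (gaussian (e n) x)) \<longlonglongrightarrow> f x" by simp
  show "AE x in lborel. norm (f x * complex_of_real (gaussian (e n) x)) \<le> cmod (f x)" for n
    by (auto simp: norm_mult gaussian_le_1 intro!: mult_left_le)
  show "(\<lambda>x. f x * complex_of_real (gaussian (e n) x)) \<in> borel_measurable lborel" for n
    by measurable
qed (use f in auto)

lemma integral_dilate_mult_gaussian_tendsto:
  fixes h :: "'a::euclidean_space \<Rightarrow> complex"
  assumes [measurable]: "h \<in> borel_measurable borel"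
    and bounded: "\<And>\<xi>. cmod (h \<xi>) \<le> B" and cont: "isCont h 0" and e: "e \<longlonglongrightarrow> 0"
  shows "(\<lambda>n. LINT w|lborel. h (e n *\<^sub>R w) * complex_of_real (gaussian 1 w)) \<longlonglongrightarrow> h 0"
proof -
  have "(\<lambda>n. LINT w|lborel. h (e n *\<^sub>R w) * complex_of_real (gaussian 1 w)) \<longlonglongrightarrow>
      (LINT w|lborel. h 0 * complex_of_real (gaussian 1 (w::'a)))"
  proof (rule integral_dominated_convergence[where w="\<lambda>w. B * gaussian 1 w"])
    show "integrable lborel (\<lambda>w::'a. B * gaussian 1 w)" by (simp add: integrable_gaussian)
    show "AE w in lborel. (\<lambda>n. h (e n *\<^sub>R w) * complex_of_real (gaussian 1 w)) \<longlonglongrightarrow>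
        h 0 * complex_of_real (gaussian 1 w)"
    proof (rule AE_I2)
      fix w :: 'a
      have "(\<lambda>n. e n *\<^sub>R w) \<longlonglongrightarrow> 0" using tendsto_scaleR[OF e tendsto_const[of w]] by simp
      then show "(\<lambda>n. h (e n *\<^sub>R w) * complex_of_real (gaussian 1 w)) \<longlonglongrightarrow>
          h 0 * complex_of_real (gaussian 1 w)"
        by (intro tendsto_mult tendsto_const isCont_tendsto_compose[OF cont])
    qed
    show "AE w in lborel. norm (h (e n *\<^sub>R w) * complex_of_real (gaussian 1 w)) \<le> B * gaussian 1 w"
      for n
      by (simp add: norm_mult mult_right_mono bounded)
  qed measurable
  then show ?thesis by (simp add: integral_gaussian)
qed

theorem integral_fourier:
  fixes h :: "'a::euclidean_space \<Rightarrow> complex"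
  assumes h: "integrable lborel h" and ft: "integrable lborel (fourier h)"
    and bounded: "\<And>\<xi>. cmod (h \<xi>) \<le> B" and cont: "isCont h 0"
  shows "(LINT x|lborel. fourier h x) = h 0"
proof (rule LIMSEQ_unique)
  define e where "e n = 1 / real (Suc n)" for n
  have e: "e \<longlonglongrightarrow> 0" unfolding e_def by (rule LIMSEQ_Suc[OF lim_1_over_n])
  show "(\<lambda>n. LINT x|lborel. fourier h x * complex_of_real (gaussian (e n) x)) \<longlonglongrightarrow>
      (LINT x|lborel. fourier h x)"
    by (rule integral_mult_gaussian_tendsto[OF ft e])
  have "(LINT x|lborel. fourier h x * complex_of_real (gaussian (e n) x)) =
      (LINT w|lborel. h (e n *\<^sub>R w) * complex_of_real (gaussian 1 w))" for n
    by (rule integral_fourier_mult_gaussian[OF h]) (simp add: e_def)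
  then show "(\<lambda>n. LINT x|lborel. fourier h x * complex_of_real (gaussian (e n) x)) \<longlonglongrightarrow> h 0"
    using integral_dilate_mult_gaussian_tendsto[OF _ bounded cont e] h by simp
qed

subsection \<open>Plancherel's inequality\<close>

lemma gaussian_weighted_energy:
  fixes h :: "'a::euclidean_space \<Rightarrow> complex"
  assumes h: "integrable lborel h" and e: "e > 0"
  shows "(\<integral>\<^sup>+x. gaussian e x * (cmod (fourier h x))\<^sup>2 \<partial>lborel) =
    cmod (LINT \<xi>|lborel. h \<xi> * cnj (LINT \<eta>|lborel. h \<eta> * complex_of_real (heat_kernel e (\<eta> - \<xi>))))"
proof -
  have [measurable]: "h \<in> borel_measurable borel" using h by auto
  have gaussian_int: "integrable lborel (\<lambda>x::'a. complex_of_real (gaussian e x))"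
    using integrable_gaussian[where 'a='a, OF e] by (simp add: complex_of_real_integrable_eq)
  define energy where "energy x = gaussian e x * (cmod (fourier h x))\<^sup>2" for x
  have energy: "complex_of_real (energy x) = fourier h x * (gaussian e x * cnj (fourier h x))" for x
    unfolding energy_def of_real_mult complex_norm_square by (simp only: mult_ac)
  have bounded: "norm (cnj (fourier h x)) \<le> (LINT \<xi>|lborel. cmod (h \<xi>))" for x
    by (simp add: norm_fourier_le_integral)
  have weighted: "integrable lborel (\<lambda>x. gaussian e x * cnj (fourier h x))"
    by (subst mult.commute, rule integrable_bounded_mult[OF gaussian_int _ bounded]) measurable
  have "integrable lborel (\<lambda>x. complex_of_real (energy x))"
    unfolding energy
    by (rule integrable_bounded_mult[OF weighted _ norm_fourier_le_integral]) simp
  then have "(\<integral>\<^sup>+x. energy x \<partial>lborel) = ennreal (LINT x|lborel. energy x)"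
    unfolding complex_of_real_integrable_eq
    by (rule nn_integral_eq_integral) (simp add: energy_def)
  also have "(LINT x|lborel. energy x) = cmod (LINT x|lborel. complex_of_real (energy x))"
    unfolding integral_complex_of_real norm_of_real
    by (intro abs_of_nonneg[symmetric] integral_nonneg_AE AE_I2) (simp add: energy_def)
  also have "\<dots> = cmod (LINT \<xi>|lborel. h \<xi> * fourier (\<lambda>x. gaussian e x * cnj (fourier h x)) \<xi>)"
    unfolding energy by (simp add: fourier_multiplication_formula[OF h weighted])
  finally show ?thesis
    by (simp add: energy_def fourier_mult_cnj_fourier[OF gaussian_int h] fourier_gaussian[OF e])
qed

lemma ennreal_power2_le_imp_le:
  fixes a b :: ennreal
  assumes "a\<^sup>2 \<le> b\<^sup>2"
  shows "a \<le> b"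
proof (cases b)
  case (real r)
  with assms have "a \<noteq> \<infinity>" by (auto simp: ennreal_power top_unique)
  then obtain q where "a = ennreal q" "q \<ge> 0" by (cases a) auto
  then show ?thesis using assms real
    by (auto simp: ennreal_power intro: ennreal_leI power2_le_imp_le)
qed simp

lemma gaussian_weighted_energy_le:
  fixes h :: "'a::euclidean_space \<Rightarrow> complex"
  assumes h: "integrable lborel h" and e: "e > 0"
  shows "(\<integral>\<^sup>+x. gaussian e x * (cmod (fourier h x))\<^sup>2 \<partial>lborel) \<le> (\<integral>\<^sup>+\<xi>. (cmod (h \<xi>))\<^sup>2 \<partial>lborel)"
proof (rule ennreal_power2_le_imp_le)
  have [measurable]: "h \<in> borel_measurable borel" using h by auto
  define g where "g \<xi> = (LINT \<eta>|lborel. h \<eta> * complex_of_real (heat_kernel e (\<eta> - \<xi>)))" for \<xi>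
  have [measurable]: "g \<in> borel_measurable borel" unfolding g_def by measurable
  let ?H = "\<integral>\<^sup>+\<xi>. (cmod (h \<xi>))\<^sup>2 \<partial>lborel"
  have g_le: "ennreal (cmod (g \<xi>)) \<le>
      (\<integral>\<^sup>+z. ennreal (heat_kernel e z) * ennreal (cmod (h (\<xi> + z))) \<partial>lborel)" for \<xi>
  proof -
    have "ennreal (cmod (g \<xi>)) \<le>
        (\<integral>\<^sup>+\<eta>. cmod (h \<eta> * complex_of_real (heat_kernel e (\<eta> - \<xi>))) \<partial>lborel)"
      unfolding g_def by (rule integral_norm_bound_nn_integral)
    also have "\<dots> = (\<integral>\<^sup>+z. cmod (h (z + \<xi>) * complex_of_real (heat_kernel e (z + \<xi> - \<xi>))) \<partial>lborel)"
      by (rule nn_integral_lborel_translate[symmetric]) measurable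
    finally show ?thesis
      using e by (simp add: norm_mult heat_kernel_nonneg ennreal_mult mult.commute add.commute)
  qed
  have "(\<integral>\<^sup>+x. gaussian e x * (cmod (fourier h x))\<^sup>2 \<partial>lborel) = cmod (LINT \<xi>|lborel. h \<xi> * cnj (g \<xi>))"
    unfolding g_def by (rule gaussian_weighted_energy[OF h e])
  also have "\<dots> \<le> (\<integral>\<^sup>+\<xi>. ennreal (cmod (h \<xi>)) * ennreal (cmod (g \<xi>)) \<partial>lborel)"
    using integral_norm_bound_nn_integral[of lborel "\<lambda>\<xi>. h \<xi> * cnj (g \<xi>)"]
    by (simp add: norm_mult ennreal_mult)
  finally have "(\<integral>\<^sup>+x. gaussian e x * (cmod (fourier h x))\<^sup>2 \<partial>lborel)\<^sup>2 \<le>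
      (\<integral>\<^sup>+\<xi>. ennreal (cmod (h \<xi>)) * ennreal (cmod (g \<xi>)) \<partial>lborel)\<^sup>2"
    by (rule power_mono) simp
  also have "\<dots> \<le> (\<integral>\<^sup>+\<xi>. (ennreal (cmod (h \<xi>)))\<^sup>2 \<partial>lborel) * (\<integral>\<^sup>+\<xi>. (ennreal (cmod (g \<xi>)))\<^sup>2 \<partial>lborel)"
    by (rule Cauchy_Schwarz_nn_integral) measurable
  also have "(\<integral>\<^sup>+\<xi>. (ennreal (cmod (g \<xi>)))\<^sup>2 \<partial>lborel) \<le>
      (\<integral>\<^sup>+\<xi>. (\<integral>\<^sup>+z. ennreal (heat_kernel e z) * ennreal (cmod (h (\<xi> + z))) \<partial>lborel)\<^sup>2 \<partial>lborel)"
    by (intro nn_integral_mono power_mono g_le) simp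
  also have "\<dots> \<le> (\<integral>\<^sup>+z. ennreal (heat_kernel e (z::'a)) \<partial>lborel)\<^sup>2 *
      (\<integral>\<^sup>+x. (ennreal (cmod (h x)))\<^sup>2 \<partial>lborel)"
    by (rule nn_integral_convolution_square_le) measurable
  finally show "(\<integral>\<^sup>+x. gaussian e x * (cmod (fourier h x))\<^sup>2 \<partial>lborel)\<^sup>2 \<le> ?H\<^sup>2"
    by (simp add: nn_integral_heat_kernel[OF e] ennreal_power power2_eq_square[of ?H]
        mult_left_mono)
qed

theorem plancherel_le:
  fixes h :: "'a::euclidean_space \<Rightarrow> complex"
  assumes h: "integrable lborel h"
  shows "(\<integral>\<^sup>+x. (cmod (fourier h x))\<^sup>2 \<partial>lborel) \<le> (\<integral>\<^sup>+\<xi>. (cmod (h \<xi>))\<^sup>2 \<partial>lborel)"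
proof -
  have [measurable]: "h \<in> borel_measurable borel" using h by auto
  define weighted where
    "weighted n x = ennreal (gaussian (1 / real (Suc n)) x * (cmod (fourier h x))\<^sup>2)" for n x
  have "(\<lambda>n. weighted n x) \<longlonglongrightarrow> ennreal (1 * (cmod (fourier h x))\<^sup>2)" for x
    unfolding weighted_def
    by (intro tendsto_ennrealI tendsto_mult tendsto_const gaussian_tendsto_1
        LIMSEQ_Suc[OF lim_1_over_n])
  then have "(\<integral>\<^sup>+x. (cmod (fourier h x))\<^sup>2 \<partial>lborel) = (\<integral>\<^sup>+x. liminf (\<lambda>n. weighted n x) \<partial>lborel)"
    by (intro nn_integral_cong lim_imp_Liminf[symmetric]) simp_all
  also have "\<dots> \<le> liminf (\<lambda>n. \<integral>\<^sup>+x. weighted n x \<partial>lborel)"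
    unfolding weighted_def by (rule nn_integral_liminf) simp
  also have "\<dots> \<le> (\<integral>\<^sup>+\<xi>. (cmod (h \<xi>))\<^sup>2 \<partial>lborel)"
    unfolding weighted_def
    by (rule Liminf_le) (auto intro!: always_eventually gaussian_weighted_energy_le[OF h])
  finally show ?thesis .
qed

section \<open>Local \<open>L\<^sup>p\<close> quantities\<close>

definition lp_pow_on :: "'a::euclidean_space set \<Rightarrow> real \<Rightarrow> ('a \<Rightarrow> complex) \<Rightarrow> ennreal" where
  "lp_pow_on S p u = (\<integral>\<^sup>+x\<in>S. ennreal (cmod (u x) powr p) \<partial>lborel)"

lemma lp_pow_on_UNIV: "lp_pow_on UNIV p u = lp_pow p u"
  by (simp add: lp_pow_on_def lp_pow_def)

lemma lp_pow_on_mono: "S \<subseteq> T \<Longrightarrow> lp_pow_on S p u \<le> lp_pow_on T p u"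
  unfolding lp_pow_on_def by (intro nn_integral_mono) (auto split: split_indicator)

lemma powr_le_add_powr:
  fixes a b M p q :: real
  assumes "0 \<le> a" "a \<le> b + M" "0 \<le> b" "0 \<le> M" "0 \<le> q" "q \<le> p"
  shows "a powr p \<le> 2 powr p * b powr p + (2 * M) powr (p - q) * a powr q"
proof (cases "a \<le> 2 * b")
  case True
  then have "a powr p \<le> (2 * b) powr p" using assms by (intro powr_mono2) auto
  then show ?thesis by (simp add: powr_mult add_increasing2)
next
  case False
  then have "a powr (p - q) \<le> (2 * M) powr (p - q)" using assms by (intro powr_mono2) auto
  then have "a powr (p - q) * a powr q \<le> (2 * M) powr (p - q) * a powr q"
    by (rule mult_right_mono) simp
  then have "a powr p \<le> (2 * M) powr (p - q) * a powr q" by (simp add: powr_add[symmetric])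
  then show ?thesis by (rule add_increasing[rotated]) simp
qed

lemma lp_pow_on_le_if_near:
  fixes u v :: "'a::euclidean_space \<Rightarrow> complex"
  assumes [measurable]: "u \<in> borel_measurable borel" "v \<in> borel_measurable borel" "S \<in> sets borel"
    and near: "\<And>x. x \<in> S \<Longrightarrow> cmod (u x) \<le> cmod (v x) + M" and "0 \<le> M" "0 \<le> q" "q \<le> p"
  shows "lp_pow_on S p u \<le>
    ennreal (2 powr p) * lp_pow p v + ennreal ((2 * M) powr (p - q)) * lp_pow_on S q u"
proof -
  have "lp_pow_on S p u \<le> (\<integral>\<^sup>+x. ennreal (2 powr p) * ennreal (cmod (v x) powr p) +
      ennreal ((2 * M) powr (p - q)) * (ennreal (cmod (u x) powr q) * indicator S x) \<partial>lborel)"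
    unfolding lp_pow_on_def
  proof (rule nn_integral_mono)
    fix x
    show "ennreal (cmod (u x) powr p) * indicator S x \<le>
        ennreal (2 powr p) * ennreal (cmod (v x) powr p) +
        ennreal ((2 * M) powr (p - q)) * (ennreal (cmod (u x) powr q) * indicator S x)"
    proof (cases "x \<in> S")
      case True
      have "ennreal (cmod (u x) powr p) \<le>
          ennreal (2 powr p * cmod (v x) powr p + (2 * M) powr (p - q) * cmod (u x) powr q)"
        by (intro ennreal_leI powr_le_add_powr near True assms) auto
      then show ?thesis using True by (simp add: ennreal_mult)
    qed simp
  qed
  then show ?thesis
    by (simp add: nn_integral_add nn_integral_cmult lp_pow_def lp_pow_on_def)
qed

lemma powr_interpolate:
  fixes a \<mu> p q r :: real
  assumes a: "0 \<le> a" and \<mu>: "0 < \<mu>" and exponents: "q \<le> p" "p \<le> r"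
  shows "a powr p \<le> \<mu> powr (p - r) * a powr r + \<mu> powr (p - q) * a powr q"
proof (cases "\<mu> \<le> a")
  case True
  then have "a powr (p - r) \<le> \<mu> powr (p - r)" using \<mu> exponents by (intro powr_mono2') auto
  then have "a powr (p - r) * a powr r \<le> \<mu> powr (p - r) * a powr r" by (rule mult_right_mono) simp
  then show ?thesis by (simp add: powr_add[symmetric] add_increasing2)
next
  case False
  then have "a powr (p - q) \<le> \<mu> powr (p - q)" using a exponents by (intro powr_mono2) auto
  then have "a powr (p - q) * a powr q \<le> \<mu> powr (p - q) * a powr q" by (rule mult_right_mono) simp
  then show ?thesis by (simp add: powr_add[symmetric] add_increasing)
qed

lemma lp_pow_on_interpolate:
  fixes u :: "'a::euclidean_space \<Rightarrow> complex"
  assumes [measurable]: "u \<in> borel_measurable borel" "S \<in> sets borel" and \<mu>: "0 < \<mu>"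
    and exponents: "q \<le> p" "p \<le> r"
    and bounds: "lp_pow_on S r u \<le> ennreal X" "0 \<le> X" "lp_pow_on S q u \<le> ennreal Y" "0 \<le> Y"
  shows "lp_pow_on S p u \<le> ennreal (\<mu> powr (p - r) * X + \<mu> powr (p - q) * Y)"
proof -
  have "lp_pow_on S p u \<le>
      (\<integral>\<^sup>+x. ennreal (\<mu> powr (p - r)) * (ennreal (cmod (u x) powr r) * indicator S x) +
      ennreal (\<mu> powr (p - q)) * (ennreal (cmod (u x) powr q) * indicator S x) \<partial>lborel)"
    unfolding lp_pow_on_def
  proof (rule nn_integral_mono)
    fix x
    have "ennreal (cmod (u x) powr p) \<le>
        ennreal (\<mu> powr (p - r) * cmod (u x) powr r + \<mu> powr (p - q) * cmod (u x) powr q)"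
      by (intro ennreal_leI powr_interpolate \<mu> exponents) simp
    then show "ennreal (cmod (u x) powr p) * indicator S x \<le>
        ennreal (\<mu> powr (p - r)) * (ennreal (cmod (u x) powr r) * indicator S x) +
        ennreal (\<mu> powr (p - q)) * (ennreal (cmod (u x) powr q) * indicator S x)"
      by (auto simp: ennreal_mult split: split_indicator)
  qed
  also have "\<dots> = ennreal (\<mu> powr (p - r)) * lp_pow_on S r u +
      ennreal (\<mu> powr (p - q)) * lp_pow_on S q u"
    by (simp add: nn_integral_add nn_integral_cmult lp_pow_on_def)
  also have "\<dots> \<le> ennreal (\<mu> powr (p - r)) * ennreal X + ennreal (\<mu> powr (p - q)) * ennreal Y"
    using bounds by (intro add_mono mult_left_mono) auto
  also have "\<dots> = ennreal (\<mu> powr (p - r) * X + \<mu> powr (p - q) * Y)"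
    using bounds by (simp add: ennreal_mult)
  finally show ?thesis .
qed

lemma hdot_sq_0: "hdot_sq 0 h = lp_pow 2 h"
  unfolding hdot_sq_def lp_pow_def
  by (intro nn_integral_cong_AE, use AE_lborel_singleton[of 0] in eventually_elim) simp

corollary lp_pow_2_fourier_le:
  "integrable lborel h \<Longrightarrow> lp_pow 2 (fourier h) \<le> hdot_sq 0 h"
  using plancherel_le[of h] by (simp add: hdot_sq_0 lp_pow_def)

section \<open>Ball averages\<close>

definition ball_kernel :: "real \<Rightarrow> 'a::euclidean_space \<Rightarrow> complex" where
  "ball_kernel \<rho> y = complex_of_real (indicator (ball 0 \<rho>) y / measure lborel (ball (0::'a) \<rho>))"

definition ball_average :: "real \<Rightarrow> ('a::euclidean_space \<Rightarrow> complex) \<Rightarrow> 'a \<Rightarrow> complex" where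
  "ball_average \<rho> f x = (LINT y|lborel. ball_kernel \<rho> y * f (x + y))"

definition ball_multiplier :: "real \<Rightarrow> 'a::euclidean_space \<Rightarrow> complex" where
  "ball_multiplier \<rho> = fourier (ball_kernel \<rho>)"

lemma ball_kernel_measurable [measurable]: "ball_kernel \<rho> \<in> borel_measurable borel"
  unfolding ball_kernel_def[abs_def] by measurable

lemma ball_multiplier_measurable [measurable]: "ball_multiplier \<rho> \<in> borel_measurable borel"
  unfolding ball_multiplier_def by measurable

lemma norm_ball_kernel:
  fixes y :: "'a::euclidean_space"
  shows "cmod (ball_kernel \<rho> y) = indicator (ball 0 \<rho>) y / measure lborel (ball (0::'a) \<rho>)"
  unfolding ball_kernel_def norm_of_real by (auto split: split_indicator)

lemma nn_integral_ball_kernel: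
  fixes f :: "'a::euclidean_space \<Rightarrow> ennreal"
  assumes [measurable]: "f \<in> borel_measurable borel"
  shows "(\<integral>\<^sup>+y. cmod (ball_kernel \<rho> y) * f (x + y) \<partial>lborel) =
    ennreal (1 / measure lborel (ball (0::'a) \<rho>)) * (\<integral>\<^sup>+y\<in>ball x \<rho>. f y \<partial>lborel)"
proof -
  have "(\<integral>\<^sup>+y. cmod (ball_kernel \<rho> y) * f (x + y) \<partial>lborel) =
      (\<integral>\<^sup>+y. ennreal (1 / measure lborel (ball (0::'a) \<rho>)) *
          (f (y + x) * indicator (ball x \<rho>) (y + x)) \<partial>lborel)"
    by (intro nn_integral_cong)
       (auto simp: norm_ball_kernel dist_norm add.commute split: split_indicator)
  also have "\<dots> = ennreal (1 / measure lborel (ball (0::'a) \<rho>)) *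
      (\<integral>\<^sup>+y. f (y + x) * indicator (ball x \<rho>) (y + x) \<partial>lborel)"
    by (rule nn_integral_cmult) measurable
  also have "(\<integral>\<^sup>+y. f (y + x) * indicator (ball x \<rho>) (y + x) \<partial>lborel) = (\<integral>\<^sup>+y\<in>ball x \<rho>. f y \<partial>lborel)"
    by (rule nn_integral_lborel_translate[of "\<lambda>y. f y * indicator (ball x \<rho>) y"]) measurable
  finally show ?thesis .
qed

lemma emeasure_lborel_ball_eq_measure:
  "emeasure lborel (ball (x::'a::euclidean_space) \<rho>) = ennreal (measure lborel (ball (0::'a) \<rho>))"
  by (cases "\<rho> \<ge> 0") (auto simp: emeasure_ball content_ball ball_empty)

lemma nn_integral_norm_ball_kernel:
  assumes "\<rho> > 0"
  shows "(\<integral>\<^sup>+y. cmod (ball_kernel \<rho> (y::'a::euclidean_space)) \<partial>lborel) = 1"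
  using nn_integral_ball_kernel[of "\<lambda>_. 1" \<rho> "0::'a"] content_ball_pos[OF assms, of "0::'a"]
  by (simp add: emeasure_lborel_ball_eq_measure flip: ennreal_mult)

lemma integrable_ball_kernel:
  assumes "\<rho> > 0"
  shows "integrable lborel (ball_kernel \<rho> :: 'a::euclidean_space \<Rightarrow> complex)"
  using nn_integral_norm_ball_kernel[OF assms, where 'a='a] by (intro integrableI_bounded) auto

lemma integral_ball_kernel:
  assumes "\<rho> > 0"
  shows "(LINT y|lborel. ball_kernel \<rho> (y::'a::euclidean_space)) = 1"
proof -
  have "(LINT y|lborel. ball_kernel \<rho> (y::'a)) =
      (LINT y|lborel. complex_of_real (cmod (ball_kernel \<rho> (y::'a))))"
    unfolding norm_ball_kernel by (simp only: ball_kernel_def)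
  also have "\<dots> = complex_of_real (LINT y|lborel. cmod (ball_kernel \<rho> (y::'a)))"
    by (rule integral_complex_of_real)
  also have "(LINT y|lborel. cmod (ball_kernel \<rho> (y::'a))) = 1"
    using nn_integral_norm_ball_kernel[OF assms, where 'a='a]
    by (subst integral_eq_nn_integral) auto
  finally show ?thesis by simp
qed

lemma fourier_ball_multiplier:
  assumes h: "integrable lborel h" and \<rho>: "\<rho> > 0"
  shows "fourier (\<lambda>\<xi>. ball_multiplier \<rho> \<xi> * h \<xi>) x = ball_average \<rho> (fourier h) x"
proof -
  define g where "g \<xi> = h \<xi> * cis (2 * pi * ((- x) \<bullet> \<xi>))" for \<xi>
  have g: "integrable lborel g" unfolding g_def by (intro integrable_mult_cis h) measurable
  have "(LINT y|lborel. fourier g y * ball_kernel \<rho> y) =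
      (LINT \<xi>|lborel. g \<xi> * fourier (ball_kernel \<rho>) \<xi>)"
    by (rule fourier_multiplication_formula[OF g integrable_ball_kernel[OF \<rho>]])
  moreover have "fourier g y = fourier h (x + y)" for y
    unfolding g_def fourier_modulate by (simp add: add.commute)
  ultimately show ?thesis
    by (simp add: fourier_def[of _ x] g_def ball_multiplier_def ball_average_def mult_ac)
qed

lemma norm_ball_average_le_mass:
  fixes f :: "'a::euclidean_space \<Rightarrow> complex"
  assumes [measurable]: "f \<in> borel_measurable borel" and \<rho>: "\<rho> > 0" and L: "L \<ge> 0"
    and mass: "lp_pow_on (ball x \<rho>) 1 f \<le> ennreal (L * measure lborel (ball (0::'a) \<rho>))"
  shows "cmod (ball_average \<rho> f x) \<le> L"
proof -
  have "ennreal (cmod (ball_average \<rho> f x)) \<le>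
      (\<integral>\<^sup>+y. cmod (ball_kernel \<rho> y) * ennreal (cmod (f (x + y))) \<partial>lborel)"
    using integral_norm_bound_nn_integral[of lborel "\<lambda>y. ball_kernel \<rho> y * f (x + y)"]
    by (simp add: ball_average_def norm_mult ennreal_mult)
  also have "\<dots> = ennreal (1 / measure lborel (ball (0::'a) \<rho>)) * lp_pow_on (ball x \<rho>) 1 f"
    by (simp add: nn_integral_ball_kernel[of "\<lambda>y. ennreal (cmod (f y))"] lp_pow_on_def)
  also have "\<dots> \<le> ennreal (1 / measure lborel (ball (0::'a) \<rho>)) *
      ennreal (L * measure lborel (ball (0::'a) \<rho>))"
    by (intro mult_left_mono mass) simp
  also have "\<dots> = ennreal L"
    using content_ball_pos[OF \<rho>, of "0::'a"] L by (simp flip: ennreal_mult)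
  finally show ?thesis using L by simp
qed

lemma norm_ball_average_le:
  fixes f :: "'a::euclidean_space \<Rightarrow> complex"
  assumes [measurable]: "f \<in> borel_measurable borel" and \<rho>: "\<rho> > 0" and L: "L \<ge> 0"
    and bounded: "\<And>y. y \<in> ball x \<rho> \<Longrightarrow> cmod (f y) \<le> L"
  shows "cmod (ball_average \<rho> f x) \<le> L"
proof (rule norm_ball_average_le_mass[OF _ \<rho> L])
  have "lp_pow_on (ball x \<rho>) 1 f \<le> (\<integral>\<^sup>+y. ennreal L * indicator (ball x \<rho>) y \<partial>lborel)"
    unfolding lp_pow_on_def
    by (intro nn_integral_mono) (auto simp: bounded ennreal_leI split: split_indicator)
  also have "\<dots> = ennreal (L * measure lborel (ball (0::'a) \<rho>))"
    using L by (simp add: nn_integral_cmult emeasure_lborel_ball_eq_measure ennreal_mult)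
  finally show "lp_pow_on (ball x \<rho>) 1 f \<le> ennreal (L * measure lborel (ball (0::'a) \<rho>))" .
qed fact

lemma norm_ball_multiplier_le: "\<rho> > 0 \<Longrightarrow> cmod (ball_multiplier \<rho> \<xi>) \<le> 1"
  using norm_fourier_le[of "ball_kernel \<rho>" \<xi>]
  by (simp add: ball_multiplier_def nn_integral_norm_ball_kernel)

lemma norm_one_minus_ball_multiplier_le_2: "\<rho> > 0 \<Longrightarrow> cmod (1 - ball_multiplier \<rho> \<xi>) \<le> 2"
  using norm_triangle_ineq4[of 1 "ball_multiplier \<rho> \<xi>"] norm_ball_multiplier_le[of \<rho> \<xi>] by simp

lemma norm_one_minus_ball_multiplier_le:
  fixes \<xi> :: "'a::euclidean_space"
  assumes \<rho>: "\<rho> > 0"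
  shows "cmod (1 - ball_multiplier \<rho> \<xi>) \<le> 2 * pi * \<rho> * norm \<xi>"
proof -
  note kernel = integrable_ball_kernel[OF \<rho>, where 'a='a]
  have "1 - ball_multiplier \<rho> \<xi> =
      (LINT y|lborel. ball_kernel \<rho> (y::'a)) -
         (LINT y|lborel. ball_kernel \<rho> y * cis (- 2 * pi * (\<xi> \<bullet> y)))"
    using integral_ball_kernel[OF \<rho>, where 'a='a] by (simp add: ball_multiplier_def fourier_def)
  also have "\<dots> = (LINT y|lborel. ball_kernel \<rho> y * (1 - cis (- 2 * pi * (\<xi> \<bullet> y))))"
    using kernel by (simp add: right_diff_distrib integrable_mult_cis)
  finally have "ennreal (cmod (1 - ball_multiplier \<rho> \<xi>)) \<le>
      (\<integral>\<^sup>+y. cmod (ball_kernel \<rho> y * (1 - cis (- 2 * pi * (\<xi> \<bullet> y)))) \<partial>lborel)"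
    by (simp only: integral_norm_bound_nn_integral)
  also have "\<dots> \<le> (\<integral>\<^sup>+y. ennreal (2 * pi * \<rho> * norm \<xi>) * cmod (ball_kernel \<rho> (y::'a)) \<partial>lborel)"
  proof (rule nn_integral_mono)
    fix y :: 'a
    have "cmod (ball_kernel \<rho> y * (1 - cis (- 2 * pi * (\<xi> \<bullet> y)))) \<le>
        2 * pi * \<rho> * norm \<xi> * cmod (ball_kernel \<rho> y)"
    proof (cases "y \<in> ball 0 \<rho>")
      case True
      have "cmod (1 - cis (- 2 * pi * (\<xi> \<bullet> y))) \<le> \<bar>- 2 * pi * (\<xi> \<bullet> y)\<bar>"
        using iexp_approx1[of "- 2 * pi * (\<xi> \<bullet> y)" 0] by (simp add: cis_conv_exp norm_minus_commute)
      also have "\<dots> \<le> 2 * pi * (norm \<xi> * norm y)"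
        using Cauchy_Schwarz_ineq2[of \<xi> y] by (simp add: abs_mult)
      also have "\<dots> \<le> 2 * pi * (norm \<xi> * \<rho>)" using True by (intro mult_left_mono) auto
      finally have "cmod (1 - cis (- 2 * pi * (\<xi> \<bullet> y))) \<le> 2 * pi * \<rho> * norm \<xi>"
        by (simp add: mult_ac)
      then show ?thesis unfolding norm_mult by (subst mult.commute) (rule mult_right_mono, auto)
    qed (simp add: ball_kernel_def)
    then show "ennreal (cmod (ball_kernel \<rho> y * (1 - cis (- 2 * pi * (\<xi> \<bullet> y))))) \<le>
        ennreal (2 * pi * \<rho> * norm \<xi>) * cmod (ball_kernel \<rho> y)"
      using \<rho> by (simp add: ennreal_leI flip: ennreal_mult)
  qed
  also have "\<dots> = ennreal (2 * pi * \<rho> * norm \<xi>)"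
    by (simp add: nn_integral_cmult nn_integral_norm_ball_kernel[OF \<rho>])
  finally show ?thesis using \<rho> by simp
qed

subsection \<open>Frequency splitting by iterated averages\<close>

text \<open>With \<open>T\<close> the averaging operator, \<open>1 - (1 - T)\<^sup>k\<close> is a smoothing operator localised
  at distance \<open>k \<rho>\<close>, while \<open>(1 - T)\<^sup>k\<close> annihilates low frequencies to order \<open>k\<close>.\<close>

definition high_multiplier :: "nat \<Rightarrow> real \<Rightarrow> 'a::euclidean_space \<Rightarrow> complex" where
  "high_multiplier k \<rho> \<xi> = (1 - ball_multiplier \<rho> \<xi>) ^ k"

definition low_multiplier :: "nat \<Rightarrow> real \<Rightarrow> 'a::euclidean_space \<Rightarrow> complex" where
  "low_multiplier k \<rho> \<xi> = 1 - high_multiplier k \<rho> \<xi>"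

lemma high_multiplier_measurable [measurable]: "high_multiplier k \<rho> \<in> borel_measurable borel"
  unfolding high_multiplier_def[abs_def] by measurable

lemma low_multiplier_measurable [measurable]: "low_multiplier k \<rho> \<in> borel_measurable borel"
  unfolding low_multiplier_def[abs_def] by measurable

lemma norm_high_multiplier_le: "\<rho> > 0 \<Longrightarrow> cmod (high_multiplier k \<rho> \<xi>) \<le> 2 ^ k"
  unfolding high_multiplier_def norm_power
  by (intro power_mono norm_one_minus_ball_multiplier_le_2) auto

lemma norm_low_multiplier_le: "\<rho> > 0 \<Longrightarrow> cmod (low_multiplier k \<rho> \<xi>) \<le> 1 + 2 ^ k"
  using norm_triangle_ineq4[of 1 "high_multiplier k \<rho> \<xi>"] norm_high_multiplier_le[of \<rho> k \<xi>]
  by (simp add: low_multiplier_def)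

lemma integrable_high_multiplier:
  "integrable lborel h \<Longrightarrow> \<rho> > 0 \<Longrightarrow> integrable lborel (\<lambda>\<xi>. high_multiplier k \<rho> \<xi> * h \<xi>)"
  by (rule integrable_bounded_mult[OF _ _ norm_high_multiplier_le]) auto

lemma integrable_low_multiplier:
  "integrable lborel h \<Longrightarrow> \<rho> > 0 \<Longrightarrow> integrable lborel (\<lambda>\<xi>. low_multiplier k \<rho> \<xi> * h \<xi>)"
  by (rule integrable_bounded_mult[OF _ _ norm_low_multiplier_le]) auto

lemma integrable_ball_multiplier:
  "integrable lborel h \<Longrightarrow> \<rho> > 0 \<Longrightarrow> integrable lborel (\<lambda>\<xi>. ball_multiplier \<rho> \<xi> * h \<xi>)"
  by (rule integrable_bounded_mult[OF _ _ norm_ball_multiplier_le]) auto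

lemma fourier_high_low:
  assumes "integrable lborel h" "\<rho> > 0"
  shows "fourier h x =
      fourier (\<lambda>\<xi>. high_multiplier k \<rho> \<xi> * h \<xi>) x + fourier (\<lambda>\<xi>. low_multiplier k \<rho> \<xi> * h \<xi>) x"
proof -
  have "fourier h x = fourier (\<lambda>\<xi>. high_multiplier k \<rho> \<xi> * h \<xi> + low_multiplier k \<rho> \<xi> * h \<xi>) x"
    by (simp add: low_multiplier_def left_diff_distrib)
  also have "\<dots> = fourier (\<lambda>\<xi>. high_multiplier k \<rho> \<xi> * h \<xi>) x +
      fourier (\<lambda>\<xi>. low_multiplier k \<rho> \<xi> * h \<xi>) x"
    by (intro fourier_add integrable_high_multiplier integrable_low_multiplier assms)
  finally show ?thesis .
qed

lemma fourier_low_multiplier_Suc: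
  assumes h: "integrable lborel h" and \<rho>: "\<rho> > 0"
  defines "low k \<equiv> fourier (\<lambda>\<xi>. low_multiplier k \<rho> \<xi> * h \<xi>)"
  shows "low (Suc k) x = low k x + ball_average \<rho> (fourier h) x - ball_average \<rho> (low k) x"
proof -
  note integrable = integrable_low_multiplier[OF h \<rho>, of k] integrable_ball_multiplier[OF h \<rho>]
    integrable_ball_multiplier[OF integrable_low_multiplier[OF h \<rho>, of k] \<rho>]
  have "low_multiplier (Suc k) \<rho> \<xi> * h \<xi> =
      (low_multiplier k \<rho> \<xi> * h \<xi> + ball_multiplier \<rho> \<xi> * h \<xi>) -
      ball_multiplier \<rho> \<xi> * (low_multiplier k \<rho> \<xi> * h \<xi>)" for \<xi>
    by (simp add: low_multiplier_def high_multiplier_def algebra_simps)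
  then have "low (Suc k) x = fourier (\<lambda>\<xi>. low_multiplier k \<rho> \<xi> * h \<xi>) x +
      fourier (\<lambda>\<xi>. ball_multiplier \<rho> \<xi> * h \<xi>) x -
      fourier (\<lambda>\<xi>. ball_multiplier \<rho> \<xi> * (low_multiplier k \<rho> \<xi> * h \<xi>)) x"
    unfolding low_def by (simp add: fourier_diff fourier_add integrable)
  then show ?thesis
    by (simp add: low_def fourier_ball_multiplier integrable(1) h \<rho>)
qed

lemma norm_fourier_low_multiplier_le:
  fixes h :: "'a::euclidean_space \<Rightarrow> complex"
  assumes h: "integrable lborel h" and \<rho>: "\<rho> > 0" and L: "L \<ge> 0"
    and mass: "\<And>z. dist x z \<le> real k * \<rho> \<Longrightarrow>
      lp_pow_on (ball z \<rho>) 1 (fourier h) \<le> ennreal (L * measure lborel (ball (0::'a) \<rho>))"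
  shows "cmod (fourier (\<lambda>\<xi>. low_multiplier k \<rho> \<xi> * h \<xi>) x) \<le> (2 ^ k - 1) * L"
  using mass
proof (induction k arbitrary: x)
  case 0
  then show ?case by (simp add: fourier_def low_multiplier_def high_multiplier_def)
next
  case (Suc k)
  have [measurable]: "h \<in> borel_measurable borel" using h by auto
  define low where "low = fourier (\<lambda>\<xi>. low_multiplier k \<rho> \<xi> * h \<xi>)"
  have [measurable]: "low \<in> borel_measurable borel" unfolding low_def by measurable
  have near: "cmod (low x') \<le> (2 ^ k - 1) * L" if "dist x x' \<le> \<rho>" for x'
    unfolding low_def
  proof (rule Suc.IH)
    fix z assume "dist x' z \<le> real k * \<rho>"
    then have "dist x z \<le> real (Suc k) * \<rho>"
      using that dist_triangle[of x z x'] by (simp add: algebra_simps)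
    then show "lp_pow_on (ball z \<rho>) 1 (fourier h) \<le> ennreal (L * measure lborel (ball (0::'a) \<rho>))"
      by (rule Suc.prems)
  qed
  have "cmod (fourier (\<lambda>\<xi>. low_multiplier (Suc k) \<rho> \<xi> * h \<xi>) x) \<le>
      cmod (low x) + cmod (ball_average \<rho> (fourier h) x) + cmod (ball_average \<rho> low x)"
    unfolding fourier_low_multiplier_Suc[OF h \<rho>] low_def[symmetric] by norm
  also have "\<dots> \<le> (2 ^ k - 1) * L + L + (2 ^ k - 1) * L"
  proof (intro add_mono)
    show "cmod (low x) \<le> (2 ^ k - 1) * L" by (rule near) (use \<rho> in simp)
    show "cmod (ball_average \<rho> (fourier h) x) \<le> L"
      by (rule norm_ball_average_le_mass[OF _ \<rho> L]) (use Suc.prems[of x] \<rho> in auto)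
    show "cmod (ball_average \<rho> low x) \<le> (2 ^ k - 1) * L"
      by (rule norm_ball_average_le[OF _ \<rho>]) (use L in \<open>auto intro: near\<close>)
  qed
  also have "\<dots> = (2 ^ Suc k - 1) * L" by (simp add: algebra_simps)
  finally show ?case .
qed

lemma power_le_powr_interp:
  fixes a b \<sigma> :: real
  assumes "0 \<le> a" "a \<le> 2" "a \<le> b" "0 \<le> \<sigma>" "\<sigma> \<le> real k" "0 < k"
  shows "a ^ k \<le> 2 ^ k * b powr \<sigma>"
proof (cases "a = 0")
  case False
  then have a: "a > 0" using assms by simp
  have "a ^ k = a powr \<sigma> * a powr (real k - \<sigma>)"
    using a by (simp add: powr_realpow flip: powr_add)
  also have "\<dots> \<le> b powr \<sigma> * 2 powr (real k - \<sigma>)"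
    using assms a by (intro mult_mono powr_mono2) auto
  also have "\<dots> \<le> b powr \<sigma> * 2 powr (real k)"
    using assms by (intro mult_left_mono powr_mono) auto
  finally show ?thesis by (simp add: powr_realpow mult.commute)
qed (use assms in \<open>auto simp: zero_power\<close>)

lemma hdot_sq_high_multiplier_le:
  fixes h :: "'a::euclidean_space \<Rightarrow> complex"
  assumes [measurable]: "h \<in> borel_measurable borel" and \<rho>: "\<rho> > 0"
    and order: "t \<le> s" "s \<le> t + real k" "0 < k"
  shows "hdot_sq t (\<lambda>\<xi>. high_multiplier k \<rho> \<xi> * h \<xi>) \<le>
    ennreal (4 ^ k * (2 * pi * \<rho>) powr (2 * (s - t))) * hdot_sq s h"
proof -
  define C where "C = 4 ^ k * (2 * pi * \<rho>) powr (2 * (s - t))"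
  have "hdot_sq t (\<lambda>\<xi>. high_multiplier k \<rho> \<xi> * h \<xi>) \<le>
      (\<integral>\<^sup>+\<xi>. ennreal C * ennreal (norm \<xi> powr (2 * s) * (cmod (h \<xi>))\<^sup>2) \<partial>lborel)"
    unfolding hdot_sq_def
  proof (rule nn_integral_mono)
    fix \<xi> :: 'a
    have "cmod (high_multiplier k \<rho> \<xi>) \<le> 2 ^ k * (2 * pi * \<rho> * norm \<xi>) powr (s - t)"
      unfolding high_multiplier_def norm_power
      by (rule power_le_powr_interp)
         (use order norm_one_minus_ball_multiplier_le[OF \<rho>]
             norm_one_minus_ball_multiplier_le_2[OF \<rho>] in auto)
    then have "(cmod (high_multiplier k \<rho> \<xi>))\<^sup>2 \<le> (2 ^ k * (2 * pi * \<rho> * norm \<xi>) powr (s - t))\<^sup>2"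
      by (rule power_mono) simp
    also have "\<dots> = (2 ^ k)\<^sup>2 * (2 * pi * \<rho> * norm \<xi>) powr (2 * (s - t))"
      by (simp add: power_mult_distrib power2_eq_square powr_add[symmetric])
    also have "\<dots> = C * norm \<xi> powr (2 * (s - t))"
      using \<rho> by (simp add: C_def powr_mult power_mult[symmetric] mult.commute[of k] power_mult)
    finally have "norm \<xi> powr (2 * t) * ((cmod (high_multiplier k \<rho> \<xi>))\<^sup>2 * (cmod (h \<xi>))\<^sup>2) \<le>
        norm \<xi> powr (2 * t) * (C * norm \<xi> powr (2 * (s - t)) * (cmod (h \<xi>))\<^sup>2)"
      by (intro mult_left_mono mult_right_mono) auto
    also have "\<dots> = C * ((norm \<xi> powr (2 * t) * norm \<xi> powr (2 * (s - t))) * (cmod (h \<xi>))\<^sup>2)"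
      by (simp only: mult_ac)
    also have "norm \<xi> powr (2 * t) * norm \<xi> powr (2 * (s - t)) = norm \<xi> powr (2 * s)"
      by (simp add: powr_add[symmetric])
    finally show "ennreal (norm \<xi> powr (2 * t) * (cmod (high_multiplier k \<rho> \<xi> * h \<xi>))\<^sup>2) \<le>
        ennreal C * ennreal (norm \<xi> powr (2 * s) * (cmod (h \<xi>))\<^sup>2)"
      by (simp add: norm_mult power_mult_distrib ennreal_leI C_def flip: ennreal_mult)
  qed
  also have "\<dots> = ennreal C * hdot_sq s h"
    unfolding hdot_sq_def by (rule nn_integral_cmult) measurable
  finally show ?thesis by (simp add: C_def)
qed

lemma lp_pow_on_fourier_le:
  fixes h :: "'a::euclidean_space \<Rightarrow> complex"
  assumes h: "integrable lborel h" and \<rho>: "\<rho> > 0" and L: "L \<ge> 0" and exponents: "0 \<le> q" "q \<le> p"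
    and [measurable]: "S \<in> sets borel"
    and mass: "\<And>x z. x \<in> S \<Longrightarrow> dist x z \<le> real k * \<rho> \<Longrightarrow>
      lp_pow_on (ball z \<rho>) 1 (fourier h) \<le> ennreal (L * measure lborel (ball (0::'a) \<rho>))"
  shows "lp_pow_on S p (fourier h) \<le>
    ennreal (2 powr p) * lp_pow p (fourier (\<lambda>\<xi>. high_multiplier k \<rho> \<xi> * h \<xi>)) +
    ennreal ((2 * (2 ^ k * L)) powr (p - q)) * lp_pow_on S q (fourier h)"
proof (rule lp_pow_on_le_if_near)
  have [measurable]: "h \<in> borel_measurable borel" using h by auto
  show "fourier h \<in> borel_measurable borel"
      "fourier (\<lambda>\<xi>. high_multiplier k \<rho> \<xi> * h \<xi>) \<in> borel_measurable borel"
    by measurable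
  fix x assume "x \<in> S"
  then have "cmod (fourier (\<lambda>\<xi>. low_multiplier k \<rho> \<xi> * h \<xi>) x) \<le> (2 ^ k - 1) * L"
    by (intro norm_fourier_low_multiplier_le[OF h \<rho> L] mass)
  also have "\<dots> \<le> 2 ^ k * L" using L by (intro mult_right_mono) auto
  finally show "cmod (fourier h x) \<le> cmod (fourier (\<lambda>\<xi>. high_multiplier k \<rho> \<xi> * h \<xi>) x) + 2 ^ k * L"
    unfolding fourier_high_low[OF h \<rho>, of x k]
    by (intro order_trans[OF norm_triangle_ineq] add_left_mono)
qed (use L exponents in auto)

section \<open>Mass bounds from the Riesz potential\<close>

lemma ennreal_mult_le_imp_le:
  fixes a b :: ennreal
  assumes c: "0 < c" and scaled: "ennreal c * a \<le> b"
  shows "a \<le> ennreal (1 / c) * b"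
proof -
  have "a = ennreal (1 / c) * (ennreal c * a)"
    using c by (simp add: mult.assoc[symmetric] flip: ennreal_mult)
  also have "\<dots> \<le> ennreal (1 / c) * b" by (rule mult_left_mono[OF scaled]) simp
  finally show ?thesis .
qed

lemma riesz_conv_measurable [measurable]:
  assumes [measurable]: "u \<in> borel_measurable borel"
  shows "riesz_conv \<alpha> u \<in> borel_measurable borel"
  unfolding riesz_conv_def by measurable

lemma ball_mass_le_riesz_conv:
  fixes u :: "'a::euclidean_space \<Rightarrow> complex"
  assumes [measurable]: "u \<in> borel_measurable borel" and \<alpha>: "\<alpha> \<ge> 0" and z: "z \<in> ball x R"
  shows "ennreal ((2 * R) powr - \<alpha>) * lp_pow_on (ball x R) 1 u \<le> riesz_conv \<alpha> u z"
proof -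
  have "ennreal ((2 * R) powr - \<alpha>) * lp_pow_on (ball x R) 1 u =
      (\<integral>\<^sup>+y. ennreal ((2 * R) powr - \<alpha>) * (ennreal (cmod (u y)) * indicator (ball x R) y) \<partial>lborel)"
    by (simp add: lp_pow_on_def nn_integral_cmult)
  also have "\<dots> \<le> (\<integral>\<^sup>+y. ennreal (norm (z - y) powr - \<alpha> * cmod (u y)) \<partial>lborel)"
  proof (intro nn_integral_mono_AE, use AE_lborel_singleton[of z] in eventually_elim)
    case (elim y)
    show ?case
    proof (cases "y \<in> ball x R")
      case True
      have "norm (z - y) \<le> 2 * R"
        using z True dist_triangle[of z y x] by (simp add: dist_norm norm_minus_commute)
      then have "(2 * R) powr - \<alpha> \<le> norm (z - y) powr - \<alpha>"
        using elim \<alpha> by (intro powr_mono2') auto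
      then show ?thesis using True by (simp add: ennreal_leI mult_right_mono flip: ennreal_mult)
    qed simp
  qed
  finally show ?thesis by (simp add: riesz_conv_def)
qed

lemma ball_mass_square_le_conv_sq:
  fixes u :: "'a::euclidean_space \<Rightarrow> complex"
  assumes [measurable]: "u \<in> borel_measurable borel" and \<alpha>: "\<alpha> \<ge> 0" and R: "R > 0"
  shows "(lp_pow_on (ball x R) 1 u)\<^sup>2 \<le>
    ennreal ((2 powr \<alpha>)\<^sup>2 / unit_ball_vol (real DIM('a)) * R powr (2 * \<alpha> - real DIM('a))) *
      conv_sq \<alpha> u"
proof -
  define I where "I = lp_pow_on (ball x R) 1 u"
  define V where "V = unit_ball_vol (real DIM('a))"
  define c where "c = V * R ^ DIM('a) * ((2 * R) powr - \<alpha>)\<^sup>2"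
  have V: "V > 0" by (simp add: V_def)
  have c: "c > 0" using R V by (simp add: c_def)
  have "ennreal c * I\<^sup>2 = ennreal (V * R ^ DIM('a)) * (ennreal ((2 * R) powr - \<alpha>) * I)\<^sup>2"
    using V R by (simp add: c_def ennreal_mult power_mult_distrib ennreal_power mult.assoc)
  also have "\<dots> = (\<integral>\<^sup>+z. (ennreal ((2 * R) powr - \<alpha>) * I)\<^sup>2 * indicator (ball x R) z \<partial>lborel)"
    using R by (subst nn_integral_cmult_indicator) (auto simp: emeasure_ball V_def mult.commute)
  also have "\<dots> \<le> conv_sq \<alpha> u"
    unfolding conv_sq_def I_def using \<alpha>
    by (intro nn_integral_mono)
       (auto intro!: power_mono ball_mass_le_riesz_conv split: split_indicator)
  finally have "I\<^sup>2 \<le> ennreal (1 / c) * conv_sq \<alpha> u" by (rule ennreal_mult_le_imp_le[OF c])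
  also have "1 / c = (2 powr \<alpha>)\<^sup>2 / V * R powr (2 * \<alpha> - real DIM('a))"
  proof -
    have R_powr: "R powr (2 * \<alpha> - real DIM('a)) = (R powr \<alpha>)\<^sup>2 / R ^ DIM('a)"
      using R by (simp add: powr_diff powr_realpow power2_eq_square powr_add[symmetric])
    show ?thesis
      unfolding R_powr using R
      by (simp add: c_def powr_minus powr_mult power_mult_distrib field_simps)
  qed
  finally show ?thesis by (simp add: I_def V_def)
qed

section \<open>Mass concentration of radial functions\<close>

lemma lp_pow_on_ball_radial:
  fixes u :: "'a::euclidean_space \<Rightarrow> complex"
  assumes [measurable]: "u \<in> borel_measurable borel" and u: "radial u" and "norm x = norm y"
  shows "lp_pow_on (ball x r) p u = lp_pow_on (ball y r) p u"
proof -
  obtain T where T: "orthogonal_transformation T" "T x = y"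
    using assms(3) by (rule orthogonal_transformation_swap)
  have "lp_pow_on (ball y r) p u =
      (\<integral>\<^sup>+z. ennreal (cmod (u (T z)) powr p) * indicator (ball y r) (T z) \<partial>lborel)"
    unfolding lp_pow_on_def by (rule nn_integral_orthogonal[OF T(1), symmetric]) measurable
  also have "\<dots> = lp_pow_on (ball x r) p u"
    unfolding lp_pow_on_def
  proof (rule nn_integral_cong)
    fix z
    have "u (T z) = u z" by (rule radialD[OF u orthogonal_transformation_norm[OF T(1)]])
    moreover have "dist y (T z) = dist x z"
      using T by (metis dist_norm linear_diff orthogonal_transformation_linear
          orthogonal_transformation_norm)
    ultimately show "ennreal (cmod (u (T z)) powr p) * indicator (ball y r) (T z) =
        ennreal (cmod (u z) powr p) * indicator (ball x r) z"
      by (simp add: indicator_def)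
  qed
  finally show ?thesis by simp
qed

lemma lp_pow_on_ball_radial_le:
  fixes u :: "'a::euclidean_space \<Rightarrow> complex"
  assumes "u \<in> borel_measurable borel" and "radial u"
    and x: "x \<noteq> 0" and y: "norm x \<le> norm y" "norm y < norm x + \<rho>"
  shows "lp_pow_on (ball x \<rho>) p u \<le> lp_pow_on (ball y (2 * \<rho>)) p u"
proof -
  define x' where "x' = (norm y / norm x) *\<^sub>R x"
  have "x' - x = ((norm y - norm x) / norm x) *\<^sub>R x"
    using x by (simp add: x'_def diff_divide_distrib scaleR_diff_left)
  then have "dist x' x < \<rho>" using x y by (simp add: dist_norm)
  then have "ball x \<rho> \<subseteq> ball x' (2 * \<rho>)"
    by (intro subsetI)
       (metis add.commute add_strict_mono dist_commute dist_triangle_lt mem_ball mult_2)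
  then have "lp_pow_on (ball x \<rho>) p u \<le> lp_pow_on (ball x' (2 * \<rho>)) p u" by (rule lp_pow_on_mono)
  also have "\<dots> = lp_pow_on (ball y (2 * \<rho>)) p u"
    by (rule lp_pow_on_ball_radial) (use assms x in \<open>auto simp: x'_def\<close>)
  finally show ?thesis .
qed

lemma emeasure_shell_ge:
  assumes r: "r > 0" and \<rho>: "\<rho> > 0"
  shows "ennreal (unit_ball_vol (real DIM('a)) * \<rho> * r ^ (DIM('a) - 1)) \<le>
    emeasure lborel (ball (0::'a::euclidean_space) (r + \<rho>) - ball 0 r)"
proof -
  define V where "V = unit_ball_vol (real DIM('a))"
  have V: "V > 0" by (simp add: V_def)
  obtain m where m: "DIM('a) = Suc m" using DIM_positive[where 'a='a] gr0_conv_Suc by blast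
  have "r ^ m \<le> (r + \<rho>) ^ m" using r \<rho> by (intro power_mono) auto
  then have "(r + \<rho>) * r ^ m \<le> (r + \<rho>) * (r + \<rho>) ^ m" using r \<rho> by (intro mult_left_mono) auto
  then have "V * (\<rho> * r ^ m) \<le> V * ((r + \<rho>) ^ Suc m - r ^ Suc m)"
    using V by (intro mult_left_mono) (auto simp: algebra_simps)
  then have "ennreal (V * \<rho> * r ^ m) \<le> ennreal (V * (r + \<rho>) ^ Suc m - V * r ^ Suc m)"
    by (intro ennreal_leI) (simp add: algebra_simps)
  also have "\<dots> = emeasure lborel (ball (0::'a) (r + \<rho>)) - emeasure lborel (ball (0::'a) r)"
    using r \<rho> V by (simp add: emeasure_ball ennreal_minus V_def m)
  also have "\<dots> = emeasure lborel (ball (0::'a) (r + \<rho>) - ball 0 r)"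
    using r \<rho> by (intro emeasure_Diff[symmetric]) (auto simp: emeasure_ball)
  finally show ?thesis by (simp add: V_def m)
qed

lemma nn_integral_lp_pow_on_ball_le:
  fixes u :: "'a::euclidean_space \<Rightarrow> complex"
  assumes [measurable]: "u \<in> borel_measurable borel" "A \<in> sets borel" "B \<in> sets borel"
    and cover: "\<And>x. x \<in> A \<Longrightarrow> ball x r \<subseteq> B"
  shows "(\<integral>\<^sup>+x\<in>A. lp_pow_on (ball x r) p u \<partial>lborel) \<le>
      emeasure lborel (ball (0::'a) r) * lp_pow_on B p u"
proof -
  define w where "w y = ennreal (cmod (u y) powr p)" for y
  have [measurable]: "w \<in> borel_measurable borel" unfolding w_def by measurable
  have "(\<integral>\<^sup>+x\<in>A. lp_pow_on (ball x r) p u \<partial>lborel) =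
      (\<integral>\<^sup>+x. \<integral>\<^sup>+y. w y * indicator {y. dist x y < r} y * indicator A x \<partial>lborel \<partial>lborel)"
    by (simp add: lp_pow_on_def w_def nn_integral_multc ball_def)
  also have "\<dots> = (\<integral>\<^sup>+y. \<integral>\<^sup>+x. w y * indicator {y. dist x y < r} y * indicator A x \<partial>lborel \<partial>lborel)"
    by (rule lborel_pair.Fubini') measurable
  also have "\<dots> \<le> (\<integral>\<^sup>+y. \<integral>\<^sup>+x. w y * indicator B y * indicator (ball y r) x \<partial>lborel \<partial>lborel)"
    using cover by (intro nn_integral_mono)
       (auto simp: dist_commute subset_eq split: split_indicator)
  also have "\<dots> = (\<integral>\<^sup>+y. w y * indicator B y * emeasure lborel (ball (0::'a) r) \<partial>lborel)"
    by (simp add: nn_integral_cmult emeasure_lborel_ball_eq_measure)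
  also have "\<dots> = emeasure lborel (ball (0::'a) r) * lp_pow_on B p u"
    by (subst nn_integral_multc) (auto simp: lp_pow_on_def w_def mult.commute)
  finally show ?thesis .
qed

text \<open>Averaging over a spherical shell of centres counts the disjoint rotated copies of the ball
  without a packing argument.\<close>

theorem radial_ball_mass_le:
  fixes u :: "'a::euclidean_space \<Rightarrow> complex"
  assumes u: "u \<in> borel_measurable borel" "radial u" and \<rho>: "\<rho> > 0" and x: "x \<noteq> 0"
  shows "lp_pow_on (ball x \<rho>) p u \<le>
    ennreal (2 ^ DIM('a) * (\<rho> / norm x) ^ (DIM('a) - 1)) * lp_pow_on (ball 0 (norm x + 3 * \<rho>)) p u"
proof -
  define V where "V = unit_ball_vol (real DIM('a))"
  define J where "J = lp_pow_on (ball 0 (norm x + 3 * \<rho>)) p u"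
  define shell where "shell = ball (0::'a) (norm x + \<rho>) - ball 0 (norm x)"
  define c where "c = V * \<rho> * norm x ^ (DIM('a) - 1)"
  have V: "V > 0" by (simp add: V_def)
  have c: "c > 0" using V \<rho> x by (simp add: c_def)
  have [measurable]: "shell \<in> sets borel" unfolding shell_def by measurable
  have "ennreal c * lp_pow_on (ball x \<rho>) p u \<le> emeasure lborel shell * lp_pow_on (ball x \<rho>) p u"
    unfolding c_def V_def shell_def by (intro mult_right_mono emeasure_shell_ge) (use x \<rho> in auto)
  also have "\<dots> = (\<integral>\<^sup>+y\<in>shell. lp_pow_on (ball x \<rho>) p u \<partial>lborel)"
    by (subst nn_integral_cmult_indicator) (auto simp: mult.commute)
  also have "\<dots> \<le> (\<integral>\<^sup>+y\<in>shell. lp_pow_on (ball y (2 * \<rho>)) p u \<partial>lborel)"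
    using x by (intro nn_integral_mono)
      (auto simp: shell_def intro: lp_pow_on_ball_radial_le[OF u] split: split_indicator)
  also have "\<dots> \<le> emeasure lborel (ball (0::'a) (2 * \<rho>)) * J"
    unfolding J_def
  proof (rule nn_integral_lp_pow_on_ball_le[OF u(1)])
    fix y assume "y \<in> shell"
    then show "ball y (2 * \<rho>) \<subseteq> ball 0 (norm x + 3 * \<rho>)"
      by (auto simp: shell_def ball_subset_ball_iff)
  qed auto
  also have "\<dots> = ennreal (V * (2 * \<rho>) ^ DIM('a)) * J"
    using \<rho> by (simp add: emeasure_ball V_def)
  finally have "lp_pow_on (ball x \<rho>) p u \<le> ennreal (1 / c) * (ennreal (V * (2 * \<rho>) ^ DIM('a)) * J)"
    by (rule ennreal_mult_le_imp_le[OF c])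
  also have "\<dots> = ennreal (V * (2 * \<rho>) ^ DIM('a) / c) * J"
    using c V \<rho> by (simp add: mult.assoc[symmetric] flip: ennreal_mult)
  also have "V * (2 * \<rho>) ^ DIM('a) / c = 2 ^ DIM('a) * (\<rho> / norm x) ^ (DIM('a) - 1)"
  proof -
    obtain m where m: "DIM('a) = Suc m" using DIM_positive[where 'a='a] gr0_conv_Suc by blast
    show ?thesis using V \<rho> x by (simp add: c_def m field_simps power_mult_distrib power_divide)
  qed
  finally show ?thesis by (simp add: J_def)
qed

section \<open>Sobolev inequality\<close>

lemma low_frequency_mass_square_le:
  fixes h :: "'a::euclidean_space \<Rightarrow> complex"
  assumes [measurable]: "h \<in> borel_measurable borel" and t: "2 * t < real DIM('a)" and \<Lambda>: "\<Lambda> \<ge> 0"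
  shows "(\<integral>\<^sup>+\<xi>\<in>cball 0 \<Lambda>. cmod (h \<xi>) \<partial>lborel)\<^sup>2 \<le>
    ennreal (DIM('a) * unit_ball_vol (real DIM('a)) *
        (\<Lambda> powr (real DIM('a) - 2 * t) / (real DIM('a) - 2 * t))) *
    hdot_sq t h"
proof -
  define f where "f \<xi> = ennreal (norm \<xi> powr - t) * indicator (cball 0 \<Lambda>) \<xi>" for \<xi> :: 'a
  define g where "g \<xi> = ennreal (norm \<xi> powr t * cmod (h \<xi>))" for \<xi>
  have "(\<integral>\<^sup>+\<xi>\<in>cball 0 \<Lambda>. cmod (h \<xi>) \<partial>lborel) = (\<integral>\<^sup>+\<xi>. f \<xi> * g \<xi> \<partial>lborel)"
  proof (intro nn_integral_cong_AE, use AE_lborel_singleton[of 0] in eventually_elim)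
    case (elim \<xi>)
    then have "norm \<xi> powr - t * (norm \<xi> powr t * cmod (h \<xi>)) = cmod (h \<xi>)"
      by (simp add: powr_minus)
    then show ?case by (simp add: f_def g_def flip: ennreal_mult split: split_indicator)
  qed
  also have "\<dots>\<^sup>2 \<le> (\<integral>\<^sup>+\<xi>. (f \<xi>)\<^sup>2 \<partial>lborel) * (\<integral>\<^sup>+\<xi>. (g \<xi>)\<^sup>2 \<partial>lborel)"
    by (rule Cauchy_Schwarz_nn_integral) (simp_all add: f_def g_def)
  also have "(\<integral>\<^sup>+\<xi>. (f \<xi>)\<^sup>2 \<partial>lborel) = (\<integral>\<^sup>+\<xi>\<in>cball (0::'a) \<Lambda>. norm \<xi> powr - (2 * t) \<partial>lborel)"
    by (intro nn_integral_cong)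
       (auto simp: f_def power2_eq_square powr_add[symmetric] simp flip: ennreal_mult
           split: split_indicator)
  also have "(\<integral>\<^sup>+\<xi>. (g \<xi>)\<^sup>2 \<partial>lborel) = hdot_sq t h"
    unfolding hdot_sq_def
    by (intro nn_integral_cong)
       (simp add: g_def ennreal_power power_mult_distrib power2_eq_square[of "_ powr _"]
           powr_add[symmetric])
  finally show ?thesis by (simp only: nn_integral_norm_powr_cball[OF t \<Lambda>])
qed

lemma emeasure_superlevel_le:
  fixes f g :: "'a \<Rightarrow> complex"
  assumes [measurable]: "f \<in> borel_measurable M" "g \<in> borel_measurable M" and l: "l > 0"
    and superlevel: "\<And>x. l \<le> cmod (f x) \<Longrightarrow> l \<le> 2 * cmod (g x)"
  shows "ennreal (l\<^sup>2) * emeasure M {x \<in> space M. l \<le> cmod (f x)} \<le> 4 * (\<integral>\<^sup>+x. (cmod (g x))\<^sup>2 \<partial>M)"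
proof -
  have "ennreal (l\<^sup>2) * emeasure M {x \<in> space M. l \<le> cmod (f x)} =
      (\<integral>\<^sup>+x. ennreal (l\<^sup>2) * indicator {x \<in> space M. l \<le> cmod (f x)} x \<partial>M)"
    by (rule nn_integral_cmult_indicator[symmetric]) measurable
  also have "\<dots> \<le> (\<integral>\<^sup>+x. 4 * ennreal ((cmod (g x))\<^sup>2) \<partial>M)"
  proof (rule nn_integral_mono)
    fix x
    have "ennreal (l\<^sup>2) \<le> ennreal (4 * (cmod (g x))\<^sup>2)" if "l \<le> cmod (f x)"
      using power_mono[OF superlevel[OF that], of 2] l by (simp add: power_mult_distrib ennreal_leI)
    then show "ennreal (l\<^sup>2) * indicator {x \<in> space M. l \<le> cmod (f x)} x \<le>
        4 * ennreal ((cmod (g x))\<^sup>2)"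
      by (simp add: ennreal_mult split: split_indicator)
  qed
  also have "\<dots> = 4 * (\<integral>\<^sup>+x. (cmod (g x))\<^sup>2 \<partial>M)" by (rule nn_integral_cmult) measurable
  finally show ?thesis .
qed

lemma fourier_superlevel_le:
  fixes h :: "'a::euclidean_space \<Rightarrow> complex"
  assumes h: "integrable lborel h" and l: "l > 0" and [measurable]: "H \<in> sets borel"
    and low: "(\<integral>\<^sup>+\<xi>\<in>- H. cmod (h \<xi>) \<partial>lborel) \<le> ennreal (l / 2)"
  shows "ennreal (l\<^sup>2) * emeasure lborel {x. l \<le> cmod (fourier h x)} \<le>
      4 * (\<integral>\<^sup>+\<xi>\<in>H. (cmod (h \<xi>))\<^sup>2 \<partial>lborel)"
proof -
  have [measurable]: "h \<in> borel_measurable borel" using h by auto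
  define high where "high = fourier (\<lambda>\<xi>. indicator H \<xi> * h \<xi>)"
  have parts: "integrable lborel (\<lambda>\<xi>. indicator H \<xi> * h \<xi>)"
    "integrable lborel (\<lambda>\<xi>. indicator (- H) \<xi> * h \<xi>)"
    by (rule Bochner_Integration.integrable_bound[OF h]; auto split: split_indicator)+
  have "l \<le> 2 * cmod (high x)" if "l \<le> cmod (fourier h x)" for x
  proof -
    have "h = (\<lambda>\<xi>. indicator H \<xi> * h \<xi> + indicator (- H) \<xi> * h \<xi>)"
      by (auto split: split_indicator)
    then have split: "fourier h x = high x + fourier (\<lambda>\<xi>. indicator (- H) \<xi> * h \<xi>) x"
      using fourier_add[OF parts, of x] by (simp add: high_def)
    have "ennreal (cmod (fourier (\<lambda>\<xi>. indicator (- H) \<xi> * h \<xi>) x)) \<le>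
        (\<integral>\<^sup>+\<xi>. cmod (indicator (- H) \<xi> * h \<xi>) \<partial>lborel)"
      by (rule norm_fourier_le)
    also have "\<dots> = (\<integral>\<^sup>+\<xi>\<in>- H. cmod (h \<xi>) \<partial>lborel)"
      by (intro nn_integral_cong) (auto split: split_indicator)
    also note low
    finally have "cmod (fourier (\<lambda>\<xi>. indicator (- H) \<xi> * h \<xi>) x) \<le> l / 2"
      using l by simp
    then show ?thesis
      using that norm_triangle_ineq[of "high x" "fourier (\<lambda>\<xi>. indicator (- H) \<xi> * h \<xi>) x"]
      unfolding split by linarith
  qed
  then have "ennreal (l\<^sup>2) * emeasure lborel {x. l \<le> cmod (fourier h x)} \<le>
      4 * (\<integral>\<^sup>+x. (cmod (high x))\<^sup>2 \<partial>lborel)"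
    using emeasure_superlevel_le[of "fourier h" lborel high l] l by (simp add: high_def)
  also have "\<dots> \<le> 4 * (\<integral>\<^sup>+\<xi>. (cmod (indicator H \<xi> * h \<xi>))\<^sup>2 \<partial>lborel)"
    unfolding high_def by (intro mult_left_mono plancherel_le parts) simp
  also have "(\<integral>\<^sup>+\<xi>. (cmod (indicator H \<xi> * h \<xi>))\<^sup>2 \<partial>lborel) = (\<integral>\<^sup>+\<xi>\<in>H. (cmod (h \<xi>))\<^sup>2 \<partial>lborel)"
    by (intro nn_integral_cong) (auto split: split_indicator)
  finally show ?thesis .
qed

lemma lp_pow_layer_cake:
  fixes u :: "'a::euclidean_space \<Rightarrow> complex"
  assumes [measurable]: "u \<in> borel_measurable borel" and p: "p > 0"
  shows "lp_pow p u =
    ennreal p * (\<integral>\<^sup>+l\<in>{0..}. ennreal (l powr (p - 1)) * emeasure lborel {x. l \<le> cmod (u x)} \<partial>lborel)"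
proof -
  have "lp_pow p u =
      (\<integral>\<^sup>+x. ennreal p * (\<integral>\<^sup>+l. ennreal (l powr (p - 1)) * indicator {0..cmod (u x)} l \<partial>lborel)
          \<partial>lborel)"
    unfolding lp_pow_def
    by (subst nn_integral_powr_Icc) (use p in \<open>auto simp: ennreal_mult[symmetric]\<close>)
  also have "\<dots> = ennreal p *
      (\<integral>\<^sup>+x. \<integral>\<^sup>+l. ennreal (l powr (p - 1)) * indicator {0..cmod (u x)} l \<partial>lborel \<partial>lborel)"
    by (rule nn_integral_cmult) (simp add: indicator_def[of "{_.._}"], measurable)
  also have "(\<integral>\<^sup>+x. \<integral>\<^sup>+l. ennreal (l powr (p - 1)) * indicator {0..cmod (u x)} l \<partial>lborel \<partial>lborel) =
      (\<integral>\<^sup>+l. \<integral>\<^sup>+x. ennreal (l powr (p - 1)) * indicator {0..cmod (u x)} l \<partial>lborel \<partial>lborel)"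
    by (rule lborel_pair.Fubini') (simp add: indicator_def[of "{_.._}"], measurable)
  also have "\<dots> = (\<integral>\<^sup>+l\<in>{0..}.
      ennreal (l powr (p - 1)) * emeasure lborel {x. l \<le> cmod (u x)} \<partial>lborel)"
  proof (rule nn_integral_cong)
    fix l :: real
    have "(\<integral>\<^sup>+x. ennreal (l powr (p - 1)) * indicator {0..cmod (u x)} l \<partial>lborel) =
        (\<integral>\<^sup>+x. (ennreal (l powr (p - 1)) * indicator {0..} l) * indicator {x. l \<le> cmod (u x)} x
            \<partial>lborel)"
      by (intro nn_integral_cong) (auto split: split_indicator)
    also have "\<dots> = ennreal (l powr (p - 1)) * indicator {0..} l *
        emeasure lborel {x. l \<le> cmod (u x)}"
      by (rule nn_integral_cmult_indicator) measurable
    finally show "(\<integral>\<^sup>+x. ennreal (l powr (p - 1)) * indicator {0..cmod (u x)} l \<partial>lborel) =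
        ennreal (l powr (p - 1)) * emeasure lborel {x. l \<le> cmod (u x)} * indicator {0..} l"
      by (simp add: mult_ac)
  qed
  finally show ?thesis .
qed

lemma superlevel_powr_le:
  fixes h :: "'a::euclidean_space \<Rightarrow> complex"
  assumes h: "integrable lborel h" and l: "l > 0" and [measurable]: "\<phi> \<in> borel_measurable borel"
    and low: "(\<integral>\<^sup>+\<xi>\<in>- {\<xi>. l \<le> \<phi> \<xi>}. cmod (h \<xi>) \<partial>lborel) \<le> ennreal (l / 2)"
  shows "ennreal (l powr (p - 1)) * emeasure lborel {x. l \<le> cmod (fourier h x)} \<le>
    (\<integral>\<^sup>+\<xi>. ennreal (4 * (cmod (h \<xi>))\<^sup>2) * (ennreal (l powr (p - 3)) * indicator {0..\<phi> \<xi>} l) \<partial>lborel)"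
proof -
  have [measurable]: "h \<in> borel_measurable borel" using h by auto
  have "l powr (p - 1) = l powr (p - 3) * l\<^sup>2"
    using l by (simp add: powr_numeral[symmetric] powr_add[symmetric] del: powr_numeral)
  then have "ennreal (l powr (p - 1)) * emeasure lborel {x. l \<le> cmod (fourier h x)} =
      ennreal (l powr (p - 3)) * (ennreal (l\<^sup>2) * emeasure lborel {x. l \<le> cmod (fourier h x)})"
    by (simp add: ennreal_mult mult.assoc)
  also have "\<dots> \<le> ennreal (l powr (p - 3)) * (4 * (\<integral>\<^sup>+\<xi>\<in>{\<xi>. l \<le> \<phi> \<xi>}. (cmod (h \<xi>))\<^sup>2 \<partial>lborel))"
    by (intro mult_left_mono fourier_superlevel_le[OF h l _ low]) auto
  also have "\<dots> = (\<integral>\<^sup>+\<xi>. (ennreal (l powr (p - 3)) * 4) *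
      (ennreal ((cmod (h \<xi>))\<^sup>2) * indicator {\<xi>. l \<le> \<phi> \<xi>} \<xi>) \<partial>lborel)"
    by (simp add: nn_integral_cmult mult.assoc)
  also have "\<dots> = (\<integral>\<^sup>+\<xi>. ennreal (4 * (cmod (h \<xi>))\<^sup>2) *
      (ennreal (l powr (p - 3)) * indicator {0..\<phi> \<xi>} l) \<partial>lborel)"
    using l by (intro nn_integral_cong) (auto simp: ennreal_mult mult_ac split: split_indicator)
  finally show ?thesis .
qed

text \<open>The device of Chemin and Xu: at height \<open>l\<close> the function is split at a frequency, depending
  on \<open>l\<close>, below which the low-frequency part is bounded by \<open>l/2\<close>.\<close>

lemma lp_pow_fourier_le_frequency_split:
  fixes h :: "'a::euclidean_space \<Rightarrow> complex"
  assumes h: "integrable lborel h" and p: "p > 2"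
    and [measurable]: "\<phi> \<in> borel_measurable borel" and \<phi>: "\<And>\<xi>. \<phi> \<xi> \<ge> 0"
    and low: "\<And>l. l > 0 \<Longrightarrow> (\<integral>\<^sup>+\<xi>\<in>- {\<xi>. l \<le> \<phi> \<xi>}. cmod (h \<xi>) \<partial>lborel) \<le> ennreal (l / 2)"
  shows "lp_pow p (fourier h) \<le>
    ennreal (4 * p / (p - 2)) * (\<integral>\<^sup>+\<xi>. ennreal (\<phi> \<xi> powr (p - 2) * (cmod (h \<xi>))\<^sup>2) \<partial>lborel)"
proof -
  have [measurable]: "h \<in> borel_measurable borel" using h by auto
  have "(\<integral>\<^sup>+l\<in>{0..}.
        ennreal (l powr (p - 1)) * emeasure lborel {x. l \<le> cmod (fourier h x)} \<partial>lborel) \<le>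
      (\<integral>\<^sup>+l. \<integral>\<^sup>+\<xi>. ennreal (4 * (cmod (h \<xi>))\<^sup>2) * (ennreal (l powr (p - 3)) * indicator {0..\<phi> \<xi>} l)
          \<partial>lborel \<partial>lborel)"
    by (intro nn_integral_mono_AE, use AE_lborel_singleton[of 0] in eventually_elim)
       (auto simp: order_less_le split: split_indicator intro!: superlevel_powr_le[OF h _ _ low])
  also have "\<dots> = (\<integral>\<^sup>+\<xi>. \<integral>\<^sup>+l. ennreal (4 * (cmod (h \<xi>))\<^sup>2) *
      (ennreal (l powr (p - 3)) * indicator {0..\<phi> \<xi>} l) \<partial>lborel \<partial>lborel)"
    by (rule lborel_pair.Fubini') (simp add: indicator_def[of "{_.._}"], measurable)
  also have "\<dots> = (\<integral>\<^sup>+\<xi>. ennreal (4 / (p - 2)) * ennreal (\<phi> \<xi> powr (p - 2) * (cmod (h \<xi>))\<^sup>2) \<partial>lborel)"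
  proof (rule nn_integral_cong)
    fix \<xi>
    have "(\<integral>\<^sup>+l. ennreal (4 * (cmod (h \<xi>))\<^sup>2) *
        (ennreal (l powr (p - 3)) * indicator {0..\<phi> \<xi>} l) \<partial>lborel) =
        ennreal (4 * (cmod (h \<xi>))\<^sup>2) * ennreal (\<phi> \<xi> powr (p - 3 + 1) / (p - 3 + 1))"
      using p by (subst nn_integral_cmult) (auto simp: nn_integral_powr_Icc \<phi>)
    then show "(\<integral>\<^sup>+l. ennreal (4 * (cmod (h \<xi>))\<^sup>2) *
        (ennreal (l powr (p - 3)) * indicator {0..\<phi> \<xi>} l) \<partial>lborel) =
        ennreal (4 / (p - 2)) * ennreal (\<phi> \<xi> powr (p - 2) * (cmod (h \<xi>))\<^sup>2)"
      using p by (simp add: mult_ac flip: ennreal_mult)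
  qed
  also have "\<dots> = ennreal (4 / (p - 2)) * (\<integral>\<^sup>+\<xi>. ennreal (\<phi> \<xi> powr (p - 2) * (cmod (h \<xi>))\<^sup>2) \<partial>lborel)"
    by (rule nn_integral_cmult) measurable
  finally have "lp_pow p (fourier h) \<le>
      ennreal p * (ennreal (4 / (p - 2)) *
          (\<integral>\<^sup>+\<xi>. ennreal (\<phi> \<xi> powr (p - 2) * (cmod (h \<xi>))\<^sup>2) \<partial>lborel))"
    using p by (subst lp_pow_layer_cake) (auto intro: mult_left_mono)
  then show ?thesis
    using p by (simp add: mult.assoc[symmetric] mult.commute[of p] flip: ennreal_mult)
qed

lemma lp_pow_fourier_le_low_frequency_growth:
  fixes h :: "'a::euclidean_space \<Rightarrow> complex"
  assumes h: "integrable lborel h" and c: "c > 0" and \<tau>: "\<tau> > 0" and p: "p > 2"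
    and low: "\<And>\<Lambda>. \<Lambda> > 0 \<Longrightarrow> (\<integral>\<^sup>+\<xi>\<in>cball 0 \<Lambda>. cmod (h \<xi>) \<partial>lborel) \<le> ennreal (c * \<Lambda> powr \<tau>)"
  shows "lp_pow p (fourier h) \<le>
    ennreal (4 * p / (p - 2) * (2 * c) powr (p - 2)) * hdot_sq (\<tau> * (p - 2) / 2) h"
proof -
  have [measurable]: "h \<in> borel_measurable borel" using h by auto
  have "lp_pow p (fourier h) \<le> ennreal (4 * p / (p - 2)) *
      (\<integral>\<^sup>+\<xi>. ennreal ((2 * c * norm \<xi> powr \<tau>) powr (p - 2) * (cmod (h \<xi>))\<^sup>2) \<partial>lborel)"
  proof (rule lp_pow_fourier_le_frequency_split[OF h p])
    fix l :: real assume l: "l > 0"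
    define \<Lambda> where "\<Lambda> = (l / (2 * c)) powr (1 / \<tau>)"
    have \<Lambda>: "\<Lambda> > 0" "\<Lambda> powr \<tau> = l / (2 * c)" using \<tau> l c by (simp_all add: \<Lambda>_def powr_powr)
    have "norm \<xi> \<le> \<Lambda>" if "2 * c * norm \<xi> powr \<tau> < l" for \<xi> :: 'a
    proof (rule ccontr)
      assume "\<not> norm \<xi> \<le> \<Lambda>"
      then have "\<Lambda> powr \<tau> \<le> norm \<xi> powr \<tau>" using \<Lambda>(1) \<tau> by (intro powr_mono2) auto
      then show False using that c by (simp add: \<Lambda>(2) field_simps)
    qed
    then have "(\<integral>\<^sup>+\<xi>\<in>- {\<xi>. l \<le> 2 * c * norm \<xi> powr \<tau>}. cmod (h \<xi>) \<partial>lborel) \<le>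
        (\<integral>\<^sup>+\<xi>\<in>cball 0 \<Lambda>. cmod (h \<xi>) \<partial>lborel)"
      by (intro nn_integral_mono) (auto split: split_indicator)
    also have "\<dots> \<le> ennreal (c * \<Lambda> powr \<tau>)" by (rule low[OF \<Lambda>(1)])
    also have "c * \<Lambda> powr \<tau> = l / 2" using c by (simp add: \<Lambda>(2))
    finally show "(\<integral>\<^sup>+\<xi>\<in>- {\<xi>. l \<le> 2 * c * norm \<xi> powr \<tau>}. cmod (h \<xi>) \<partial>lborel) \<le> ennreal (l / 2)" .
  qed (use c in auto)
  also have "(\<integral>\<^sup>+\<xi>. ennreal ((2 * c * norm \<xi> powr \<tau>) powr (p - 2) * (cmod (h \<xi>))\<^sup>2) \<partial>lborel) =
      (\<integral>\<^sup>+\<xi>. ennreal ((2 * c) powr (p - 2)) *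
        ennreal (norm \<xi> powr (2 * (\<tau> * (p - 2) / 2)) * (cmod (h \<xi>))\<^sup>2) \<partial>lborel)"
    using c by (intro nn_integral_cong)
       (simp add: powr_mult powr_powr mult.assoc flip: ennreal_mult)
  also have "\<dots> = ennreal ((2 * c) powr (p - 2)) * hdot_sq (\<tau> * (p - 2) / 2) h"
    unfolding hdot_sq_def by (rule nn_integral_cmult) measurable
  finally show ?thesis using p by (simp add: mult.assoc[symmetric] flip: ennreal_mult)
qed

lemma low_frequency_mass_le:
  fixes h :: "'a::euclidean_space \<Rightarrow> complex"
  defines "d \<equiv> real DIM('a)"
  assumes [measurable]: "h \<in> borel_measurable borel" and t: "0 < t" "2 * t < d" and "\<Lambda> > 0"
    and energy: "hdot_sq t h \<le> ennreal E" and E: "E \<ge> 0"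
  shows "(\<integral>\<^sup>+\<xi>\<in>cball 0 \<Lambda>. cmod (h \<xi>) \<partial>lborel) \<le>
    ennreal (sqrt (d * unit_ball_vol d / (d - 2 * t)) * sqrt E * \<Lambda> powr (d/2 - t))"
proof (rule ennreal_power2_le_imp_le)
  define c where "c = sqrt (d * unit_ball_vol d / (d - 2 * t))"
  have c: "c > 0" "c\<^sup>2 = d * unit_ball_vol d / (d - 2 * t)" using t by (simp_all add: c_def d_def)
  have "(\<integral>\<^sup>+\<xi>\<in>cball 0 \<Lambda>. cmod (h \<xi>) \<partial>lborel)\<^sup>2 \<le> ennreal (c\<^sup>2 * \<Lambda> powr (d - 2 * t)) * hdot_sq t h"
    using low_frequency_mass_square_le[of h t \<Lambda>] t \<open>\<Lambda> > 0\<close> by (simp add: c(2) d_def)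
  also have "\<dots> \<le> ennreal (c\<^sup>2 * \<Lambda> powr (d - 2 * t)) * ennreal E"
    by (rule mult_left_mono[OF energy]) simp
  also have "\<dots> = ennreal (c\<^sup>2 * E * \<Lambda> powr (d - 2 * t))"
    using E by (simp add: mult_ac flip: ennreal_mult)
  also have "c\<^sup>2 * E * \<Lambda> powr (d - 2 * t) = (c * sqrt E * \<Lambda> powr (d/2 - t))\<^sup>2"
    using E by (simp add: power_mult_distrib power2_eq_square[of "_ powr _"] powr_add[symmetric])
  finally show "(\<integral>\<^sup>+\<xi>\<in>cball 0 \<Lambda>. cmod (h \<xi>) \<partial>lborel)\<^sup>2 \<le>
      (ennreal (sqrt (d * unit_ball_vol d / (d - 2 * t)) * sqrt E * \<Lambda> powr (d/2 - t)))\<^sup>2"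
    using c E by (simp add: ennreal_power c_def)
qed

theorem sobolev_inequality:
  fixes t p :: real
  defines "d \<equiv> real DIM('a::euclidean_space)"
  assumes t: "0 < t" "2 * t < d" and p: "p = 2 * d / (d - 2 * t)"
  shows "\<exists>C\<ge>0. \<forall>(h :: 'a \<Rightarrow> complex) E. integrable lborel h \<longrightarrow> E > 0 \<longrightarrow> hdot_sq t h \<le> ennreal E \<longrightarrow>
    lp_pow p (fourier h) \<le> ennreal (C * E powr (p / 2))"
proof -
  define \<tau> where "\<tau> = d/2 - t"
  define c where "c = sqrt (d * unit_ball_vol d / (d - 2 * t))"
  define C where "C = 4 * p / (p - 2) * (2 * c) powr (p - 2)"
  have \<tau>: "\<tau> > 0" "\<tau> * (p - 2) / 2 = t" using t by (simp_all add: p \<tau>_def field_simps)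
  have p_gt_2: "p > 2" using t by (simp add: p field_simps)
  have c: "c > 0" using t by (simp add: c_def d_def)
  have "lp_pow p (fourier h) \<le> ennreal (C * E powr (p / 2))"
    if h: "integrable lborel h" and E: "E > 0" and energy: "hdot_sq t h \<le> ennreal E"
    for h :: "'a \<Rightarrow> complex" and E
  proof -
    have low: "(\<integral>\<^sup>+\<xi>\<in>cball 0 \<Lambda>. cmod (h \<xi>) \<partial>lborel) \<le> ennreal (c * sqrt E * \<Lambda> powr \<tau>)" if "\<Lambda> > 0"
      for \<Lambda>
      unfolding c_def \<tau>_def d_def
      by (rule low_frequency_mass_le) (use h t that energy E in \<open>auto simp: d_def\<close>)
    have "lp_pow p (fourier h) \<le>
        ennreal (4 * p / (p - 2) * (2 * (c * sqrt E)) powr (p - 2)) * hdot_sq t h"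
      using lp_pow_fourier_le_low_frequency_growth[OF h _ \<tau>(1) p_gt_2 low] c E by (simp add: \<tau>(2))
    also have "\<dots> \<le> ennreal (4 * p / (p - 2) * (2 * (c * sqrt E)) powr (p - 2)) * ennreal E"
      by (rule mult_left_mono[OF energy]) simp
    also have "\<dots> = ennreal (C * (sqrt E powr (p - 2) * E))"
      using p_gt_2 c E by (simp add: C_def powr_mult mult_ac flip: ennreal_mult)
    also have "sqrt E powr (p - 2) * E = E powr (p / 2)"
    proof -
      have "sqrt E powr (p - 2) = E powr ((p - 2) / 2)" using E
        by (simp add: powr_half_sqrt[symmetric] powr_powr)
      then have "sqrt E powr (p - 2) * E = E powr ((p - 2) / 2) * E powr 1" using E by simp
      then show ?thesis unfolding powr_add[symmetric] by (simp add: field_simps)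
    qed
    finally show ?thesis .
  qed
  moreover have "C \<ge> 0" using p_gt_2 by (simp add: C_def)
  ultimately show ?thesis by blast
qed

section \<open>Dyadic decomposition\<close>

definition dyadic_annulus :: "real \<Rightarrow> 'a::real_normed_vector set" where
  "dyadic_annulus R = {x. R \<le> norm x \<and> norm x < 2 * R}"

lemma dyadic_annulus_measurable [measurable]:
  "dyadic_annulus R \<in> sets (borel :: 'a::euclidean_space measure)"
  unfolding dyadic_annulus_def by measurable

lemma dyadic_annulus_subset_ball: "dyadic_annulus R \<subseteq> ball 0 (2 * R)"
  by (auto simp: dyadic_annulus_def)

lemma exists_dyadic_annulus:
  assumes "1 \<le> norm x"
  obtains j where "x \<in> dyadic_annulus (2 ^ j)"
proof -
  define j where "j = nat \<lfloor>log 2 (norm x)\<rfloor>"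
  have x: "norm x > 0" using assms by linarith
  have "log 2 (norm x) \<ge> 0" using assms x by (subst zero_le_log_cancel_iff) auto
  then have "real j \<le> log 2 (norm x)" "log 2 (norm x) < real j + 1"
    unfolding j_def by linarith+
  then have "2 powr real j \<le> 2 powr log 2 (norm x)" "2 powr log 2 (norm x) < 2 powr (real j + 1)"
    by auto
  then have "x \<in> dyadic_annulus (2 ^ j)"
    using x by (simp add: dyadic_annulus_def powr_add powr_realpow mult.commute)
  then show ?thesis by (rule that)
qed

lemma lp_pow_le_dyadic_suminf:
  fixes u :: "'a::euclidean_space \<Rightarrow> complex"
  assumes [measurable]: "u \<in> borel_measurable borel"
  shows "lp_pow p u \<le> lp_pow_on (ball 0 1) p u + (\<Sum>j. lp_pow_on (dyadic_annulus (2 ^ j)) p u)"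
proof -
  define w where "w x = ennreal (cmod (u x) powr p)" for x
  have [measurable]: "w \<in> borel_measurable borel" unfolding w_def by measurable
  have "(\<integral>\<^sup>+x. w x \<partial>lborel) \<le>
      (\<integral>\<^sup>+x. w x * indicator (ball 0 1) x + (\<Sum>j. w x * indicator (dyadic_annulus (2 ^ j)) x)
          \<partial>lborel)"
  proof (rule nn_integral_mono)
    fix x :: 'a
    show "w x \<le> w x * indicator (ball 0 1) x + (\<Sum>j. w x * indicator (dyadic_annulus (2 ^ j)) x)"
    proof (cases "norm x < 1")
      case False
      then obtain j where "x \<in> dyadic_annulus (2 ^ j)" using exists_dyadic_annulus[of x]
        by (auto simp: not_less)
      then have "w x = (\<Sum>i\<in>{j}. w x * indicator (dyadic_annulus (2 ^ i)) x)" by simp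
      also have "\<dots> \<le> (\<Sum>i. w x * indicator (dyadic_annulus (2 ^ i)) x)"
        by (rule sum_le_suminf[OF summableI]) auto
      finally show ?thesis by (simp add: add_increasing)
    qed simp
  qed
  also have "\<dots> = (\<integral>\<^sup>+x\<in>ball 0 1. w x \<partial>lborel) + (\<Sum>j. \<integral>\<^sup>+x\<in>dyadic_annulus (2 ^ j). w x \<partial>lborel)"
    by (subst nn_integral_add, measurable, measurable, subst nn_integral_suminf, measurable)
  finally show ?thesis by (simp add: lp_pow_def lp_pow_on_def w_def)
qed

lemma lp_pow_le_if_dyadic_decay:
  fixes u :: "'a::euclidean_space \<Rightarrow> complex"
  assumes "u \<in> borel_measurable borel" and \<gamma>: "\<gamma> > 0"
    and ball: "lp_pow_on (ball 0 1) p u \<le> ennreal A" "A \<ge> 0"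
    and annuli: "\<And>R. R \<ge> 1 \<Longrightarrow> lp_pow_on (dyadic_annulus R) p u \<le> ennreal (K * R powr - \<gamma>)"
      and K: "K \<ge> 0"
  shows "lp_pow p u \<le> ennreal (A + K / (1 - 2 powr - \<gamma>))"
proof -
  define q where "q = 2 powr - \<gamma>"
  have q: "0 \<le> q" "q < 1" using \<gamma> by (auto simp: q_def powr_less_one)
  have decay: "lp_pow_on (dyadic_annulus (2 ^ j)) p u \<le> ennreal (K * q ^ j)" for j
  proof -
    have "(2 ^ j) powr - \<gamma> = q ^ j"
      by (simp add: q_def powr_realpow[symmetric] powr_powr mult.commute)
    then show ?thesis using annuli[of "2 ^ j"] by simp
  qed
  have "lp_pow p u \<le> lp_pow_on (ball 0 1) p u + (\<Sum>j. lp_pow_on (dyadic_annulus (2 ^ j)) p u)"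
    by (rule lp_pow_le_dyadic_suminf) fact
  also have "\<dots> \<le> ennreal A + (\<Sum>j. ennreal (K * q ^ j))"
    by (intro add_mono ball suminf_le decay) auto
  also have "(\<Sum>j. ennreal (K * q ^ j)) = ennreal (\<Sum>j. K * q ^ j)"
    using q K by (intro suminf_ennreal2 summable_mult summable_geometric) auto
  also have "(\<Sum>j. K * q ^ j) = K / (1 - q)"
    using q by (simp add: suminf_mult suminf_geometric summable_geometric)
  also have "ennreal A + ennreal (K / (1 - q)) = ennreal (A + K / (1 - q))"
    using ball q K by simp
  finally show ?thesis by (simp add: q_def)
qed

section \<open>Bounds for normalised functions\<close>

locale riesz_sobolev =
  fixes d s \<alpha> :: real and E :: "'a::euclidean_space itself"
  assumes d_def: "d = real DIM('a)" and s_pos: "s > 0" and \<alpha>_gt: "d/2 < \<alpha>" and \<alpha>_less: "\<alpha> < d - 1/2"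
begin

definition \<beta> :: real where "\<beta> = \<alpha> - d/2"

definition \<sigma> :: real where "\<sigma> = (d - 1 - 2 * \<beta>) / (2 * s + 1)"

definition mass_const :: real where
  "mass_const = 2 powr \<alpha> / sqrt (unit_ball_vol d)"

definition normalized :: "('a \<Rightarrow> complex) \<Rightarrow> bool" where
  "normalized h \<longleftrightarrow> integrable lborel h \<and> radial (fourier h) \<and>
    conv_sq \<alpha> (fourier h) \<le> 1 \<and> hdot_sq s h \<le> 1"

lemma \<alpha>_pos: "\<alpha> > 0"
  using \<alpha>_gt by (rule order_le_less_trans[rotated]) (simp add: d_def)

lemma d_gt_1: "d > 1"
  using \<alpha>_gt \<alpha>_less by linarith

lemma unit_ball_vol_d_pos [simp]: "unit_ball_vol d > 0"
  by (simp add: d_def)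

lemma \<beta>_pos: "\<beta> > 0" and \<beta>_less: "2 * \<beta> < d - 1"
  using \<alpha>_gt \<alpha>_less by (simp_all add: \<beta>_def)

lemma \<sigma>_pos: "\<sigma> > 0" and \<sigma>_mult: "\<sigma> * (2 * s + 1) = d - 1 - 2 * \<beta>"
  using \<beta>_less s_pos by (simp_all add: \<sigma>_def)

lemma mass_const_pos: "mass_const > 0"
  by (simp add: mass_const_def)

lemma normalized_measurable: "normalized h \<Longrightarrow> h \<in> borel_measurable borel"
  by (auto simp: normalized_def)

subsection \<open>Local square norms\<close>

lemma ball_mass_le:
  assumes h: "normalized h" and R: "R > 0"
  shows "lp_pow_on (ball z R) 1 (fourier h) \<le> ennreal (mass_const * R powr \<beta>)"
proof (rule ennreal_power2_le_imp_le)
  note [measurable] = normalized_measurable[OF h]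
  have square: "(mass_const * R powr \<beta>)\<^sup>2 = (2 powr \<alpha>)\<^sup>2 / unit_ball_vol d * R powr (2 * \<alpha> - d)"
    by (simp add: mass_const_def power_mult_distrib power_divide \<beta>_def
        power2_eq_square[of "R powr _"]
        powr_add[symmetric] less_imp_le)
  have "(lp_pow_on (ball z R) 1 (fourier h))\<^sup>2 \<le>
      ennreal ((mass_const * R powr \<beta>)\<^sup>2) * conv_sq \<alpha> (fourier h)"
    unfolding square by (rule ball_mass_square_le_conv_sq[where u="fourier h", folded d_def])
       (use \<alpha>_pos R in auto)
  also have "\<dots> \<le> ennreal ((mass_const * R powr \<beta>)\<^sup>2) * 1"
    using h by (intro mult_left_mono) (auto simp: normalized_def)
  finally show "(lp_pow_on (ball z R) 1 (fourier h))\<^sup>2 \<le> (ennreal (mass_const * R powr \<beta>))\<^sup>2"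
    using mass_const_pos by (simp add: ennreal_power)
qed

lemma unit_ball_mass_le:
  assumes "normalized h"
  shows "lp_pow_on (ball z 1) 1 (fourier h) \<le>
      ennreal (mass_const / unit_ball_vol d * measure lborel (ball (0::'a) 1))"
  using ball_mass_le[OF assms, of 1 z]
  by (simp add: content_ball less_imp_neq[symmetric] flip: d_def)

lemma annulus_mass_le:
  assumes "normalized h" "R > 0"
  shows "lp_pow_on (dyadic_annulus R) 1 (fourier h) \<le> ennreal (mass_const * (2 * R) powr \<beta>)"
  using lp_pow_on_mono[OF dyadic_annulus_subset_ball] ball_mass_le[of h "2 * R" 0] assms
  by (auto intro: order_trans)

lemma L2_le_if_ball_mass_le:
  assumes h: "normalized h" and \<rho>: "\<rho> > 0" and k: "s \<le> real k" and L: "L \<ge> 0"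
    and S: "S \<in> sets borel"
    and mass: "\<And>x z. x \<in> S \<Longrightarrow> dist x z \<le> real k * \<rho> \<Longrightarrow>
      lp_pow_on (ball z \<rho>) 1 (fourier h) \<le> ennreal (L * measure lborel (ball (0::'a) \<rho>))"
  shows "lp_pow_on S 2 (fourier h) \<le>
    ennreal (4 * (4 ^ k * (2 * pi * \<rho>) powr (2 * s))) +
      ennreal (2 * (2 ^ k * L)) * lp_pow_on S 1 (fourier h)"
proof -
  note [measurable] = normalized_measurable[OF h]
  have h_int: "integrable lborel h" using h by (simp add: normalized_def)
  have "lp_pow 2 (fourier (\<lambda>\<xi>. high_multiplier k \<rho> \<xi> * h \<xi>)) \<le>
      hdot_sq 0 (\<lambda>\<xi>. high_multiplier k \<rho> \<xi> * h \<xi>)"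
    by (intro lp_pow_2_fourier_le integrable_high_multiplier h_int \<rho>)
  also have "\<dots> \<le> ennreal (4 ^ k * (2 * pi * \<rho>) powr (2 * (s - 0))) * hdot_sq s h"
    by (rule hdot_sq_high_multiplier_le) (use \<rho> k s_pos in auto)
  also have "\<dots> \<le> ennreal (4 ^ k * (2 * pi * \<rho>) powr (2 * s)) * 1"
    using h by (intro mult_mono) (auto simp: normalized_def)
  finally have high: "lp_pow 2 (fourier (\<lambda>\<xi>. high_multiplier k \<rho> \<xi> * h \<xi>)) \<le>
      ennreal (4 ^ k * (2 * pi * \<rho>) powr (2 * s))" by simp
  have "lp_pow_on S 2 (fourier h) \<le>
      ennreal (2 powr 2) * lp_pow 2 (fourier (\<lambda>\<xi>. high_multiplier k \<rho> \<xi> * h \<xi>)) +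
      ennreal ((2 * (2 ^ k * L)) powr (2 - 1)) * lp_pow_on S 1 (fourier h)"
    by (rule lp_pow_on_fourier_le[OF h_int \<rho> L _ _ S mass]) auto
  also have "\<dots> \<le> ennreal (2 powr 2) * ennreal (4 ^ k * (2 * pi * \<rho>) powr (2 * s)) +
      ennreal ((2 * (2 ^ k * L)) powr (2 - 1)) * lp_pow_on S 1 (fourier h)"
    by (intro add_right_mono mult_left_mono high) simp
  also have "ennreal (2 powr 2) * ennreal (4 ^ k * (2 * pi * \<rho>) powr (2 * s)) =
      ennreal (4 * (4 ^ k * (2 * pi * \<rho>) powr (2 * s)))"
    by (subst ennreal_mult) auto
  finally show ?thesis using L by simp
qed

lemma unit_ball_L2_bounded:
  "\<exists>K\<ge>0. \<forall>h. normalized h \<longrightarrow> lp_pow_on (ball 0 1) 2 (fourier h) \<le> ennreal K"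
proof -
  obtain k :: nat where k: "s \<le> real k" using real_arch_simple by blast
  define L where "L = mass_const / unit_ball_vol d"
  have L: "L \<ge> 0" using mass_const_pos by (simp add: L_def less_imp_le)
  define K where "K = 4 * (4 ^ k * (2 * pi * 1) powr (2 * s)) + 2 * (2 ^ k * L) * mass_const"
  have "lp_pow_on (ball 0 1) 2 (fourier h) \<le> ennreal K" if h: "normalized h" for h
  proof -
    have "lp_pow_on (ball 0 1) 2 (fourier h) \<le> ennreal (4 * (4 ^ k * (2 * pi * 1) powr (2 * s))) +
        ennreal (2 * (2 ^ k * L)) * lp_pow_on (ball 0 1) 1 (fourier h)"
      by (rule L2_le_if_ball_mass_le[OF h _ k L])
         (use unit_ball_mass_le[OF h] in \<open>auto simp: L_def\<close>)
    also have "\<dots> \<le> ennreal (4 * (4 ^ k * (2 * pi * 1) powr (2 * s))) +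
        ennreal (2 * (2 ^ k * L)) * ennreal mass_const"
      using ball_mass_le[OF h, of 1 0] by (intro add_left_mono mult_left_mono) auto
    also have "\<dots> = ennreal K"
      using L mass_const_pos by (simp add: K_def flip: ennreal_mult ennreal_plus)
    finally show ?thesis .
  qed
  moreover have "K \<ge> 0" using L mass_const_pos by (simp add: K_def)
  ultimately show ?thesis by blast
qed

lemma far_ball_mass_le:
  assumes h: "normalized h" and \<rho>: "\<rho> > 0" and R: "R > 0"
    and z: "R / 2 \<le> norm z" "norm z + 3 * \<rho> \<le> 4 * R"
  shows "lp_pow_on (ball z \<rho>) 1 (fourier h) \<le>
    ennreal (2 ^ DIM('a) * (2 * \<rho> / R) ^ (DIM('a) - 1) * (mass_const * (4 * R) powr \<beta>))"
proof -
  note [measurable] = normalized_measurable[OF h]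
  have z_pos: "norm z > 0" using z(1) R by linarith
  have "lp_pow_on (ball z \<rho>) 1 (fourier h) \<le> ennreal (2 ^ DIM('a) * (\<rho> / norm z) ^ (DIM('a) - 1)) *
      lp_pow_on (ball 0 (norm z + 3 * \<rho>)) 1 (fourier h)"
    by (rule radial_ball_mass_le) (use h \<rho> z_pos in \<open>auto simp: normalized_def\<close>)
  also have "\<dots> \<le> ennreal (2 ^ DIM('a) * (2 * \<rho> / R) ^ (DIM('a) - 1)) *
      ennreal (mass_const * (4 * R) powr \<beta>)"
  proof (intro mult_mono ennreal_leI mult_left_mono power_mono)
    show "\<rho> / norm z \<le> 2 * \<rho> / R" using z(1) z_pos R \<rho> by (simp add: field_simps)
    have "lp_pow_on (ball 0 (norm z + 3 * \<rho>)) 1 (fourier h) \<le>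
        lp_pow_on (ball 0 (4 * R)) 1 (fourier h)"
      using z(2) by (intro lp_pow_on_mono subset_ball)
    also have "\<dots> \<le> ennreal (mass_const * (4 * R) powr \<beta>)" using R by (intro ball_mass_le h) simp
    finally show "lp_pow_on (ball 0 (norm z + 3 * \<rho>)) 1 (fourier h) \<le>
        ennreal (mass_const * (4 * R) powr \<beta>)" .
  qed (use \<rho> in auto)
  also have "\<dots> = ennreal (2 ^ DIM('a) * (2 * \<rho> / R) ^ (DIM('a) - 1) *
      (mass_const * (4 * R) powr \<beta>))"
    using \<rho> R by (intro ennreal_mult'[symmetric]) simp
  finally show ?thesis .
qed

lemma annulus_ball_mass_le:
  assumes h: "normalized h" and \<rho>: "\<rho> > 0" and width: "2 * ((k + 3) * \<rho>) \<le> R" "k \<ge> 0"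
    and x: "x \<in> dyadic_annulus R" and z: "dist x z \<le> k * \<rho>"
  defines "K \<equiv> 2 ^ DIM('a) * 2 ^ (DIM('a) - 1) * 4 powr \<beta> * mass_const / unit_ball_vol d"
  shows "lp_pow_on (ball z \<rho>) 1 (fourier h) \<le>
    ennreal (K * (R powr (\<beta> - (d - 1)) / \<rho>) * measure lborel (ball (0::'a) \<rho>))"
proof -
  have width': "2 * (k * \<rho>) + 6 * \<rho> \<le> R" "k * \<rho> \<ge> 0" using width \<rho> by (auto simp: algebra_simps)
  then have R: "R > 0" using \<rho> by linarith
  have "norm x \<le> norm z + dist x z" "norm z \<le> norm x + dist x z"
    using norm_triangle_ineq2[of x z] norm_triangle_ineq3[of x z] by (auto simp: dist_norm)
  then have "R / 2 \<le> norm z" "norm z + 3 * \<rho> \<le> 4 * R"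
    using x z width' \<rho> by (auto simp: dyadic_annulus_def)
  then have "lp_pow_on (ball z \<rho>) 1 (fourier h) \<le>
      ennreal (2 ^ DIM('a) * (2 * \<rho> / R) ^ (DIM('a) - 1) * (mass_const * (4 * R) powr \<beta>))"
    by (rule far_ball_mass_le[OF h \<rho> R])
  also have "2 ^ DIM('a) * (2 * \<rho> / R) ^ (DIM('a) - 1) * (mass_const * (4 * R) powr \<beta>) =
      K * (R powr (\<beta> - (d - 1)) / \<rho>) * measure lborel (ball (0::'a) \<rho>)"
  proof -
    obtain m where m: "DIM('a) = Suc m" using DIM_positive[where 'a='a] gr0_conv_Suc by blast
    have volume: "measure lborel (ball (0::'a) \<rho>) = unit_ball_vol d * (\<rho> * \<rho> ^ m)"
      using \<rho> by (simp add: content_ball d_def m)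
    have "R powr (\<beta> - (d - 1)) = R powr \<beta> / R ^ m"
      using R by (simp add: d_def m powr_diff powr_realpow)
    moreover have "(4 * R) powr \<beta> = 4 powr \<beta> * R powr \<beta>" using R by (simp add: powr_mult)
    moreover have "unit_ball_vol d \<noteq> 0" by (simp add: less_imp_neq[symmetric])
    ultimately show ?thesis
      unfolding volume K_def using \<rho> R by (simp add: m field_simps power_mult_distrib power_divide)
  qed
  finally show ?thesis .
qed

lemma annulus_L2_le_width:
  "\<exists>c>0. \<exists>K\<ge>0. \<forall>h R \<rho>. normalized h \<longrightarrow> 0 < \<rho> \<longrightarrow> \<rho> \<le> c * R \<longrightarrow>
    lp_pow_on (dyadic_annulus R) 2 (fourier h) \<le>
      ennreal (K * (\<rho> powr (2 * s) + R powr (2 * \<beta> - (d - 1)) / \<rho>))"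
proof -
  obtain k :: nat where k: "s \<le> real k" using real_arch_simple by blast
  define c where "c = 1 / (2 * (real k + 3))"
  define M where "M = 2 ^ DIM('a) * 2 ^ (DIM('a) - 1) * 4 powr \<beta> * mass_const / unit_ball_vol d"
  define K1 where "K1 = 4 * (4 ^ k * (2 * pi) powr (2 * s))"
  define K2 where "K2 = 2 * (2 ^ k * M) * (mass_const * 2 powr \<beta>)"
  have M: "M \<ge> 0" using mass_const_pos by (simp add: M_def less_imp_le)
  have K: "K1 \<ge> 0" "K2 \<ge> 0" using M mass_const_pos by (simp_all add: K1_def K2_def)
  have "lp_pow_on (dyadic_annulus R) 2 (fourier h) \<le>
      ennreal ((K1 + K2) * (\<rho> powr (2 * s) + R powr (2 * \<beta> - (d - 1)) / \<rho>))"
    if h: "normalized h" and \<rho>: "0 < \<rho>" and width: "\<rho> \<le> c * R" for h R \<rho>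
  proof -
    have R_ge: "2 * ((real k + 3) * \<rho>) \<le> R" using width by (simp add: c_def field_simps)
    note ball_mass = annulus_ball_mass_le[OF h \<rho> R_ge, folded M_def]
    have R: "R > 0" by (rule less_le_trans[OF _ R_ge]) (use \<rho> in simp)
    define L where "L = M * (R powr (\<beta> - (d - 1)) / \<rho>)"
    have L: "L \<ge> 0" using M \<rho> by (simp add: L_def)
    have "lp_pow_on (dyadic_annulus R) 2 (fourier h) \<le>
        ennreal (4 * (4 ^ k * (2 * pi * \<rho>) powr (2 * s))) +
        ennreal (2 * (2 ^ k * L)) * lp_pow_on (dyadic_annulus R) 1 (fourier h)"
      by (rule L2_le_if_ball_mass_le[OF h \<rho> k L _ ball_mass[folded L_def]]) auto
    also have "\<dots> \<le> ennreal (4 * (4 ^ k * (2 * pi * \<rho>) powr (2 * s))) +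
        ennreal (2 * (2 ^ k * L)) * ennreal (mass_const * (2 * R) powr \<beta>)"
      by (intro add_left_mono mult_left_mono annulus_mass_le h R) simp
    also have "\<dots> = ennreal (4 * (4 ^ k * (2 * pi * \<rho>) powr (2 * s)) +
        2 * (2 ^ k * L) * (mass_const * (2 * R) powr \<beta>))"
      using L mass_const_pos by (simp flip: ennreal_mult ennreal_plus)
    also have "\<dots> = ennreal (K1 * \<rho> powr (2 * s) + K2 * (R powr (2 * \<beta> - (d - 1)) / \<rho>))"
    proof -
      have "R powr (2 * \<beta> - (d - 1)) = R powr (\<beta> - (d - 1)) * R powr \<beta>"
        unfolding powr_add[symmetric] by (rule arg_cong[of _ _ "(powr) R"]) simp
      then show ?thesis
        using R \<rho> by (simp add: K1_def K2_def L_def powr_mult mult_ac)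
    qed
    also have "\<dots> \<le> ennreal ((K1 + K2) * (\<rho> powr (2 * s) + R powr (2 * \<beta> - (d - 1)) / \<rho>))"
      unfolding distrib_left by (intro ennreal_leI add_mono mult_right_mono) (use K \<rho> in auto)
    finally show ?thesis .
  qed
  moreover have "c > 0" by (simp add: c_def)
  ultimately show ?thesis using K by (intro exI[of _ c] conjI exI[of _ "K1 + K2"]) auto
qed

text \<open>The two terms balance for the width \<open>\<rho> = R\<^bsup>-\<sigma>\<^esup>\<close>.\<close>

lemma annulus_L2_le:
  "\<exists>K\<ge>0. \<forall>h R. normalized h \<longrightarrow> R \<ge> 1 \<longrightarrow>
    lp_pow_on (dyadic_annulus R) 2 (fourier h) \<le> ennreal (K * R powr (- 2 * s * \<sigma>))"
proof -
  obtain c K where c: "c > 0" and K: "K \<ge> 0"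
    and width: "\<And>h R \<rho>. normalized h \<Longrightarrow> 0 < \<rho> \<Longrightarrow> \<rho> \<le> c * R \<Longrightarrow>
      lp_pow_on (dyadic_annulus R) 2 (fourier h) \<le>
        ennreal (K * (\<rho> powr (2 * s) + R powr (2 * \<beta> - (d - 1)) / \<rho>))"
    using annulus_L2_le_width by blast
  have "lp_pow_on (dyadic_annulus R) 2 (fourier h) \<le>
      ennreal (K * (c powr (2 * s) + 1 / c) * R powr (- 2 * s * \<sigma>))"
    if h: "normalized h" and R: "R \<ge> 1" for h R
  proof -
    define \<rho> where "\<rho> = c * R powr - \<sigma>"
    have \<rho>: "\<rho> > 0" using c R by (simp add: \<rho>_def)
    have "R powr - \<sigma> \<le> R powr 1" using R \<sigma>_pos by (intro powr_mono) auto
    then have "\<rho> \<le> c * R" using c R by (simp add: \<rho>_def)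
    then have "lp_pow_on (dyadic_annulus R) 2 (fourier h) \<le>
        ennreal (K * (\<rho> powr (2 * s) + R powr (2 * \<beta> - (d - 1)) / \<rho>))"
      by (rule width[OF h \<rho>])
    also have "\<rho> powr (2 * s) = c powr (2 * s) * R powr (- 2 * s * \<sigma>)"
      using c R by (simp add: \<rho>_def powr_mult powr_powr mult_ac)
    also have "R powr (2 * \<beta> - (d - 1)) / \<rho> = 1 / c * R powr (- 2 * s * \<sigma>)"
    proof -
      have "2 * \<beta> - (d - 1) + \<sigma> = - 2 * s * \<sigma>" using \<sigma>_mult by (simp add: algebra_simps)
      then have "R powr (- 2 * s * \<sigma>) = R powr (2 * \<beta> - (d - 1)) * R powr \<sigma>"
        unfolding powr_add[symmetric] by simp
      then show ?thesis using c R by (simp add: \<rho>_def powr_minus divide_inverse)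
    qed
    finally show ?thesis by (simp add: algebra_simps)
  qed
  moreover have "K * (c powr (2 * s) + 1 / c) \<ge> 0" using c K by simp
  ultimately show ?thesis by blast
qed

subsection \<open>Exponents at most two\<close>

definition decay_rate :: "real \<Rightarrow> real" where
  "decay_rate p = 2 * s * \<sigma> * (p - 1) - \<beta> * (2 - p)"

lemma annulus_lp_le:
  assumes p: "1 \<le> p" "p \<le> 2"
  shows "\<exists>K\<ge>0. \<forall>h R. normalized h \<longrightarrow> R \<ge> 1 \<longrightarrow>
    lp_pow_on (dyadic_annulus R) p (fourier h) \<le> ennreal (K * R powr - decay_rate p)"
proof -
  obtain K where K: "K \<ge> 0" and L2: "\<And>h R. normalized h \<Longrightarrow> R \<ge> 1 \<Longrightarrow>
      lp_pow_on (dyadic_annulus R) 2 (fourier h) \<le> ennreal (K * R powr (- 2 * s * \<sigma>))"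
    using annulus_L2_le by blast
  have "lp_pow_on (dyadic_annulus R) p (fourier h) \<le>
      ennreal ((K + mass_const * 2 powr \<beta>) * R powr - decay_rate p)"
    if h: "normalized h" and R: "R \<ge> 1" for h R
  proof -
    note [measurable] = normalized_measurable[OF h]
    define \<mu> where "\<mu> = R powr (- 2 * s * \<sigma> - \<beta>)"
    have "lp_pow_on (dyadic_annulus R) p (fourier h) \<le>
        ennreal (\<mu> powr (p - 2) * (K * R powr (- 2 * s * \<sigma>)) + \<mu> powr (p - 1) *
            (mass_const * (2 * R) powr \<beta>))"
      using R K mass_const_pos p
      by (intro lp_pow_on_interpolate L2 annulus_mass_le h) (auto simp: \<mu>_def)
    also have "\<mu> powr (p - 2) * (K * R powr (- 2 * s * \<sigma>)) +
        \<mu> powr (p - 1) * (mass_const * (2 * R) powr \<beta>) =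
        K * (\<mu> powr (p - 2) * R powr (- 2 * s * \<sigma>)) + mass_const * 2 powr \<beta> *
           (\<mu> powr (p - 1) * R powr \<beta>)"
      using R by (simp add: powr_mult mult_ac)
    also have "\<mu> powr (p - 2) * R powr (- 2 * s * \<sigma>) = R powr - decay_rate p"
      unfolding \<mu>_def powr_powr powr_add[symmetric]
      by (rule arg_cong[of _ _ "(powr) R"]) (simp add: decay_rate_def algebra_simps)
    also have "\<mu> powr (p - 1) * R powr \<beta> = R powr - decay_rate p"
      unfolding \<mu>_def powr_powr powr_add[symmetric]
      by (rule arg_cong[of _ _ "(powr) R"]) (simp add: decay_rate_def algebra_simps)
    finally show ?thesis by (simp add: distrib_right)
  qed
  moreover have "K + mass_const * 2 powr \<beta> \<ge> 0" using K mass_const_pos by simp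
  ultimately show ?thesis by blast
qed

theorem lp_bounded_le_2:
  assumes p: "1 \<le> p" "p \<le> 2" and decay: "decay_rate p > 0"
  shows "\<exists>C\<ge>0. \<forall>h. normalized h \<longrightarrow> lp_pow p (fourier h) \<le> ennreal C"
proof -
  obtain K0 where K0: "K0 \<ge> 0"
    and L2: "\<And>h. normalized h \<Longrightarrow> lp_pow_on (ball 0 1) 2 (fourier h) \<le> ennreal K0"
    using unit_ball_L2_bounded by blast
  obtain K where K: "K \<ge> 0" and annuli: "\<And>h R. normalized h \<Longrightarrow> R \<ge> 1 \<Longrightarrow>
      lp_pow_on (dyadic_annulus R) p (fourier h) \<le> ennreal (K * R powr - decay_rate p)"
    using annulus_lp_le[OF p] by blast
  have "lp_pow p (fourier h) \<le> ennreal (K0 + mass_const + K / (1 - 2 powr - decay_rate p))"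
    if h: "normalized h" for h
  proof -
    note [measurable] = normalized_measurable[OF h]
    have "lp_pow_on (ball 0 1) p (fourier h) \<le>
        ennreal (1 powr (p - 2) * K0 + 1 powr (p - 1) * mass_const)"
      using ball_mass_le[OF h, of 1 0] L2[OF h] K0 mass_const_pos p
      by (intro lp_pow_on_interpolate) auto
    then show ?thesis
      using annuli[OF h] K0 K mass_const_pos decay
      by (intro lp_pow_le_if_dyadic_decay) auto
  qed
  moreover have "K0 + mass_const + K / (1 - 2 powr - decay_rate p) \<ge> 0"
    using K0 K mass_const_pos powr_less_one[of 2 "- decay_rate p"] decay by simp
  ultimately show ?thesis by blast
qed

lemma
  shows p_rad_gt_1: "1 < p_rad d s \<alpha>" and p_rad_less_2: "p_rad d s \<alpha> < 2"
    and decay_rate_pos: "p_rad d s \<alpha> < p \<Longrightarrow> decay_rate p > 0"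
proof -
  define N where "N = 2 * \<beta> + 2 * s * (d - 1)"
  define D where "D = - (2 * s - 1) * \<beta> + 2 * s * (d - 1)"
  have p_rad: "p_rad d s \<alpha> = N / D" by (simp add: p_rad_def N_def D_def \<beta>_def)
  have "2 * s * (2 * \<beta>) < 2 * s * (d - 1)" using \<beta>_less s_pos by (intro mult_strict_left_mono) auto
  then have s\<beta>: "4 * (s * \<beta>) < 2 * s * (d - 1)" "s * \<beta> > 0" using \<beta>_pos s_pos by auto
  then have D: "D > 0" using \<beta>_pos unfolding D_def by (simp add: algebra_simps)
  show "1 < p_rad d s \<alpha>" using D s\<beta>(2) \<beta>_pos unfolding p_rad
    by (simp add: N_def D_def algebra_simps)
  have "N < 2 * D" using s\<beta>(1) by (simp add: N_def D_def algebra_simps)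
  then show "p_rad d s \<alpha> < 2" using D unfolding p_rad by (simp add: pos_divide_less_eq)
  assume "p_rad d s \<alpha> < p"
  then have "0 < p * D - N" using D unfolding p_rad by (simp add: pos_divide_less_eq)
  also have "p * D - N = 2 * s * (d - 1 - 2 * \<beta>) * (p - 1) - \<beta> * (2 - p) * (2 * s + 1)"
    by (simp add: N_def D_def algebra_simps)
  also have "\<dots> = decay_rate p * (2 * s + 1)"
    unfolding \<sigma>_mult[symmetric] by (simp add: decay_rate_def algebra_simps)
  finally show "decay_rate p > 0" using s_pos by (simp add: zero_less_mult_iff)
qed

subsection \<open>Exponents above two\<close>

lemma lp_high_multiplier_bounded:
  assumes p: "p > 2" and sobolev: "d/2 - d/p \<le> s" and k: "s \<le> real k"
  shows "\<exists>C\<ge>0. \<forall>h. normalized h \<longrightarrow> lp_pow p (fourier (\<lambda>\<xi>. high_multiplier k 1 \<xi> * h \<xi>)) \<le> ennreal C"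
proof -
  define t where "t = d/2 - d/p"
  have "d/p < d/2" by (rule divide_strict_left_mono) (use p d_gt_1 in auto)
  moreover have "0 < d/p" using p d_gt_1 by simp
  ultimately have t: "0 < t" "2 * t < d" "p = 2 * d / (d - 2 * t)" "t \<le> s"
    using p d_gt_1 sobolev by (simp_all add: t_def)
  define e where "e = 4 ^ k * (2 * pi * 1) powr (2 * (s - t))"
  have e: "e > 0" by (simp add: e_def)
  obtain C where C: "C \<ge> 0" and sobolev_high: "\<And>h :: 'a \<Rightarrow> complex. integrable lborel h \<Longrightarrow>
      hdot_sq t h \<le> ennreal e \<Longrightarrow> lp_pow p (fourier h) \<le> ennreal (C * e powr (p / 2))"
    using sobolev_inequality[where 'a='a, folded d_def, OF t(1-3)] e by blast
  have "lp_pow p (fourier (\<lambda>\<xi>. high_multiplier k 1 \<xi> * h \<xi>)) \<le> ennreal (C * e powr (p / 2))"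
    if h: "normalized h" for h
  proof (rule sobolev_high)
    note [measurable] = normalized_measurable[OF h]
    show "integrable lborel (\<lambda>\<xi>. high_multiplier k 1 \<xi> * h \<xi>)"
      using h by (intro integrable_high_multiplier) (auto simp: normalized_def)
    have "hdot_sq t (\<lambda>\<xi>. high_multiplier k 1 \<xi> * h \<xi>) \<le> ennreal e * hdot_sq s h"
      unfolding e_def by (rule hdot_sq_high_multiplier_le) (use t k s_pos in auto)
    also have "\<dots> \<le> ennreal e * 1"
      using h by (intro mult_left_mono) (auto simp: normalized_def)
    finally show "hdot_sq t (\<lambda>\<xi>. high_multiplier k 1 \<xi> * h \<xi>) \<le> ennreal e" by simp
  qed
  moreover have "C * e powr (p / 2) \<ge> 0" using C by simp
  ultimately show ?thesis by blast
qed

theorem lp_bounded_gt_2: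
  assumes p: "p > 2" and sobolev: "d/2 - d/p \<le> s"
  shows "\<exists>C\<ge>0. \<forall>h. normalized h \<longrightarrow> lp_pow p (fourier h) \<le> ennreal C"
proof -
  obtain k :: nat where k: "s \<le> real k" using real_arch_simple by blast
  define L where "L = mass_const / unit_ball_vol d"
  have L: "L \<ge> 0" using mass_const_pos by (simp add: L_def less_imp_le)
  define c where "c = (2 * (2 ^ k * L)) powr (p - 2)"
  obtain C1 where C1: "C1 \<ge> 0"
    "\<And>h. normalized h \<Longrightarrow> lp_pow p (fourier (\<lambda>\<xi>. high_multiplier k 1 \<xi> * h \<xi>)) \<le> ennreal C1"
    using lp_high_multiplier_bounded[OF p sobolev k] by blast
  obtain C2 where C2: "C2 \<ge> 0" "\<And>h. normalized h \<Longrightarrow> lp_pow 2 (fourier h) \<le> ennreal C2"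
    using lp_bounded_le_2[of 2] decay_rate_pos[OF p_rad_less_2] by auto
  have "lp_pow p (fourier h) \<le> ennreal (2 powr p * C1 + c * C2)" if h: "normalized h" for h
  proof -
    have "lp_pow_on UNIV p (fourier h) \<le>
        ennreal (2 powr p) * lp_pow p (fourier (\<lambda>\<xi>. high_multiplier k 1 \<xi> * h \<xi>)) +
        ennreal c * lp_pow_on UNIV 2 (fourier h)"
      unfolding c_def
      by (rule lp_pow_on_fourier_le[OF _ _ L])
         (use h p unit_ball_mass_le[OF h] in \<open>auto simp: L_def normalized_def\<close>)
    also have "\<dots> \<le> ennreal (2 powr p) * ennreal C1 + ennreal c * ennreal C2"
      unfolding lp_pow_on_UNIV by (intro add_mono mult_left_mono C1(2) C2(2) h) auto
    also have "\<dots> = ennreal (2 powr p * C1 + c * C2)"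
      using C1(1) C2(1) by (simp add: c_def flip: ennreal_mult ennreal_plus)
    finally show ?thesis by (simp add: lp_pow_on_UNIV)
  qed
  moreover have "2 powr p * C1 + c * C2 \<ge> 0" using C1(1) C2(1) by (simp add: c_def)
  ultimately show ?thesis by blast
qed

corollary lp_bounded:
  assumes p: "p_rad d s \<alpha> < p" and sobolev: "s < d/2 \<Longrightarrow> p \<le> 2 * d / (d - 2 * s)"
  shows "\<exists>C\<ge>0. \<forall>h. normalized h \<longrightarrow> lp_pow p (fourier h) \<le> ennreal C"
proof (cases "p \<le> 2")
  case True
  then show ?thesis using p p_rad_gt_1 decay_rate_pos[OF p] by (intro lp_bounded_le_2) auto
next
  case False
  have "d/2 - d/p \<le> s"
  proof (cases "s < d/2")
    case True
    then have "p * (d - 2 * s) \<le> 2 * d" using sobolev by (simp add: pos_le_divide_eq)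
    then have "d - 2 * s \<le> 2 * d / p" using False by (simp add: pos_le_divide_eq mult.commute)
    then show ?thesis by simp
  next
    case False
    moreover have "d/p \<ge> 0" using \<open>\<not> p \<le> 2\<close> d_gt_1 by simp
    ultimately show ?thesis by linarith
  qed
  then show ?thesis using False by (intro lp_bounded_gt_2) auto
qed

end

section \<open>Scaling\<close>

lemma lp_pow_dilate:
  fixes u :: "'a::euclidean_space \<Rightarrow> complex"
  assumes [measurable]: "u \<in> borel_measurable borel" and R: "R > 0" and c: "c > 0"
  shows "lp_pow p (\<lambda>x. complex_of_real c * u (R *\<^sub>R x)) =
      ennreal (c powr p * R powr - real DIM('a)) * lp_pow p u"
proof -
  have "lp_pow p (\<lambda>x. complex_of_real c * u (R *\<^sub>R x)) =
      (\<integral>\<^sup>+x. ennreal (c powr p) * ennreal (cmod (u (R *\<^sub>R x)) powr p) \<partial>lborel)"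
    unfolding lp_pow_def using c
    by (intro nn_integral_cong) (simp add: norm_mult powr_mult ennreal_mult)
  also have "\<dots> = ennreal (c powr p) * (\<integral>\<^sup>+x. ennreal (cmod (u (R *\<^sub>R x)) powr p) \<partial>lborel)"
    by (rule nn_integral_cmult) measurable
  also have "(\<integral>\<^sup>+x. ennreal (cmod (u (R *\<^sub>R x)) powr p) \<partial>lborel) =
      ennreal (R powr - real DIM('a)) * lp_pow p u"
    unfolding lp_pow_def by (rule nn_integral_lborel_scale[OF _ R]) measurable
  finally show ?thesis by (simp add: ennreal_mult mult.assoc)
qed

lemma riesz_conv_dilate:
  fixes u :: "'a::euclidean_space \<Rightarrow> complex"
  assumes [measurable]: "u \<in> borel_measurable borel" and R: "R > 0" and c: "c > 0"
  shows "riesz_conv \<alpha> (\<lambda>x. complex_of_real c * u (R *\<^sub>R x)) x =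
    ennreal (c * R powr (\<alpha> - real DIM('a))) * riesz_conv \<alpha> u (R *\<^sub>R x)"
proof -
  have "riesz_conv \<alpha> (\<lambda>x. complex_of_real c * u (R *\<^sub>R x)) x =
      (\<integral>\<^sup>+y. ennreal (c * R powr \<alpha>) * ennreal (norm (R *\<^sub>R x - R *\<^sub>R y) powr - \<alpha> * cmod (u (R *\<^sub>R y)))
          \<partial>lborel)"
    unfolding riesz_conv_def
  proof (rule nn_integral_cong)
    fix y
    have "norm (R *\<^sub>R x - R *\<^sub>R y) = R * norm (x - y)"
      using R by (simp add: scaleR_diff_right[symmetric])
    then have "R powr \<alpha> * norm (R *\<^sub>R x - R *\<^sub>R y) powr - \<alpha> = norm (x - y) powr - \<alpha>"
      using R by (simp add: powr_mult powr_minus)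
    then have "norm (x - y) powr - \<alpha> * cmod (complex_of_real c * u (R *\<^sub>R y)) =
        c * R powr \<alpha> * (norm (R *\<^sub>R x - R *\<^sub>R y) powr - \<alpha> * cmod (u (R *\<^sub>R y)))"
      using c by (simp add: norm_mult mult_ac)
    then show "ennreal (norm (x - y) powr - \<alpha> * cmod (complex_of_real c * u (R *\<^sub>R y))) =
        ennreal (c * R powr \<alpha>) * ennreal (norm (R *\<^sub>R x - R *\<^sub>R y) powr - \<alpha> * cmod (u (R *\<^sub>R y)))"
      using c by (simp only: ennreal_mult'[symmetric] less_imp_le powr_ge_zero mult_nonneg_nonneg)
  qed
  also have "\<dots> = ennreal (c * R powr \<alpha>) *
      (\<integral>\<^sup>+y. ennreal (norm (R *\<^sub>R x - R *\<^sub>R y) powr - \<alpha> * cmod (u (R *\<^sub>R y))) \<partial>lborel)"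
    by (rule nn_integral_cmult) measurable
  also have "(\<integral>\<^sup>+y. ennreal (norm (R *\<^sub>R x - R *\<^sub>R y) powr - \<alpha> * cmod (u (R *\<^sub>R y))) \<partial>lborel) =
      ennreal (R powr - real DIM('a)) * riesz_conv \<alpha> u (R *\<^sub>R x)"
    unfolding riesz_conv_def
    by (rule nn_integral_lborel_scale[OF _ R,
          of "\<lambda>y. ennreal (norm (R *\<^sub>R x - y) powr - \<alpha> * cmod (u y))"]) measurable
  also have "ennreal (c * R powr \<alpha>) * (ennreal (R powr - real DIM('a)) * riesz_conv \<alpha> u (R *\<^sub>R x)) =
      ennreal (c * (R powr \<alpha> * R powr - real DIM('a))) * riesz_conv \<alpha> u (R *\<^sub>R x)"
    using c by (simp add: ennreal_mult mult.assoc)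
  also have "R powr \<alpha> * R powr - real DIM('a) = R powr (\<alpha> - real DIM('a))"
    by (simp add: powr_add[symmetric])
  finally show ?thesis .
qed

lemma conv_sq_dilate:
  fixes u :: "'a::euclidean_space \<Rightarrow> complex"
  assumes [measurable]: "u \<in> borel_measurable borel" and R: "R > 0" and c: "c > 0"
  shows "conv_sq \<alpha> (\<lambda>x. complex_of_real c * u (R *\<^sub>R x)) =
    ennreal (c\<^sup>2 * R powr (2 * \<alpha> - 3 * real DIM('a))) * conv_sq \<alpha> u"
proof -
  define b where "b = c * R powr (\<alpha> - real DIM('a))"
  have "conv_sq \<alpha> (\<lambda>x. complex_of_real c * u (R *\<^sub>R x)) =
      (\<integral>\<^sup>+x. ennreal (b\<^sup>2) * (riesz_conv \<alpha> u (R *\<^sub>R x))\<^sup>2 \<partial>lborel)"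
    unfolding conv_sq_def b_def using c
    by (simp add: riesz_conv_dilate R power_mult_distrib ennreal_power)
  also have "\<dots> = ennreal (b\<^sup>2) * (\<integral>\<^sup>+x. (riesz_conv \<alpha> u (R *\<^sub>R x))\<^sup>2 \<partial>lborel)"
    by (rule nn_integral_cmult) measurable
  also have "(\<integral>\<^sup>+x. (riesz_conv \<alpha> u (R *\<^sub>R x))\<^sup>2 \<partial>lborel) =
      ennreal (R powr - real DIM('a)) * conv_sq \<alpha> u"
    unfolding conv_sq_def by (rule nn_integral_lborel_scale[OF _ R]) measurable
  also have "ennreal (b\<^sup>2) * (ennreal (R powr - real DIM('a)) * conv_sq \<alpha> u) =
      ennreal (b\<^sup>2 * R powr - real DIM('a)) * conv_sq \<alpha> u"
    by (simp add: ennreal_mult mult.assoc)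
  also have "b\<^sup>2 * R powr - real DIM('a) = c\<^sup>2 * R powr (2 * \<alpha> - 3 * real DIM('a))"
  proof -
    have "R powr (2 * \<alpha> - 3 * real DIM('a)) =
        R powr (\<alpha> - real DIM('a)) * R powr (\<alpha> - real DIM('a)) * R powr - real DIM('a)"
      unfolding powr_add[symmetric] by (rule arg_cong[of _ _ "(powr) R"]) simp
    then show ?thesis by (simp add: b_def power2_eq_square mult_ac)
  qed
  finally show ?thesis .
qed

lemma hdot_sq_dilate:
  fixes h :: "'a::euclidean_space \<Rightarrow> complex"
  assumes [measurable]: "h \<in> borel_measurable borel" and R: "R > 0"
  shows "hdot_sq s (\<lambda>\<xi>. complex_of_real c * h (\<xi> /\<^sub>R R)) =
      ennreal (c\<^sup>2 * R powr (2 * s + real DIM('a))) * hdot_sq s h"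
proof -
  define energy where "energy \<xi> = norm \<xi> powr (2 * s) * (cmod (h \<xi>))\<^sup>2" for \<xi>
  have [measurable]: "energy \<in> borel_measurable borel" unfolding energy_def by measurable
  have "hdot_sq s (\<lambda>\<xi>. complex_of_real c * h (\<xi> /\<^sub>R R)) =
      (\<integral>\<^sup>+\<xi>. ennreal (c\<^sup>2 * R powr (2 * s)) * ennreal (energy (\<xi> /\<^sub>R R)) \<partial>lborel)"
    unfolding hdot_sq_def
  proof (rule nn_integral_cong)
    fix \<xi> :: 'a
    have "R powr (2 * s) * norm (\<xi> /\<^sub>R R) powr (2 * s) = norm \<xi> powr (2 * s)"
      using R by (simp add: powr_mult[symmetric] mult.assoc[symmetric])
    then have "norm \<xi> powr (2 * s) * (cmod (complex_of_real c * h (\<xi> /\<^sub>R R)))\<^sup>2 =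
        c\<^sup>2 * R powr (2 * s) * energy (\<xi> /\<^sub>R R)"
      unfolding energy_def by (simp add: norm_mult power_mult_distrib mult_ac)
    then show "ennreal (norm \<xi> powr (2 * s) * (cmod (complex_of_real c * h (\<xi> /\<^sub>R R)))\<^sup>2) =
        ennreal (c\<^sup>2 * R powr (2 * s)) * ennreal (energy (\<xi> /\<^sub>R R))"
      by (simp only: ennreal_mult'[symmetric] powr_ge_zero mult_nonneg_nonneg zero_le_power2)
  qed
  also have "\<dots> = ennreal (c\<^sup>2 * R powr (2 * s)) * (\<integral>\<^sup>+\<xi>. ennreal (energy (\<xi> /\<^sub>R R)) \<partial>lborel)"
    by (rule nn_integral_cmult) measurable
  also have "(\<integral>\<^sup>+\<xi>. ennreal (energy (\<xi> /\<^sub>R R)) \<partial>lborel) =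
      ennreal (inverse R powr - real DIM('a)) * hdot_sq s h"
    unfolding hdot_sq_def energy_def[symmetric]
    by (rule nn_integral_lborel_scale[of "\<lambda>\<xi>. ennreal (energy \<xi>)"]) (use R in auto)
  also have "inverse R powr - real DIM('a) = R powr real DIM('a)"
    using R by (simp add: powr_minus inverse_powr)
  finally show ?thesis
    by (simp add: powr_add ennreal_mult mult.assoc)
qed

lemma fourier_dilate:
  fixes h :: "'a::euclidean_space \<Rightarrow> complex"
  assumes "h \<in> borel_measurable borel" and R: "R > 0"
  shows "fourier (\<lambda>\<xi>. complex_of_real (c * R powr - real DIM('a)) * h (\<xi> /\<^sub>R R)) =
    (\<lambda>x. complex_of_real c * fourier h (R *\<^sub>R x))"
proof
  fix x :: 'a
  have "R powr - real DIM('a) * inverse R powr - real DIM('a) = 1"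
    using R by (simp add: powr_minus inverse_powr)
  then show "fourier (\<lambda>\<xi>. complex_of_real (c * R powr - real DIM('a)) * h (\<xi> /\<^sub>R R)) x =
      complex_of_real c * fourier h (R *\<^sub>R x)"
    using fourier_scale[OF assms(1), of "inverse R" x] R
    by (simp add: fourier_cmult mult.assoc flip: of_real_mult)
qed

context riesz_sobolev
begin

lemma conv_sq_dilate_le_1:
  fixes u :: "'a \<Rightarrow> complex"
  assumes [measurable]: "u \<in> borel_measurable borel" and B: "B > 0" and R: "R > 0"
    and conv: "conv_sq \<alpha> u \<le> ennreal ((R powr (s + d - \<alpha>) * B)\<^sup>2)"
  defines "c \<equiv> R powr (d/2 - s) / B"
  shows "conv_sq \<alpha> (\<lambda>x. complex_of_real c * u (R *\<^sub>R x)) \<le> 1"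
proof -
  have "conv_sq \<alpha> (\<lambda>x. complex_of_real c * u (R *\<^sub>R x)) =
      ennreal (c\<^sup>2 * R powr (2 * \<alpha> - 3 * d)) * conv_sq \<alpha> u"
    unfolding d_def by (rule conv_sq_dilate) (use R B in \<open>auto simp: c_def\<close>)
  also have "\<dots> \<le> ennreal (c\<^sup>2 * R powr (2 * \<alpha> - 3 * d)) * ennreal ((R powr (s + d - \<alpha>) * B)\<^sup>2)"
    by (rule mult_left_mono[OF conv]) simp
  also have "\<dots> = ennreal (c\<^sup>2 * R powr (2 * \<alpha> - 3 * d) * (R powr (s + d - \<alpha>) * B)\<^sup>2)"
    by (simp add: ennreal_mult)
  also have "c\<^sup>2 * R powr (2 * \<alpha> - 3 * d) * (R powr (s + d - \<alpha>) * B)\<^sup>2 =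
      R powr (2 * (d/2 - s)) * R powr (2 * \<alpha> - 3 * d) * R powr (2 * (s + d - \<alpha>))"
    using B by (simp add: c_def power_mult_distrib power_divide power2_eq_square[of "_ powr _"]
        powr_add[symmetric])
  also have "\<dots> = R powr 0"
    unfolding powr_add[symmetric] by (rule arg_cong[of _ _ "(powr) R"]) (simp add: field_simps)
  finally show ?thesis using R by simp
qed

lemma hdot_sq_dilate_le_1:
  fixes h :: "'a \<Rightarrow> complex"
  assumes [measurable]: "h \<in> borel_measurable borel" and B: "B > 0" and R: "R > 0"
    and hdot: "hdot_sq s h \<le> ennreal (B\<^sup>2)"
  defines "c \<equiv> R powr (d/2 - s) / B"
  shows "hdot_sq s (\<lambda>\<xi>. complex_of_real (c * R powr - d) * h (\<xi> /\<^sub>R R)) \<le> 1"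
proof -
  have "hdot_sq s (\<lambda>\<xi>. complex_of_real (c * R powr - d) * h (\<xi> /\<^sub>R R)) =
      ennreal ((c * R powr - d)\<^sup>2 * R powr (2 * s + d)) * hdot_sq s h"
    unfolding d_def by (rule hdot_sq_dilate[OF _ R]) measurable
  also have "\<dots> \<le> ennreal ((c * R powr - d)\<^sup>2 * R powr (2 * s + d)) * ennreal (B\<^sup>2)"
    by (rule mult_left_mono[OF hdot]) simp
  also have "\<dots> = ennreal ((c * R powr - d)\<^sup>2 * R powr (2 * s + d) * B\<^sup>2)"
    by (simp add: ennreal_mult)
  also have "(c * R powr - d)\<^sup>2 * R powr (2 * s + d) * B\<^sup>2 =
      R powr (2 * (d/2 - s)) * R powr (2 * - d) * R powr (2 * s + d)"
    using B by (simp add: c_def power_mult_distrib power_divide power2_eq_square[of "_ powr _"]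
        powr_add[symmetric])
  also have "\<dots> = R powr 0"
    unfolding powr_add[symmetric] by (rule arg_cong[of _ _ "(powr) R"]) (simp add: field_simps)
  finally show ?thesis using R by simp
qed

lemma normalized_dilate:
  assumes h: "integrable lborel h" "radial (fourier h)" and B: "B > 0" and R: "R > 0"
    and conv: "conv_sq \<alpha> (fourier h) \<le> ennreal ((R powr (s + d - \<alpha>) * B)\<^sup>2)"
    and hdot: "hdot_sq s h \<le> ennreal (B\<^sup>2)"
  defines "c \<equiv> R powr (d/2 - s) / B"
  shows "normalized (\<lambda>\<xi>. complex_of_real (c * R powr - d) * h (\<xi> /\<^sub>R R))"
proof -
  have [measurable]: "h \<in> borel_measurable borel" using h(1) by auto
  have "radial (\<lambda>x. complex_of_real c * fourier h (R *\<^sub>R x))"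
    unfolding radial_def
  proof (intro allI impI)
    fix x y :: 'a assume "norm x = norm y"
    then have "norm (R *\<^sub>R x) = norm (R *\<^sub>R y)" by simp
    then show "complex_of_real c * fourier h (R *\<^sub>R x) = complex_of_real c * fourier h (R *\<^sub>R y)"
      using radialD[OF h(2)] by simp
  qed
  moreover have "integrable lborel (\<lambda>\<xi>. complex_of_real (c * R powr - d) * h (\<xi> /\<^sub>R R))"
    using integrable_lborel_affine[OF h(1), of "inverse R" 0] R by simp
  moreover have "fourier (\<lambda>\<xi>. complex_of_real (c * R powr - d) * h (\<xi> /\<^sub>R R)) =
      (\<lambda>x. complex_of_real c * fourier h (R *\<^sub>R x))"
    unfolding d_def by (rule fourier_dilate) (use R in auto)
  ultimately show ?thesis
    using conv_sq_dilate_le_1[OF _ B R conv] hdot_sq_dilate_le_1[OF _ B R hdot]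
    by (simp add: normalized_def c_def)
qed

lemma lp_pow_fourier_le_if_dilate:
  fixes h :: "'a \<Rightarrow> complex"
  assumes [measurable]: "h \<in> borel_measurable borel" and R: "R > 0" and c: "c > 0" and p: "p > 0"
    and "C \<ge> 0"
    and dilate: "lp_pow p (fourier (\<lambda>\<xi>. complex_of_real (c * R powr - d) * h (\<xi> /\<^sub>R R))) \<le> ennreal C"
  shows "lp_pow p (fourier h) \<le> ennreal (C * (R powr (d/p) / c) powr p)"
proof -
  have "fourier (\<lambda>\<xi>. complex_of_real (c * R powr - d) * h (\<xi> /\<^sub>R R)) =
      (\<lambda>x. complex_of_real c * fourier h (R *\<^sub>R x))"
    unfolding d_def by (rule fourier_dilate) (use R in auto)
  then have "ennreal (c powr p * R powr - d) * lp_pow p (fourier h) \<le> ennreal C"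
    using lp_pow_dilate[OF _ R c, of "fourier h" p] dilate by (simp add: d_def)
  then have "lp_pow p (fourier h) \<le> ennreal (1 / (c powr p * R powr - d)) * ennreal C"
    by (rule ennreal_mult_le_imp_le[rotated]) (use c R in simp)
  also have "\<dots> = ennreal (C * (R powr (d/p) / c) powr p)"
    using \<open>C \<ge> 0\<close> R c p
    by (simp add: powr_divide powr_powr powr_minus field_simps flip: ennreal_mult)
  finally show ?thesis .
qed

theorem lp_pow_fourier_le:
  assumes p: "p_rad d s \<alpha> < p" and sobolev: "s < d/2 \<Longrightarrow> p \<le> 2 * d / (d - 2 * s)"
    and \<theta>: "d/p = (1 - \<theta>) * ((d - \<alpha>) + d/2) + \<theta> * (- s + d/2)"
  shows "\<exists>C\<ge>0. \<forall>(h :: 'a \<Rightarrow> complex) A B. A > 0 \<longrightarrow> B > 0 \<longrightarrow>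
    integrable lborel h \<longrightarrow> radial (fourier h) \<longrightarrow>
    conv_sq \<alpha> (fourier h) \<le> ennreal (A\<^sup>2) \<longrightarrow> hdot_sq s h \<le> ennreal (B\<^sup>2) \<longrightarrow>
    lp_pow p (fourier h) \<le> ennreal (C * (A powr (1 - \<theta>) * B powr \<theta>) powr p)"
proof -
  have p_pos: "p > 0" using p p_rad_gt_1 by linarith
  define \<kappa> where "\<kappa> = s + d - \<alpha>"
  have \<kappa>: "\<kappa> > 0" using s_pos \<alpha>_less by (simp add: \<kappa>_def)
  obtain C where C: "C \<ge> 0" "\<And>h. normalized h \<Longrightarrow> lp_pow p (fourier h) \<le> ennreal C"
    using lp_bounded[OF p sobolev] by blast
  have "lp_pow p (fourier h) \<le> ennreal (C * (A powr (1 - \<theta>) * B powr \<theta>) powr p)"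
    if A: "A > 0" and B: "B > 0" and h: "integrable lborel h" "radial (fourier h)"
      and conv: "conv_sq \<alpha> (fourier h) \<le> ennreal (A\<^sup>2)" and hdot: "hdot_sq s h \<le> ennreal (B\<^sup>2)"
    for h :: "'a \<Rightarrow> complex" and A B
  proof -
    define R where "R = (A / B) powr (1 / \<kappa>)"
    define c where "c = R powr (d/2 - s) / B"
    have R: "R > 0" "R powr \<kappa> * B = A" using A B \<kappa> by (simp_all add: R_def powr_powr)
    have c: "c > 0" using R(1) B by (simp add: c_def)
    have "normalized (\<lambda>\<xi>. complex_of_real (c * R powr - d) * h (\<xi> /\<^sub>R R))"
      unfolding c_def by (rule normalized_dilate[OF h B R(1) _ hdot])
         (use conv R(2) in \<open>simp add: \<kappa>_def\<close>)
    then have "lp_pow p (fourier h) \<le> ennreal (C * (R powr (d/p) / c) powr p)"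
      using h(1) R(1) c p_pos C by (intro lp_pow_fourier_le_if_dilate) auto
    also have "R powr (d/p) / c = R powr (d/p - (d/2 - s)) * B"
      using R(1) B by (simp add: c_def powr_diff)
    also have "d/p - (d/2 - s) = \<kappa> * (1 - \<theta>)"
      unfolding \<theta> \<kappa>_def by (simp add: field_simps)
    also have "R powr (\<kappa> * (1 - \<theta>)) * B = (A / B) powr (1 - \<theta>) * B powr 1"
      using B \<kappa> by (simp add: R_def powr_powr)
    also have "\<dots> = A powr (1 - \<theta>) * B powr \<theta>"
      using A B by (simp add: powr_divide powr_diff)
    finally show ?thesis .
  qed
  with C(1) show ?thesis by blast
qed

end

section \<open>Smooth frequency cutoffs\<close>

subsection \<open>A class of smooth functions\<close>

definition flat :: "nat \<Rightarrow> real \<Rightarrow> real" where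
  "flat k t = (if t > 0 then exp (- (1 / t)) / t ^ k else 0)"

lemma flat_nonneg: "flat k t \<ge> 0"
  by (simp add: flat_def)

lemma flat_le: "flat k t \<le> fact (Suc k) * \<bar>t\<bar>"
proof (cases "t > 0")
  case True
  define x where "x = 1 / t"
  have x: "x > 0" using True by (simp add: x_def)
  have "x ^ Suc k /\<^sub>R fact (Suc k) = (\<Sum>n\<in>{Suc k}. x ^ n /\<^sub>R fact n)" by simp
  also have "\<dots> \<le> (\<Sum>n. x ^ n /\<^sub>R fact n)"
    using x by (intro sum_le_suminf summable_exp_generic) auto
  also have "\<dots> = exp x" by (simp add: exp_def)
  finally have "x ^ Suc k \<le> fact (Suc k) * exp x" by (simp add: field_simps del: fact_Suc power_Suc)
  then have "exp (- x) * x ^ Suc k \<le> fact (Suc k)"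
    using x by (simp add: exp_minus field_simps)
  then have "exp (- x) * x ^ k * x \<le> fact (Suc k)" by (simp add: mult_ac)
  then have "exp (- x) * x ^ k \<le> fact (Suc k) * t"
    using True by (simp add: x_def field_simps)
  then show ?thesis using True by (simp add: flat_def x_def power_divide)
qed (simp add: flat_def mult_nonneg_nonpos del: fact_Suc)

lemma has_real_derivative_flat_pos:
  assumes t: "t > 0"
  shows "(flat k has_real_derivative (flat (k + 2) t - real k * flat (k + 1) t)) (at t)"
proof -
  have "((\<lambda>t. exp (- (1 / t))) has_real_derivative exp (- (1 / t)) / t\<^sup>2) (at t)"
    using t by (auto intro!: derivative_eq_intros simp: power2_eq_square field_simps)
  from DERIV_divide[OF this DERIV_pow[of k t]] t
  have "((\<lambda>t. exp (- (1 / t)) / t ^ k) has_real_derivative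
      (exp (- (1 / t)) / t\<^sup>2 * t ^ k - exp (- (1 / t)) * (real k * t ^ (k - Suc 0))) /
         (t ^ k * t ^ k)) (at t)"
    by simp
  moreover have "(exp (- (1 / t)) / t\<^sup>2 * t ^ k -
      exp (- (1 / t)) * (real k * t ^ (k - Suc 0))) / (t ^ k * t ^ k) =
      flat (k + 2) t - real k * flat (k + 1) t"
    using t by (cases k) (simp_all add: flat_def field_simps power2_eq_square)
  moreover have "\<forall>\<^sub>F x in nhds t. flat k x = exp (- (1 / x)) / x ^ k"
    using eventually_nhds_in_open[of "{0<..}" t] t by (auto simp: flat_def elim: eventually_mono)
  ultimately show ?thesis
    by (subst DERIV_cong_ev[OF refl _ refl, where g="\<lambda>t. exp (- (1 / t)) / t ^ k"]) simp_all
qed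

lemma has_real_derivative_flat:
  "(flat k has_real_derivative (flat (k + 2) t - real k * flat (k + 1) t)) (at t)"
proof -
  consider "t > 0" | "t < 0" | "t = 0" by linarith
  then show ?thesis
  proof cases
    case 1
    then show ?thesis by (rule has_real_derivative_flat_pos)
  next
    case 2
    have "\<forall>\<^sub>F x in nhds t. flat k x = 0"
      using eventually_nhds_in_open[of "{..<0}" t] 2 by (auto simp: flat_def elim: eventually_mono)
    then have "(flat k has_real_derivative 0) (at t)"
      by (subst DERIV_cong_ev[OF refl _ refl, where g="\<lambda>_. 0"]) auto
    then show ?thesis using 2 by (simp add: flat_def)
  next
    case 3
    have "norm (flat k h / h) \<le> norm h * fact (Suc (Suc k))" for h :: real
    proof -
      have "norm (flat k h / h) = flat (Suc k) h" by (auto simp: flat_def)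
      also have "\<dots> \<le> fact (Suc (Suc k)) * \<bar>h\<bar>" by (rule flat_le)
      finally show ?thesis by (simp add: mult.commute)
    qed
    then have "((\<lambda>h. flat k h / h) \<longlongrightarrow> 0) (at 0)"
      by (intro tendsto_0_le[OF tendsto_ident_at always_eventually] allI)
    moreover have "flat m 0 = 0" for m by (simp add: flat_def)
    ultimately show ?thesis unfolding 3 DERIV_def by simp
  qed
qed

lemma continuous_flat: "continuous_on UNIV (flat k)"
  using has_real_derivative_flat DERIV_isCont by (metis continuous_at_imp_continuous_on)

text \<open>Closed under partial derivatives and rich enough to contain the cutoffs and characters
  that are needed as test functions.\<close>

inductive smooth_expr :: "('a::euclidean_space \<Rightarrow> complex) \<Rightarrow> bool" where
  const: "smooth_expr (\<lambda>_. c)"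
| linear: "smooth_expr (\<lambda>x. complex_of_real (a \<bullet> x))"
| character: "smooth_expr (\<lambda>x. cis (a \<bullet> x))"
| flat: "smooth_expr (\<lambda>x. complex_of_real (flat k (r + q * (x \<bullet> x))))"
| add: "smooth_expr f \<Longrightarrow> smooth_expr g \<Longrightarrow> smooth_expr (\<lambda>x. f x + g x)"
| mult: "smooth_expr f \<Longrightarrow> smooth_expr g \<Longrightarrow> smooth_expr (\<lambda>x. f x * g x)"
| inverse: "smooth_expr f \<Longrightarrow> (\<And>x. f x \<noteq> 0) \<Longrightarrow> smooth_expr (\<lambda>x. inverse (f x))"

lemma smooth_expr_diff: "smooth_expr f \<Longrightarrow> smooth_expr g \<Longrightarrow> smooth_expr (\<lambda>x. f x - g x)"
  using smooth_expr.add[OF _ smooth_expr.mult[OF smooth_expr.const[of "-1"]], of f g] by simp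

lemma smooth_expr_continuous: "smooth_expr f \<Longrightarrow> continuous_on UNIV f"
proof (induction rule: smooth_expr.induct)
  case (character a)
  show ?case unfolding cis_conv_exp by (intro continuous_intros)
next
  case (flat k r q)
  show ?case by (intro continuous_intros continuous_on_compose2[OF continuous_flat]) auto
qed (auto intro!: continuous_intros)

lemma has_vector_derivative_cis_linear:
  "((\<lambda>t. cis (a + t * b)) has_vector_derivative (\<i> * complex_of_real b) * cis a) (at 0)"
proof -
  have "((\<lambda>z. exp (\<i> * (of_real a + z * of_real b))) has_field_derivative
      (\<i> * b) * cis a) (at (of_real 0))"
    by (auto intro!: derivative_eq_intros simp: cis_conv_exp)
  from has_vector_derivative_real_field[OF this] show ?thesis by (simp add: cis_conv_exp)
qed

lemma has_vector_derivative_flat_line: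
  fixes x i :: "'a::euclidean_space" and q r :: real
  defines "P \<equiv> \<lambda>m y. complex_of_real (flat m (r + q * (y \<bullet> y)))"
  shows "((\<lambda>t. P k (x + t *\<^sub>R i)) has_vector_derivative
    (P (k + 2) x - of_nat k * P (k + 1) x) * complex_of_real ((2 * q) *\<^sub>R i \<bullet> x)) (at 0)"
proof -
  define line where "line t = r + q * (x \<bullet> x + 2 * t * (x \<bullet> i) + t * t * (i \<bullet> i))" for t
  have "r + q * ((x + t *\<^sub>R i) \<bullet> (x + t *\<^sub>R i)) = line t" for t
    by (simp add: line_def inner_simps inner_commute algebra_simps)
  then have P_line: "(\<lambda>t. P k (x + t *\<^sub>R i)) = (\<lambda>t. complex_of_real (flat k (line t)))"
    by (simp add: P_def)
  have "(line has_real_derivative (2 * q * (x \<bullet> i))) (at 0)"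
    unfolding line_def by (auto intro!: derivative_eq_intros)
  from DERIV_chain2[OF has_real_derivative_flat this, of k]
  have "((\<lambda>t. complex_of_real (flat k (line t))) has_vector_derivative
      complex_of_real ((flat (k + 2) (line 0) - real k * flat (k + 1) (line 0)) *
          (2 * q * (x \<bullet> i)))) (at 0)"
    by (intro has_vector_derivative_of_real)
       (simp add: has_real_derivative_iff_has_vector_derivative)
  moreover have "complex_of_real ((flat (k + 2) (line 0) - real k * flat (k + 1) (line 0)) *
      (2 * q * (x \<bullet> i))) =
      (P (k + 2) x - of_nat k * P (k + 1) x) * complex_of_real ((2 * q) *\<^sub>R i \<bullet> x)"
    by (simp add: P_def line_def inner_commute)
  ultimately show ?thesis unfolding P_line by (simp only:)
qed

lemma has_vector_derivative_inverse:
  fixes F :: "real \<Rightarrow> complex"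
  assumes F: "(F has_vector_derivative D) (at t)" and nonzero: "F t \<noteq> 0"
  shows "((\<lambda>t. inverse (F t)) has_vector_derivative
    D * ((-1) * (inverse (F t) * inverse (F t)))) (at t)"
proof -
  have "(inverse has_field_derivative ((-1) * (inverse (F t) * inverse (F t)))) (at (F t))"
    using nonzero by (auto intro!: derivative_eq_intros simp: power2_eq_square)
  from field_vector_diff_chain_at[OF F this] show ?thesis by (simp add: o_def)
qed

lemma smooth_expr_partial_derivative:
  assumes "smooth_expr f"
  shows "\<exists>g. smooth_expr g \<and> (\<forall>x. ((\<lambda>t. f (x + t *\<^sub>R i)) has_vector_derivative g x) (at 0))"
  using assms
proof (induction rule: smooth_expr.induct)
  case (const c)
  show ?case by (intro exI[of _ "\<lambda>_. 0"] conjI smooth_expr.const)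
     (auto intro!: derivative_eq_intros)
next
  case (linear a)
  have "((\<lambda>t. complex_of_real (a \<bullet> x + t * (a \<bullet> i))) has_vector_derivative
      complex_of_real (a \<bullet> i)) (at 0)" for x
    by (intro has_vector_derivative_of_real) (auto intro!: derivative_eq_intros)
  then show ?case
    by (intro exI[of _ "\<lambda>_. complex_of_real (a \<bullet> i)"] conjI smooth_expr.const)
       (auto simp: inner_add_right)
next
  case (character a)
  show ?case
    using has_vector_derivative_cis_linear[of "a \<bullet> _" "a \<bullet> i"]
    by (intro exI[of _ "\<lambda>x. (\<i> * complex_of_real (a \<bullet> i)) * cis (a \<bullet> x)"] conjI
        smooth_expr.mult smooth_expr.const smooth_expr.character) (auto simp: inner_add_right)
next
  case (flat k r q)
  show ?case
    by (rule exI, rule conjI[OF _ allI[OF has_vector_derivative_flat_line]])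
       (intro smooth_expr.mult smooth_expr_diff smooth_expr.const smooth_expr.linear
           smooth_expr.flat)
next
  case (add f g)
  then obtain f' g' where "smooth_expr f'"
    "\<And>x. ((\<lambda>t. f (x + t *\<^sub>R i)) has_vector_derivative f' x) (at 0)"
    "smooth_expr g'" "\<And>x. ((\<lambda>t. g (x + t *\<^sub>R i)) has_vector_derivative g' x) (at 0)" by blast
  then show ?case
    by (intro exI[of _ "\<lambda>x. f' x + g' x"] conjI smooth_expr.add allI has_vector_derivative_add)
next
  case (mult f g)
  then obtain f' g' where f': "smooth_expr f'"
    "\<And>x. ((\<lambda>t. f (x + t *\<^sub>R i)) has_vector_derivative f' x) (at 0)"
    and g': "smooth_expr g'" "\<And>x. ((\<lambda>t. g (x + t *\<^sub>R i)) has_vector_derivative g' x) (at 0)" by blast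
  have "((\<lambda>t. f (x + t *\<^sub>R i) * g (x + t *\<^sub>R i)) has_vector_derivative
      (f x * g' x + f' x * g x)) (at 0)" for x
    using has_vector_derivative_mult[OF f'(2)[of x] g'(2)[of x]] by simp
  then show ?case
    using f'(1) g'(1) mult
    by (intro exI[of _ "\<lambda>x. f x * g' x + f' x * g x"] conjI allI smooth_expr.add smooth_expr.mult)
next
  case (inverse f)
  then obtain f' where f': "smooth_expr f'"
    "\<And>x. ((\<lambda>t. f (x + t *\<^sub>R i)) has_vector_derivative f' x) (at 0)"
    by blast
  have "((\<lambda>t. inverse (f (x + t *\<^sub>R i))) has_vector_derivative
      (f' x * ((-1) * (inverse (f x) * inverse (f x))))) (at 0)" for x
    using has_vector_derivative_inverse[OF f'(2)[of x]] inverse(2)[of x] by simp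
  then show ?case
    using f'(1) inverse
    by (intro exI[of _ "\<lambda>x. f' x * ((-1) * (inverse (f x) * inverse (f x)))"] conjI allI
        smooth_expr.mult smooth_expr.const smooth_expr.inverse)
qed

lemma smooth_expr_smooth_fun: "smooth_expr f \<Longrightarrow> smooth_fun f"
  unfolding smooth_fun_def
  by (intro exI[of _ "{f. smooth_expr f}"])
     (auto dest: smooth_expr_continuous smooth_expr_partial_derivative)

subsection \<open>Cutoffs\<close>

definition cutoff_profile :: "real \<Rightarrow> real" where
  "cutoff_profile r = flat 0 (2 - r) / (flat 0 (2 - r) + flat 0 (r - 1))"

definition cutoff :: "real \<Rightarrow> 'a::euclidean_space \<Rightarrow> complex" where
  "cutoff c x = complex_of_real (cutoff_profile (c\<^sup>2 * (x \<bullet> x)))"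

lemma cutoff_denominator_pos: "flat 0 (2 - r) + flat 0 (r - 1) > 0"
  by (cases "r < 2") (auto simp: flat_def add_pos_nonneg)

lemma cutoff_profile_nonneg: "0 \<le> cutoff_profile r" and cutoff_profile_le_1: "cutoff_profile r \<le> 1"
  using flat_nonneg[of 0 "2 - r"] flat_nonneg[of 0 "r - 1"] cutoff_denominator_pos[of r]
  by (auto simp: cutoff_profile_def divide_le_eq_1)

lemma norm_cutoff_le: "cmod (cutoff c x) \<le> 1"
  by (simp add: cutoff_def cutoff_profile_nonneg cutoff_profile_le_1)

lemma norm_cutoff_diff_le: "cmod (cutoff c x - cutoff b x) \<le> 1"
  unfolding cutoff_def of_real_diff[symmetric] norm_of_real
  using cutoff_profile_nonneg[of "c\<^sup>2 * (x \<bullet> x)"] cutoff_profile_le_1[of "c\<^sup>2 * (x \<bullet> x)"]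
    cutoff_profile_nonneg[of "b\<^sup>2 * (x \<bullet> x)"] cutoff_profile_le_1[of "b\<^sup>2 * (x \<bullet> x)"]
  by (auto simp: abs_le_iff)

lemma cutoff_smooth: "smooth_expr (cutoff c)"
proof -
  define N where "N x = complex_of_real (flat 0 (2 + (- c\<^sup>2) * (x \<bullet> x)))" for x :: 'a
  define D where "D x = complex_of_real (flat 0 ((-1) + c\<^sup>2 * (x \<bullet> x)))" for x :: 'a
  have "smooth_expr N" "smooth_expr D" unfolding N_def D_def by (rule smooth_expr.flat)+
  moreover have "N x + D x \<noteq> 0" for x
    using cutoff_denominator_pos[of "c\<^sup>2 * (x \<bullet> x)"]
    unfolding N_def D_def of_real_add[symmetric] of_real_eq_0_iff by simp
  ultimately have "smooth_expr (\<lambda>x. N x * inverse (N x + D x))"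
    by (intro smooth_expr.mult smooth_expr.inverse smooth_expr.add) auto
  moreover have "N x * inverse (N x + D x) = cutoff c x" for x
    unfolding cutoff_def cutoff_profile_def N_def D_def by (simp add: divide_inverse)
  ultimately show ?thesis by simp
qed

lemma cutoff_measurable [measurable]: "cutoff c \<in> borel_measurable borel"
  by (rule borel_measurable_continuous_onI[OF smooth_expr_continuous[OF cutoff_smooth]])

lemma cutoff_eq_1:
  assumes "\<bar>c\<bar> * norm x \<le> 1"
  shows "cutoff c x = 1"
proof -
  have "(\<bar>c\<bar> * norm x)\<^sup>2 \<le> 1" using assms by (simp add: power_le_one)
  then show ?thesis
    by (simp add: cutoff_def cutoff_profile_def flat_def power_mult_distrib dot_square_norm)
qed

lemma cutoff_eq_0:
  assumes "\<bar>c\<bar> * norm x \<ge> 2"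
  shows "cutoff c x = 0"
proof -
  have "(\<bar>c\<bar> * norm x)\<^sup>2 \<ge> 2\<^sup>2" using assms by (intro power_mono) auto
  then show ?thesis
    by (simp add: cutoff_def cutoff_profile_def flat_def power_mult_distrib dot_square_norm)
qed

lemma cutoff_scale: "cutoff c x = cutoff 1 (c *\<^sub>R x)"
  by (simp add: cutoff_def power2_eq_square mult_ac)

lemma cutoff_radial: "norm x = norm y \<Longrightarrow> cutoff c x = cutoff c y"
  by (simp add: cutoff_def dot_square_norm)

definition band :: "nat \<Rightarrow> 'a::euclidean_space \<Rightarrow> complex" where
  "band n \<xi> = cutoff (1 / real (Suc n)) \<xi> - cutoff (real (Suc n)) \<xi>"

lemma band_measurable [measurable]: "band n \<in> borel_measurable borel"
  unfolding band_def[abs_def] by measurable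

lemma norm_band_le: "cmod (band n \<xi>) \<le> 1"
  unfolding band_def by (rule norm_cutoff_diff_le)

lemma band_eq_0_low:
  assumes "norm \<xi> \<le> 1 / real (Suc n)"
  shows "band n \<xi> = 0"
proof -
  have "1 / real (Suc n) * norm \<xi> \<le> 1 * 1"
    using assms by (intro mult_mono) (auto intro: order_trans)
  moreover have "real (Suc n) * norm \<xi> \<le> 1" using assms by (simp add: field_simps)
  ultimately show ?thesis unfolding band_def by (subst (1 2) cutoff_eq_1) (simp_all del: of_nat_Suc)
qed

lemma band_eq_0_high:
  assumes "2 * real (Suc n) \<le> norm \<xi>"
  shows "band n \<xi> = 0"
proof -
  have "1 * 2 \<le> real (Suc n) * norm \<xi>"
    using assms by (intro mult_mono) auto
  moreover have "2 \<le> 1 / real (Suc n) * norm \<xi>" using assms by (simp add: field_simps)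
  ultimately show ?thesis unfolding band_def by (subst (1 2) cutoff_eq_0) (simp_all del: of_nat_Suc)
qed

lemma freq_test_band_character: "freq_test (\<lambda>\<xi>. band n \<xi> * cis (2 * pi * (a \<bullet> \<xi>)))"
  unfolding freq_test_def
proof (intro conjI exI[of _ "cball 0 (2 * real (Suc n)) - ball 0 (1 / real (Suc n))"] allI impI)
  have "smooth_expr (\<lambda>\<xi>. band n \<xi> * cis (((2 * pi) *\<^sub>R a) \<bullet> \<xi>))"
    unfolding band_def
    by (intro smooth_expr.mult smooth_expr_diff cutoff_smooth smooth_expr.character)
  then show "smooth_fun (\<lambda>\<xi>. band n \<xi> * cis (2 * pi * (a \<bullet> \<xi>)))"
    by (intro smooth_expr_smooth_fun) simp
  show "compact (cball (0::'a) (2 * real (Suc n)) - ball 0 (1 / real (Suc n)))"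
    by (intro compact_diff) auto
  show "0 \<notin> cball (0::'a) (2 * real (Suc n)) - ball 0 (1 / real (Suc n))" by simp
  fix \<xi> :: 'a assume "\<xi> \<notin> cball 0 (2 * real (Suc n)) - ball 0 (1 / real (Suc n))"
  then have "norm \<xi> \<le> 1 / real (Suc n) \<or> 2 * real (Suc n) \<le> norm \<xi>" by auto
  then show "band n \<xi> * cis (2 * pi * (a \<bullet> \<xi>)) = 0"
    using band_eq_0_low band_eq_0_high by auto
qed

section \<open>Decay of Fourier transforms\<close>

lemma difference_quotient_tendsto:
  fixes F :: "real \<Rightarrow> complex"
  assumes F: "(F has_vector_derivative D) (at 0)" and t: "t \<longlonglongrightarrow> 0" "\<And>n. t n \<noteq> 0"
  shows "(\<lambda>n. (F (t n) - F 0) / complex_of_real (t n)) \<longlonglongrightarrow> D"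
proof -
  have "(\<lambda>h. norm (F (0 + h) - F 0 - h *\<^sub>R D) / norm h) \<midarrow>0\<rightarrow> 0"
    using F unfolding has_vector_derivative_def has_derivative_at by blast
  moreover have "filterlim t (at 0) sequentially" using t by (simp add: filterlim_at)
  ultimately have "(\<lambda>n. norm (F (0 + t n) - F 0 - t n *\<^sub>R D) / norm (t n)) \<longlonglongrightarrow> 0"
    by (rule filterlim_compose)
  moreover have "norm (F (0 + t n) - F 0 - t n *\<^sub>R D) / norm (t n) =
      norm ((F (t n) - F 0) / complex_of_real (t n) - D)" for n
  proof -
    have "(F (t n) - F 0) / complex_of_real (t n) - D =
        (F (t n) - F 0 - t n *\<^sub>R D) / complex_of_real (t n)"
      using t(2)[of n] by (simp add: field_simps scaleR_conv_of_real)
    then show ?thesis by (simp add: norm_divide)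
  qed
  ultimately have "(\<lambda>n. norm ((F (t n) - F 0) / complex_of_real (t n) - D)) \<longlonglongrightarrow> 0" by simp
  then show ?thesis by (rule LIM_zero_cancel[OF tendsto_norm_zero_cancel])
qed

lemma continuous_compact_support_bounded:
  fixes f :: "'a::euclidean_space \<Rightarrow> 'b::real_normed_vector"
  assumes "continuous_on UNIV f" and support: "\<And>x. norm x > r \<Longrightarrow> f x = 0"
  obtains B where "B \<ge> 0" "\<And>x. norm (f x) \<le> B"
proof -
  have "compact (f ` cball 0 r)"
    by (intro compact_continuous_image continuous_on_subset[OF assms(1)]) auto
  then have "bounded (f ` cball 0 r)" by (rule compact_imp_bounded)
  then obtain B where B: "\<And>x. x \<in> cball 0 r \<Longrightarrow> norm (f x) \<le> B"
    unfolding bounded_iff by blast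
  have "norm (f x) \<le> max B 0" for x
    using B[of x] support[of x] by (cases "norm x \<le> r") (auto simp: le_max_iff_disj)
  then show ?thesis using that[of "max B 0"] by simp
qed

lemma integrable_bounded_support:
  fixes f :: "'a::euclidean_space \<Rightarrow> 'b::{banach, second_countable_topology}"
  assumes "f \<in> borel_measurable borel" and B: "\<And>x. norm (f x) \<le> B"
    and support: "\<And>x. norm x > r \<Longrightarrow> f x = 0"
  shows "integrable lborel f"
proof (rule Bochner_Integration.integrable_bound[of _ "\<lambda>x. B * indicator (cball 0 r) x"])
  show "integrable lborel (\<lambda>x::'a. B * indicator (cball 0 r) x)"
    using emeasure_lborel_cball_finite[of "0::'a" r] by simp
  have "B \<ge> 0" using order_trans[OF norm_ge_zero B] .
  then have "norm (f x) \<le> norm (B * indicator (cball 0 r) x)" for x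
    using B[of x] support[of x] by (cases "norm x \<le> r") auto
  then show "AE x in lborel. norm (f x) \<le> norm (B * indicator (cball 0 r) x)" by simp
qed (use assms in simp)

lemma norm_line_increment_le:
  fixes f g :: "'a::euclidean_space \<Rightarrow> complex"
  assumes f: "continuous_on UNIV f" and g: "\<And>x. cmod (g x) \<le> B"
    and deriv: "\<And>x. ((\<lambda>t. f (x + t *\<^sub>R i)) has_vector_derivative g x) (at 0)" and t: "t > 0"
  shows "cmod (f (x + t *\<^sub>R i) - f x) \<le> B * t"
proof -
  have deriv_at: "((\<lambda>t. f (x + t *\<^sub>R i)) has_vector_derivative g (x + t0 *\<^sub>R i)) (at t0)" for t0
  proof -
    have "((\<lambda>t. f ((x + t0 *\<^sub>R i) + t *\<^sub>R i)) has_vector_derivative g (x + t0 *\<^sub>R i)) (at (t0 - t0))"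
      using deriv[of "x + t0 *\<^sub>R i"] by simp
    moreover have "((\<lambda>s. s - t0) has_vector_derivative 1) (at t0)"
      by (auto intro!: derivative_eq_intros)
    ultimately have "((\<lambda>t. f ((x + t0 *\<^sub>R i) + t *\<^sub>R i)) \<circ> (\<lambda>s. s - t0) has_vector_derivative
        1 *\<^sub>R g (x + t0 *\<^sub>R i)) (at t0)"
      by (intro vector_diff_chain_at)
    then show ?thesis by (simp add: o_def algebra_simps)
  qed
  have "norm (f (x + t *\<^sub>R i) - f (x + 0 *\<^sub>R i)) \<le> B * t - B * 0"
  proof (rule differentiable_bound_general[where f="\<lambda>t. f (x + t *\<^sub>R i)" and \<phi>="\<lambda>t. B * t"])
    show "continuous_on {0..t} (\<lambda>t. f (x + t *\<^sub>R i))"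
      by (intro continuous_on_compose2[OF f] continuous_intros) auto
    show "((\<lambda>t. B * t) has_vector_derivative B) (at s)" for s
      by (auto intro!: derivative_eq_intros
          simp: has_real_derivative_iff_has_vector_derivative[symmetric])
  qed (use t g deriv_at in \<open>auto intro!: continuous_intros\<close>)
  then show ?thesis by simp
qed

lemma fourier_difference_quotient:
  fixes f :: "'a::euclidean_space \<Rightarrow> complex"
  assumes f: "integrable lborel f"
  shows "fourier (\<lambda>\<xi>. (f (\<xi> + t *\<^sub>R i) - f \<xi>) / complex_of_real t) x =
    ((cis (0 + t * (2 * pi * (x \<bullet> i))) - cis 0) / complex_of_real t) * fourier f x"
proof -
  have [measurable]: "f \<in> borel_measurable borel" using f by auto
  have "fourier (\<lambda>\<xi>. (f (\<xi> + t *\<^sub>R i) - f \<xi>) / complex_of_real t) x =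
      (1 / complex_of_real t) * fourier (\<lambda>\<xi>. f (\<xi> + t *\<^sub>R i) - f \<xi>) x"
    by (simp add: fourier_cmult[symmetric])
  also have "fourier (\<lambda>\<xi>. f (\<xi> + t *\<^sub>R i) - f \<xi>) x = fourier (\<lambda>\<xi>. f (\<xi> + t *\<^sub>R i)) x - fourier f x"
    by (intro fourier_diff integrable_lborel_translate f)
  also have "fourier (\<lambda>\<xi>. f (\<xi> + t *\<^sub>R i)) x = cis (t * (2 * pi * (x \<bullet> i))) * fourier f x"
    by (simp add: fourier_translate mult_ac)
  finally show ?thesis by (simp add: algebra_simps diff_divide_distrib)
qed

lemma fourier_tendsto_if_bounded_support:
  fixes g :: "'a::euclidean_space \<Rightarrow> complex"
  assumes [measurable]: "\<And>n. q n \<in> borel_measurable borel" "g \<in> borel_measurable borel"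
    and bounded: "\<And>n \<xi>. cmod (q n \<xi>) \<le> B" and support: "\<And>n \<xi>. norm \<xi> > r \<Longrightarrow> q n \<xi> = 0"
    and lim: "\<And>\<xi>. (\<lambda>n. q n \<xi>) \<longlonglongrightarrow> g \<xi>"
  shows "(\<lambda>n. fourier (q n) x) \<longlonglongrightarrow> fourier g x"
  unfolding fourier_def
proof (rule integral_dominated_convergence[where w="\<lambda>\<xi>. B * indicator (cball 0 r) \<xi>"])
  show "integrable lborel (\<lambda>\<xi>::'a. B * indicator (cball 0 r) \<xi>)"
    using emeasure_lborel_cball_finite[of "0::'a" r] by simp
  show "AE \<xi> in lborel. (\<lambda>n. q n \<xi> * cis (- 2 * pi * (x \<bullet> \<xi>))) \<longlonglongrightarrow> g \<xi> * cis (- 2 * pi * (x \<bullet> \<xi>))"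
    by (intro AE_I2 tendsto_mult tendsto_const lim)
  have "cmod (q n \<xi>) \<le> B * indicator (cball 0 r) \<xi>" for n \<xi>
    using bounded[of n \<xi>] support[where n=n and \<xi>=\<xi>] by (cases "norm \<xi> \<le> r") auto
  then show "AE \<xi> in lborel. norm (q n \<xi> * cis (- 2 * pi * (x \<bullet> \<xi>))) \<le> B * indicator (cball 0 r) \<xi>"
    for n
    by simp
qed measurable

lemma fourier_partial_derivative:
  fixes f g :: "'a::euclidean_space \<Rightarrow> complex"
  assumes f: "continuous_on UNIV f" and g: "continuous_on UNIV g" and i: "norm i = 1"
    and deriv: "\<And>x. ((\<lambda>t. f (x + t *\<^sub>R i)) has_vector_derivative g x) (at 0)"
    and f_support: "\<And>x. norm x > r \<Longrightarrow> f x = 0" and g_support: "\<And>x. norm x > r \<Longrightarrow> g x = 0"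
  shows "fourier g x = (\<i> * complex_of_real (2 * pi * (x \<bullet> i))) * fourier f x"
proof -
  have [measurable]: "f \<in> borel_measurable borel" "g \<in> borel_measurable borel"
    using f g by (auto intro: borel_measurable_continuous_onI)
  obtain A where A: "\<And>x. cmod (f x) \<le> A" using continuous_compact_support_bounded[OF f f_support]
    by blast
  obtain B where B: "B \<ge> 0" "\<And>x. cmod (g x) \<le> B"
    using continuous_compact_support_bounded[OF g g_support] by blast
  have f_int: "integrable lborel f" by (rule integrable_bounded_support[OF _ A f_support]) auto
  define t where "t n = 1 / real (Suc n)" for n
  have t: "t \<longlonglongrightarrow> 0" "\<And>n. t n \<noteq> 0" "\<And>n. 0 < t n" "\<And>n. t n \<le> 1"
    unfolding t_def using LIMSEQ_Suc[OF lim_1_over_n] by auto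
  define q where "q n \<xi> = (f (\<xi> + t n *\<^sub>R i) - f \<xi>) / complex_of_real (t n)" for n \<xi>
  have [measurable]: "q n \<in> borel_measurable borel" for n unfolding q_def by measurable
  have q_bounded: "cmod (q n \<xi>) \<le> B" for n \<xi>
    using norm_line_increment_le[OF f B(2) deriv t(3), of \<xi> n] t(3)[of n]
    by (simp add: q_def norm_divide field_simps)
  have q_support: "q n \<xi> = 0" if "norm \<xi> > r + 1" for n \<xi>
  proof -
    have "norm \<xi> \<le> norm (\<xi> + t n *\<^sub>R i) + norm (t n *\<^sub>R i)"
      using norm_triangle_ineq4[of "\<xi> + t n *\<^sub>R i" "t n *\<^sub>R i"] by simp
    then have "norm (\<xi> + t n *\<^sub>R i) > r" using that t(3,4)[of n] i by simp
    then show ?thesis using that f_support[of \<xi>] f_support[of "\<xi> + t n *\<^sub>R i"] by (simp add: q_def)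
  qed
  have "(\<lambda>n. q n \<xi>) \<longlonglongrightarrow> g \<xi>" for \<xi>
    unfolding q_def using difference_quotient_tendsto[OF deriv[of \<xi>] t(1,2)] by simp
  then have "(\<lambda>n. fourier (q n) x) \<longlonglongrightarrow> fourier g x"
    by (intro fourier_tendsto_if_bounded_support[OF _ _ q_bounded q_support]) auto
  moreover have "(\<lambda>n. fourier (q n) x) \<longlonglongrightarrow>
      (\<i> * complex_of_real (2 * pi * (x \<bullet> i)) * cis 0) * fourier f x"
    unfolding q_def fourier_difference_quotient[OF f_int]
    using difference_quotient_tendsto[OF has_vector_derivative_cis_linear t(1,2),
        of 0 "2 * pi * (x \<bullet> i)"]
    by (intro tendsto_mult tendsto_const) simp
  ultimately show ?thesis using LIMSEQ_unique by fastforce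
qed

lemma partial_derivative_eq_0_outside:
  fixes f :: "'a::euclidean_space \<Rightarrow> complex"
  assumes support: "\<And>x. norm x > r \<Longrightarrow> f x = 0" and x: "norm x > r"
    and deriv: "((\<lambda>t. f (x + t *\<^sub>R i)) has_vector_derivative D) (at 0)"
  shows "D = 0"
proof -
  have "open {t. norm (x + t *\<^sub>R i) > r}"
    by (intro open_Collect_less continuous_intros)
  then have "((\<lambda>t. f (x + t *\<^sub>R i)) has_vector_derivative 0) (at 0)"
    by (rule has_vector_derivative_transform_within_open[OF has_vector_derivative_const])
       (use x support in auto)
  then show ?thesis using deriv vector_derivative_unique_at by blast
qed

lemma fourier_coordinate_decay:
  fixes f :: "'a::euclidean_space \<Rightarrow> complex"
  assumes "smooth_expr f" and "\<And>x. norm x > r \<Longrightarrow> f x = 0" and i: "norm i = 1"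
  shows "\<exists>C. \<forall>x. \<bar>x \<bullet> i\<bar> ^ m * cmod (fourier f x) \<le> C"
  using assms(1,2)
proof (induction m arbitrary: f)
  case 0
  show ?case using norm_fourier_le_integral[of f] by auto
next
  case (Suc m)
  obtain g where g: "smooth_expr g"
    and deriv: "\<And>x. ((\<lambda>t. f (x + t *\<^sub>R i)) has_vector_derivative g x) (at 0)"
    using smooth_expr_partial_derivative[OF Suc.prems(1), of i] by blast
  have g_support: "g x = 0" if "norm x > r" for x
    by (rule partial_derivative_eq_0_outside[OF Suc.prems(2) that deriv])
  obtain C where C: "\<And>x. \<bar>x \<bullet> i\<bar> ^ m * cmod (fourier g x) \<le> C" using Suc.IH[OF g g_support] by blast
  have "\<bar>x \<bullet> i\<bar> ^ Suc m * cmod (fourier f x) \<le> C / (2 * pi)" for x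
  proof -
    have "fourier g x = (\<i> * complex_of_real (2 * pi * (x \<bullet> i))) * fourier f x"
      by (rule fourier_partial_derivative[OF _ _ i deriv Suc.prems(2) g_support])
         (use smooth_expr_continuous Suc.prems(1) g in auto)
    then have "cmod (fourier g x) = 2 * pi * \<bar>x \<bullet> i\<bar> * cmod (fourier f x)"
      by (simp add: norm_mult abs_mult)
    with C[of x] have "2 * pi * (\<bar>x \<bullet> i\<bar> ^ Suc m * cmod (fourier f x)) \<le> C" by (simp add: mult_ac)
    then show ?thesis by (simp add: field_simps)
  qed
  then show ?case by blast
qed

lemma exists_large_coordinate:
  fixes x :: "'a::euclidean_space"
  obtains i where "i \<in> Basis" "norm x \<le> DIM('a) * \<bar>x \<bullet> i\<bar>"
proof (rule ccontr)
  assume "\<not> thesis"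
  then have "\<forall>i\<in>Basis. DIM('a) * \<bar>x \<bullet> i\<bar> < norm x" using that by force
  then have "(\<Sum>i\<in>Basis. DIM('a) * \<bar>x \<bullet> i\<bar>) < (\<Sum>i\<in>(Basis::'a set). norm x)"
    by (intro sum_strict_mono) auto
  then have "DIM('a) * (\<Sum>i\<in>Basis. \<bar>x \<bullet> i\<bar>) < DIM('a) * norm x" by (simp add: sum_distrib_left)
  then have "(\<Sum>i\<in>Basis. \<bar>x \<bullet> i\<bar>) < norm x" by simp
  then show False using norm_le_l1[of x] by simp
qed

lemma fourier_decay:
  fixes f :: "'a::euclidean_space \<Rightarrow> complex"
  assumes "smooth_expr f" and "\<And>x. norm x > r \<Longrightarrow> f x = 0"
  shows "\<exists>C. \<forall>x. norm x ^ m * cmod (fourier f x) \<le> C"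
proof -
  have "\<forall>i\<in>(Basis::'a set). \<exists>C. \<forall>x. \<bar>x \<bullet> i\<bar> ^ m * cmod (fourier f x) \<le> C"
    using fourier_coordinate_decay[OF assms] by auto
  then obtain C where C: "\<And>i x. i \<in> (Basis::'a set) \<Longrightarrow> \<bar>x \<bullet> i\<bar> ^ m * cmod (fourier f x) \<le> C i"
    by metis
  have C_nonneg: "C i \<ge> 0" if "i \<in> Basis" for i
    using order_trans[OF _ C[OF that, of 0]] by simp
  have "norm x ^ m * cmod (fourier f x) \<le> real DIM('a) ^ m * (\<Sum>i\<in>Basis. C i)" for x
  proof -
    obtain i where i: "i \<in> Basis" "norm x \<le> DIM('a) * \<bar>x \<bullet> i\<bar>" by (rule exists_large_coordinate)
    then have "norm x ^ m * cmod (fourier f x) \<le> (DIM('a) * \<bar>x \<bullet> i\<bar>) ^ m * cmod (fourier f x)"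
      by (intro mult_right_mono power_mono) auto
    also have "\<dots> = real DIM('a) ^ m * (\<bar>x \<bullet> i\<bar> ^ m * cmod (fourier f x))"
      by (simp add: power_mult_distrib mult_ac)
    also have "\<dots> \<le> real DIM('a) ^ m * C i" using C[OF i(1), of x] by (intro mult_left_mono) auto
    also have "\<dots> \<le> real DIM('a) ^ m * (\<Sum>i\<in>Basis. C i)"
      using i(1) C_nonneg by (intro mult_left_mono member_le_sum) auto
    finally show ?thesis .
  qed
  then show ?thesis by blast
qed

lemma fourier_powr_decay:
  fixes f :: "'a::euclidean_space \<Rightarrow> complex"
  assumes "smooth_expr f" and "\<And>x. norm x > r \<Longrightarrow> f x = 0" and b: "b \<ge> 0"
  shows "\<exists>C>0. \<forall>x. x \<noteq> 0 \<longrightarrow> cmod (fourier f x) \<le> C * norm x powr - b"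
proof -
  obtain m :: nat where m: "b \<le> real m" using real_arch_simple by blast
  obtain C0 where C0: "\<And>x. cmod (fourier f x) \<le> C0"
    using fourier_decay[OF assms(1,2), where m=0] by auto
  obtain Cm where Cm: "\<And>x. norm x ^ m * cmod (fourier f x) \<le> Cm"
    using fourier_decay[OF assms(1,2), where m=m] by blast
  define C where "C = max 1 (max C0 Cm)"
  have C: "C > 0" "C0 \<le> C" "Cm \<le> C" by (auto simp: C_def)
  have "cmod (fourier f x) \<le> C * norm x powr - b" if x: "x \<noteq> 0" for x
  proof (cases "norm x \<le> 1")
    case True
    then have "1 powr - b \<le> norm x powr - b" using x b by (intro powr_mono2') auto
    then have "C * 1 \<le> C * norm x powr - b" using C by (intro mult_left_mono) auto
    then show ?thesis using C0[of x] C(2) by simp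
  next
    case False
    have "norm x powr - real m * (norm x ^ m * cmod (fourier f x)) \<le> norm x powr - real m * C"
      using Cm[of x] C(3) by (intro mult_left_mono) auto
    then have "cmod (fourier f x) \<le> norm x powr - real m * C"
      using x by (simp add: powr_minus powr_realpow field_simps)
    also have "\<dots> \<le> norm x powr - b * C" using m False C(1) by (intro mult_right_mono powr_mono) auto
    finally show ?thesis by (simp add: mult.commute)
  qed
  then show ?thesis using C(1) by blast
qed

definition cutoff_kernel :: "'a::euclidean_space \<Rightarrow> complex" where
  "cutoff_kernel = fourier (cutoff 1)"

lemma cutoff_kernel_measurable [measurable]: "cutoff_kernel \<in> borel_measurable borel"
  unfolding cutoff_kernel_def by measurable

lemma integrable_cutoff:
  assumes "c > 0"
  shows "integrable lborel (cutoff c :: 'a::euclidean_space \<Rightarrow> complex)"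
proof (rule integrable_bounded_support[OF cutoff_measurable norm_cutoff_le, where r="2/c"])
  fix x :: 'a assume "norm x > 2/c"
  then show "cutoff c x = 0" using assms by (intro cutoff_eq_0) (simp add: field_simps)
qed

lemma fourier_cutoff:
  fixes x :: "'a::euclidean_space"
  assumes "c > 0"
  shows "fourier (cutoff c) x = complex_of_real (c powr - real DIM('a)) * cutoff_kernel (x /\<^sub>R c)"
proof -
  have "cutoff c = (\<lambda>\<xi>::'a. cutoff 1 (c *\<^sub>R \<xi>))" using cutoff_scale by auto
  then show ?thesis using fourier_scale[OF cutoff_measurable assms, of 1 x]
    by (simp add: cutoff_kernel_def)
qed

lemma cutoff_kernel_bounded: "\<exists>C. \<forall>z::'a::euclidean_space. cmod (cutoff_kernel z) \<le> C"
  unfolding cutoff_kernel_def using norm_fourier_le_integral by blast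

lemma cutoff_kernel_powr_decay:
  assumes "b \<ge> 0"
  shows "\<exists>C>0. \<forall>z::'a::euclidean_space. z \<noteq> 0 \<longrightarrow> cmod (cutoff_kernel z) \<le> C * norm z powr - b"
  unfolding cutoff_kernel_def
  by (rule fourier_powr_decay[OF cutoff_smooth cutoff_eq_0 assms, where r=2]) simp

lemma integrable_cutoff_kernel: "integrable lborel (cutoff_kernel :: 'a::euclidean_space \<Rightarrow> complex)"
proof -
  obtain B where B: "\<And>z::'a. cmod (cutoff_kernel z) \<le> B"
    using cutoff_kernel_bounded by blast
  obtain C where C: "\<And>z::'a. z \<noteq> 0 \<Longrightarrow> cmod (cutoff_kernel z) \<le> C * norm z powr - (real DIM('a) + 1)"
    using cutoff_kernel_powr_decay[where 'a='a, of "real DIM('a) + 1"] by auto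
  show ?thesis
  proof (rule integrable_norm_powr_decay)
    show "cmod (cutoff_kernel z) \<le> max B C" for z :: 'a
      using B[of z] by (simp add: le_max_iff_disj)
    show "cmod (cutoff_kernel z) \<le> max B C * norm z powr - (real DIM('a) + 1)" if "1 \<le> norm z"
      for z :: 'a
      using that by (intro order_trans[OF C] mult_right_mono) auto
  qed auto
qed

lemma integral_cutoff_kernel: "(LINT x|lborel. cutoff_kernel (x::'a::euclidean_space)) = 1"
proof -
  have "isCont (cutoff 1) (0::'a)"
    using smooth_expr_continuous[OF cutoff_smooth[of 1, where 'a='a]]
    by (simp add: continuous_on_eq_continuous_at)
  then have "(LINT x|lborel. cutoff_kernel (x::'a)) = cutoff 1 (0::'a)"
    unfolding cutoff_kernel_def
    by (intro integral_fourier[OF integrable_cutoff _ norm_cutoff_le])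
       (auto simp: integrable_cutoff_kernel[unfolded cutoff_kernel_def])
  then show ?thesis by (simp add: cutoff_eq_1)
qed

section \<open>Band limitation\<close>

subsection \<open>Dilated cutoff kernels\<close>

definition dilated_kernel :: "real \<Rightarrow> 'a::euclidean_space \<Rightarrow> complex" where
  "dilated_kernel c z = complex_of_real (c powr real DIM('a)) * cutoff_kernel (c *\<^sub>R z)"

lemma dilated_kernel_measurable [measurable]: "dilated_kernel c \<in> borel_measurable borel"
  unfolding dilated_kernel_def by measurable

lemma dilated_kernel_decay:
  fixes b :: real
  assumes "b \<ge> 0"
  obtains C where "C > 0" "\<And>c (z::'a::euclidean_space). c > 0 \<Longrightarrow> z \<noteq> 0 \<Longrightarrow>
    cmod (dilated_kernel c z) \<le> C * c powr (real DIM('a) - b) * norm z powr - b"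
proof -
  obtain C where C: "C > 0" "\<And>z::'a. z \<noteq> 0 \<Longrightarrow> cmod (cutoff_kernel z) \<le> C * norm z powr - b"
    using cutoff_kernel_powr_decay[OF assms, where 'a='a] by auto
  have "cmod (dilated_kernel c z) \<le> C * c powr (real DIM('a) - b) * norm z powr - b"
    if c: "c > 0" and z: "z \<noteq> 0" for c and z :: 'a
  proof -
    have "cmod (dilated_kernel c z) \<le> c powr real DIM('a) * (C * norm (c *\<^sub>R z) powr - b)"
      using C(2)[of "c *\<^sub>R z"] c z by (simp add: dilated_kernel_def norm_mult mult_left_mono)
    also have "\<dots> = C * (c powr real DIM('a) * c powr - b) * norm z powr - b"
      using c by (simp add: powr_mult mult_ac)
    also have "c powr real DIM('a) * c powr - b = c powr (real DIM('a) - b)"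
      by (simp flip: powr_add)
    finally show ?thesis .
  qed
  with C(1) show thesis by (rule that)
qed

lemma nn_integral_dilated_kernel:
  assumes c: "c > 0"
  shows "(\<integral>\<^sup>+(z::'a::euclidean_space). cmod (dilated_kernel c z) \<partial>lborel) =
    (\<integral>\<^sup>+(z::'a). cmod (cutoff_kernel z) \<partial>lborel)"
proof -
  have "(\<integral>\<^sup>+(z::'a). cmod (dilated_kernel c z) \<partial>lborel) =
      ennreal (c powr real DIM('a)) * (\<integral>\<^sup>+(z::'a). cmod (cutoff_kernel (c *\<^sub>R z)) \<partial>lborel)"
    by (simp add: dilated_kernel_def norm_mult ennreal_mult nn_integral_cmult)
  also have "(\<integral>\<^sup>+(z::'a). cmod (cutoff_kernel (c *\<^sub>R z)) \<partial>lborel) =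
      ennreal (c powr - real DIM('a)) * (\<integral>\<^sup>+(z::'a). cmod (cutoff_kernel z) \<partial>lborel)"
    by (rule nn_integral_lborel_scale[OF _ c, of "\<lambda>z. ennreal (cmod (cutoff_kernel z))"]) measurable
  finally show ?thesis
    using c by (simp add: mult.assoc[symmetric] powr_minus flip: ennreal_mult)
qed

lemma integral_dilated_kernel:
  fixes f :: "'a::euclidean_space \<Rightarrow> complex"
  assumes [measurable]: "f \<in> borel_measurable borel" and c: "c > 0"
  shows "(LINT y|lborel. f y * dilated_kernel c (y - x)) =
    (LINT w|lborel. f (x + (1 / c) *\<^sub>R w) * cutoff_kernel w)"
proof -
  have "(LINT y|lborel. f y * dilated_kernel c (y - x)) =
      \<bar>1 / c\<bar> ^ DIM('a) *\<^sub>R (LINT w|lborel. f (x + (1 / c) *\<^sub>R w) * dilated_kernel c ((1 / c) *\<^sub>R w))"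
    using integral_lborel_affine[of "\<lambda>y. f y * dilated_kernel c (y - x)" "1 / c" x] c by simp
  also have "\<dots> = (LINT w|lborel. \<bar>1 / c\<bar> ^ DIM('a) *\<^sub>R (f (x + (1 / c) *\<^sub>R w) *
      dilated_kernel c ((1 / c) *\<^sub>R w)))"
    by (rule integral_scaleR_right[symmetric])
  also have "\<dots> = (LINT w|lborel. f (x + (1 / c) *\<^sub>R w) * cutoff_kernel w)"
    using c by (intro Bochner_Integration.integral_cong)
      (simp_all add: dilated_kernel_def powr_realpow scaleR_conv_of_real power_divide)
  finally show ?thesis .
qed

lemma fourier_band:
  "fourier (band n) z = dilated_kernel (real (Suc n)) z - dilated_kernel (1 / real (Suc n)) z"
proof -
  have "fourier (cutoff c) z = dilated_kernel (1 / c) z" if "c > 0" for c :: real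
    using that by (simp add: fourier_cutoff dilated_kernel_def powr_divide powr_minus
        inverse_eq_divide)
  moreover have "fourier (band n) z =
      fourier (cutoff (1 / real (Suc n))) z - fourier (cutoff (real (Suc n))) z"
    unfolding band_def[abs_def] by (intro fourier_diff integrable_cutoff) auto
  ultimately show ?thesis by simp
qed

lemma fourier_band_radial: "radial (fourier (band n))"
  by (rule fourier_radial)
     (auto simp: radial_def band_def intro!: arg_cong2[where f="(-)"] cutoff_radial)

lemma nn_integral_fourier_band_le:
  "(\<integral>\<^sup>+(z::'a::euclidean_space). cmod (fourier (band n) z) \<partial>lborel)
    \<le> 2 * (\<integral>\<^sup>+(z::'a). cmod (cutoff_kernel z) \<partial>lborel)"
proof -
  have "(\<integral>\<^sup>+(z::'a). cmod (fourier (band n) z) \<partial>lborel) \<le>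
      (\<integral>\<^sup>+(z::'a). ennreal (cmod (dilated_kernel (real (Suc n)) z)) +
        ennreal (cmod (dilated_kernel (1 / real (Suc n)) z)) \<partial>lborel)"
    unfolding fourier_band
    by (intro nn_integral_mono) (simp add: norm_triangle_ineq4 ennreal_leI flip: ennreal_plus)
  also have "\<dots> = 2 * (\<integral>\<^sup>+(z::'a). cmod (cutoff_kernel z) \<partial>lborel)"
    by (simp add: nn_integral_add nn_integral_dilated_kernel mult_2 del: of_nat_Suc)
  finally show ?thesis .
qed

subsection \<open>Convolutions and Riesz potentials\<close>

lemma radial_convolution:
  fixes u k :: "'a::euclidean_space \<Rightarrow> complex"
  assumes [measurable]: "u \<in> borel_measurable borel" "k \<in> borel_measurable borel"
    and u: "radial u" and k: "radial k"
  shows "radial (\<lambda>x. LINT y|lborel. u y * k (y - x))"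
  unfolding radial_def
proof (intro allI impI)
  fix x x' :: 'a assume "norm x = norm x'"
  then obtain T where T: "orthogonal_transformation T" "T x = x'"
    using orthogonal_transformation_swap by blast
  have T_norm: "norm (T y) = norm y" for y by (rule orthogonal_transformation_norm[OF T(1)])
  have "(LINT y|lborel. u y * k (y - x')) = (LINT y|lborel. u (T y) * k (T y - x'))"
    by (rule integral_orthogonal[OF T(1), symmetric]) measurable
  also have "\<dots> = (LINT y|lborel. u y * k (y - x))"
  proof (intro Bochner_Integration.integral_cong refl)
    fix y
    have "T y - x' = T (y - x)"
      using linear_diff[OF orthogonal_transformation_linear[OF T(1)], of y x] T(2) by simp
    then have "k (T y - x') = k (y - x)" by (intro radialD[OF k]) (simp add: T_norm)
    moreover have "u (T y) = u y" by (rule radialD[OF u T_norm])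
    ultimately show "u (T y) * k (T y - x') = u y * k (y - x)" by simp
  qed
  finally show "(LINT y|lborel. u y * k (y - x)) = (LINT y|lborel. u y * k (y - x'))" by simp
qed

lemma riesz_conv_convolution_le:
  fixes u v :: "'a::euclidean_space \<Rightarrow> complex" and k :: "'a \<Rightarrow> ennreal"
  assumes [measurable]: "u \<in> borel_measurable borel" "k \<in> borel_measurable borel"
    and v: "\<And>x. ennreal (cmod (v x)) \<le> (\<integral>\<^sup>+z. k z * ennreal (cmod (u (x + z))) \<partial>lborel)"
  shows "riesz_conv \<alpha> v x \<le> (\<integral>\<^sup>+z. k z * riesz_conv \<alpha> u (x + z) \<partial>lborel)"
proof -
  define w where "w y = ennreal (norm y powr - \<alpha>)" for y :: 'a
  have [measurable]: "w \<in> borel_measurable borel" unfolding w_def by measurable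
  have "riesz_conv \<alpha> v x \<le>
      (\<integral>\<^sup>+y. w (x - y) * (\<integral>\<^sup>+z. k z * ennreal (cmod (u (y + z))) \<partial>lborel) \<partial>lborel)"
    unfolding riesz_conv_def w_def
    by (intro nn_integral_mono) (simp add: ennreal_mult mult_left_mono v)
  also have "\<dots> = (\<integral>\<^sup>+y. \<integral>\<^sup>+z. w (x - y) * (k z * ennreal (cmod (u (y + z)))) \<partial>lborel \<partial>lborel)"
    by (intro nn_integral_cong nn_integral_cmult[symmetric]) measurable
  also have "\<dots> = (\<integral>\<^sup>+z. \<integral>\<^sup>+y. w (x - y) * (k z * ennreal (cmod (u (y + z)))) \<partial>lborel \<partial>lborel)"
    by (rule lborel_pair.Fubini') measurable
  also have "\<dots> = (\<integral>\<^sup>+z. k z * riesz_conv \<alpha> u (x + z) \<partial>lborel)"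
  proof (rule nn_integral_cong)
    fix z
    have "(\<integral>\<^sup>+y. w (x - y) * (k z * ennreal (cmod (u (y + z)))) \<partial>lborel) =
        k z * (\<integral>\<^sup>+y. w ((x + z) - (y + z)) * ennreal (cmod (u (y + z))) \<partial>lborel)"
      by (subst nn_integral_cmult[symmetric]) (auto simp: mult_ac)
    also have "(\<integral>\<^sup>+y. w ((x + z) - (y + z)) * ennreal (cmod (u (y + z))) \<partial>lborel) =
        (\<integral>\<^sup>+y. w ((x + z) - y) * ennreal (cmod (u y)) \<partial>lborel)"
      by (rule nn_integral_lborel_translate[of "\<lambda>y. w ((x + z) - y) * ennreal (cmod (u y))"])
         measurable
    also have "\<dots> = riesz_conv \<alpha> u (x + z)"
      by (simp add: riesz_conv_def w_def ennreal_mult)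
    finally show "(\<integral>\<^sup>+y. w (x - y) * (k z * ennreal (cmod (u (y + z)))) \<partial>lborel) =
        k z * riesz_conv \<alpha> u (x + z)" .
  qed
  finally show ?thesis .
qed

lemma conv_sq_convolution_le:
  fixes u v :: "'a::euclidean_space \<Rightarrow> complex" and k :: "'a \<Rightarrow> ennreal"
  assumes [measurable]: "u \<in> borel_measurable borel" "k \<in> borel_measurable borel"
    and v: "\<And>x. ennreal (cmod (v x)) \<le> (\<integral>\<^sup>+z. k z * ennreal (cmod (u (x + z))) \<partial>lborel)"
  shows "conv_sq \<alpha> v \<le> (\<integral>\<^sup>+z. k z \<partial>lborel)\<^sup>2 * conv_sq \<alpha> u"
proof -
  have "conv_sq \<alpha> v \<le> (\<integral>\<^sup>+x. (\<integral>\<^sup>+z. k z * riesz_conv \<alpha> u (x + z) \<partial>lborel)\<^sup>2 \<partial>lborel)"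
    unfolding conv_sq_def
    by (intro nn_integral_mono power_mono riesz_conv_convolution_le[OF assms]) auto
  also have "\<dots> \<le> (\<integral>\<^sup>+z. k z \<partial>lborel)\<^sup>2 * conv_sq \<alpha> u"
    unfolding conv_sq_def by (intro nn_integral_convolution_square_le) measurable
  finally show ?thesis .
qed

lemma
  fixes u g :: "'a::euclidean_space \<Rightarrow> complex"
  assumes [measurable]: "u \<in> borel_measurable borel" "g \<in> borel_measurable borel"
    and g: "\<And>y. y \<noteq> x \<Longrightarrow> cmod (g y) \<le> c * (norm (x - y) powr - \<alpha> * cmod (u y))"
    and c: "c \<ge> 0" and finite: "riesz_conv \<alpha> u x < \<infinity>"
  shows integrable_le_riesz_conv: "integrable lborel g"
    and norm_integral_le_riesz_conv: "cmod (LINT y|lborel. g y) \<le> c * enn2real (riesz_conv \<alpha> u x)"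
proof -
  have g_riesz: "(\<integral>\<^sup>+y. cmod (g y) \<partial>lborel) \<le> ennreal c * riesz_conv \<alpha> u x"
  proof -
    have "(\<integral>\<^sup>+y. cmod (g y) \<partial>lborel) \<le>
        (\<integral>\<^sup>+y. ennreal c * ennreal (norm (x - y) powr - \<alpha> * cmod (u y)) \<partial>lborel)"
    proof (rule nn_integral_mono_AE)
      show "AE y in lborel. ennreal (cmod (g y)) \<le>
          ennreal c * ennreal (norm (x - y) powr - \<alpha> * cmod (u y))"
        using AE_lborel_singleton[of x]
        by eventually_elim (use c in \<open>simp add: g ennreal_leI flip: ennreal_mult\<close>)
    qed
    also have "\<dots> = ennreal c * riesz_conv \<alpha> u x"
      unfolding riesz_conv_def by (rule nn_integral_cmult) measurable
    finally show ?thesis .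
  qed
  have riesz_real: "riesz_conv \<alpha> u x = ennreal (enn2real (riesz_conv \<alpha> u x))" using finite by simp
  show "integrable lborel g"
    using g_riesz finite
    by (intro integrableI_bounded) (auto simp: ennreal_mult_less_top elim: order_le_less_trans)
  have "ennreal (cmod (LINT y|lborel. g y)) \<le> ennreal c * ennreal (enn2real (riesz_conv \<alpha> u x))"
    unfolding riesz_real[symmetric]
    by (rule order_trans[OF integral_norm_bound_nn_integral g_riesz])
  then show "cmod (LINT y|lborel. g y) \<le> c * enn2real (riesz_conv \<alpha> u x)"
    using c by (simp add: ennreal_mult[symmetric] ennreal_le_iff)
qed

lemma lp_pow_on_Fatou:
  fixes u :: "'a::euclidean_space \<Rightarrow> complex"
  assumes [measurable]: "\<And>n. v n \<in> borel_measurable borel" and p: "p > 0"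
    and lim: "AE x in lborel. x \<in> S \<longrightarrow> (\<lambda>n. v n x) \<longlonglongrightarrow> u x"
    and v: "\<And>n. lp_pow p (v n) \<le> E"
  shows "lp_pow_on S p u \<le> E"
proof -
  have "lp_pow_on S p u \<le> (\<integral>\<^sup>+x. liminf (\<lambda>n. ennreal (cmod (v n x) powr p)) \<partial>lborel)"
    unfolding lp_pow_on_def
  proof (rule nn_integral_mono_AE)
    show "AE x in lborel. ennreal (cmod (u x) powr p) * indicator S x \<le>
        liminf (\<lambda>n. ennreal (cmod (v n x) powr p))"
      using lim
    proof eventually_elim
      case (elim x)
      show ?case
      proof (cases "x \<in> S")
        case True
        then have "(\<lambda>n. cmod (v n x) powr p) \<longlonglongrightarrow> cmod (u x) powr p"
          using elim p by (intro tendsto_powr' tendsto_norm tendsto_const) auto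
        then have "(\<lambda>n. ennreal (cmod (v n x) powr p)) \<longlonglongrightarrow> ennreal (cmod (u x) powr p)"
          by (rule tendsto_ennrealI)
        from lim_imp_Liminf[OF _ this] show ?thesis using True by simp
      qed simp
    qed
  qed
  also have "\<dots> \<le> liminf (\<lambda>n. lp_pow p (v n))"
    unfolding lp_pow_def by (rule nn_integral_liminf) measurable
  also have "\<dots> \<le> E" using v by (intro Liminf_le always_eventually) auto
  finally show ?thesis .
qed

lemma lp_pow_le_if_balls:
  fixes u :: "'a::euclidean_space \<Rightarrow> complex"
  assumes [measurable]: "u \<in> borel_measurable borel" and "p > 0"
    and balls: "\<And>R. lp_pow_on (ball 0 R) p u \<le> E"
  shows "lp_pow p u \<le> E"
proof -
  define v where "v n x = indicator (ball 0 (real n)) x *\<^sub>R u x" for n :: nat and x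
  have [measurable]: "v n \<in> borel_measurable borel" for n unfolding v_def by measurable
  have "(\<lambda>n. v n x) \<longlonglongrightarrow> u x" for x
  proof (rule tendsto_eventually)
    obtain N :: nat where "norm x < real N" using reals_Archimedean2 by blast
    then show "\<forall>\<^sub>F n in sequentially. v n x = u x"
      unfolding eventually_sequentially v_def by (intro exI[of _ N]) auto
  qed
  moreover have "lp_pow p (v n) \<le> E" for n
  proof -
    have "lp_pow p (v n) = lp_pow_on (ball 0 (real n)) p u"
      unfolding lp_pow_def lp_pow_on_def v_def
      by (intro nn_integral_cong) (auto split: split_indicator)
    then show ?thesis using balls by simp
  qed
  ultimately have "lp_pow_on UNIV p u \<le> E" using \<open>p > 0\<close> by (intro lp_pow_on_Fatou[of v]) auto
  then show ?thesis by (simp add: lp_pow_on_UNIV)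
qed

lemma AE_riesz_conv_finite:
  fixes u :: "'a::euclidean_space \<Rightarrow> complex"
  assumes [measurable]: "u \<in> borel_measurable borel" and "conv_sq \<alpha> u < \<infinity>"
  shows "AE x in lborel. riesz_conv \<alpha> u x < \<infinity>"
proof -
  have "AE x in lborel. (riesz_conv \<alpha> u x)\<^sup>2 \<noteq> \<infinity>"
    using assms(2) unfolding conv_sq_def by (intro nn_integral_PInf_AE) auto
  then show ?thesis
    by eventually_elim (auto simp: power2_eq_square ennreal_mult_eq_top_iff less_top[symmetric])
qed

lemma integrable_on_ball_if_conv_sq_finite:
  fixes u :: "'a::euclidean_space \<Rightarrow> complex"
  assumes [measurable]: "u \<in> borel_measurable borel" and "\<alpha> \<ge> 0" and "conv_sq \<alpha> u < \<infinity>"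
  shows "set_integrable lborel (ball 0 R) u"
proof (cases "R > 0")
  case True
  have "(lp_pow_on (ball 0 R) 1 u)\<^sup>2 < \<infinity>"
    using ball_mass_square_le_conv_sq[OF assms(1,2) True, of 0] assms(3)
    by (elim order_le_less_trans) (simp add: ennreal_mult_less_top)
  then have "lp_pow_on (ball 0 R) 1 u < \<infinity>"
    by (auto simp: power2_eq_square ennreal_mult_less_top less_top[symmetric])
  moreover have "(\<integral>\<^sup>+y. cmod (indicator (ball 0 R) y *\<^sub>R u y) \<partial>lborel) = lp_pow_on (ball 0 R) 1 u"
    unfolding lp_pow_on_def by (intro nn_integral_cong) (auto split: split_indicator)
  ultimately show ?thesis
    unfolding set_integrable_def by (intro integrableI_bounded) auto
next
  case False
  then show ?thesis by (simp add: set_integrable_def ball_empty)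
qed

lemma lp_pow_eq_0_if_conv_sq_eq_0:
  fixes u :: "'a::euclidean_space \<Rightarrow> complex"
  assumes [measurable]: "u \<in> borel_measurable borel" and p: "p > 0" and conv: "conv_sq \<alpha> u = 0"
  shows "lp_pow p u = 0"
proof -
  have "AE x in lborel. (riesz_conv \<alpha> u x)\<^sup>2 = 0"
    using conv unfolding conv_sq_def by (subst (asm) nn_integral_0_iff_AE) auto
  then obtain x where "(riesz_conv \<alpha> u x)\<^sup>2 = 0"
    using eventually_happens[of _ "ae_filter lborel"]
    by (auto simp: trivial_limit_def[symmetric] ae_filter_eq_bot_iff)
  then have "AE y in lborel. ennreal (norm (x - y) powr - \<alpha> * cmod (u y)) = 0"
    unfolding riesz_conv_def by (simp add: nn_integral_0_iff_AE)
  then have "AE y in lborel. ennreal (cmod (u y) powr p) = 0"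
    using AE_lborel_singleton[of x]
    by eventually_elim (use p in \<open>auto simp: ennreal_eq_0_iff mult_le_0_iff\<close>)
  then show ?thesis
    unfolding lp_pow_def by (subst nn_integral_0_iff_AE) auto
qed

subsection \<open>Band-limited approximations\<close>

locale radial_riesz =
  fixes \<alpha> :: real and u uh :: "'a::euclidean_space \<Rightarrow> complex"
  assumes \<alpha>_pos: "0 < \<alpha>" and \<alpha>_less_dim: "\<alpha> < real DIM('a)"
    and u_measurable [measurable]: "u \<in> borel_measurable borel"
    and u_radial: "radial u"
    and u_fourier: "is_fourier_transform u uh"
    and conv_sq_finite: "conv_sq \<alpha> u < \<infinity>"
begin

definition band_hat :: "nat \<Rightarrow> 'a \<Rightarrow> complex" where
  "band_hat n \<xi> = band n \<xi> * uh \<xi>"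

lemma uh_measurable [measurable]: "uh \<in> borel_measurable borel"
  using u_fourier by (simp add: is_fourier_transform_def)

lemma band_hat_measurable [measurable]: "band_hat n \<in> borel_measurable borel"
  unfolding band_hat_def[abs_def] by measurable

lemma hdot_sq_band_hat_le: "hdot_sq s (band_hat n) \<le> hdot_sq s uh"
  unfolding hdot_sq_def
  by (intro nn_integral_mono ennreal_leI mult_left_mono power_mono)
     (auto simp: band_hat_def norm_mult norm_band_le mult_left_le_one_le)

lemma
  shows integrable_band_hat: "integrable lborel (band_hat n)"
    and fourier_band_hat_minus:
      "fourier (band_hat n) (- x) = (LINT y|lborel. u y * fourier (band n) (y - x))"
proof -
  have duality: "integrable lborel (\<lambda>\<xi>. uh \<xi> * (band n \<xi> * cis (2 * pi * (a \<bullet> \<xi>)))) \<and>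
      (LINT y|lborel. u y * fourier (band n) (y - a)) =
        (LINT \<xi>|lborel. uh \<xi> * (band n \<xi> * cis (2 * pi * (a \<bullet> \<xi>))))" for a
    using u_fourier freq_test_band_character[of n a]
    unfolding is_fourier_transform_def fourier_modulate[symmetric] by blast
  show "integrable lborel (band_hat n)"
    using duality[of 0] by (simp add: band_hat_def[abs_def] mult.commute)
  show "fourier (band_hat n) (- x) = (LINT y|lborel. u y * fourier (band n) (y - x))"
    using duality[of x] by (simp add: fourier_def[of "band_hat n"] band_hat_def mult_ac)
qed

lemma fourier_band_hat: "fourier (band_hat n) x = (LINT y|lborel. u y * fourier (band n) (y - x))"
  and radial_fourier_band_hat: "radial (fourier (band_hat n))"
proof -
  have "radial (\<lambda>x. fourier (band_hat n) (- x))"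
    unfolding fourier_band_hat_minus by (intro radial_convolution u_radial fourier_band_radial) auto
  note fourier_cong = radialD[OF this]
  show "radial (fourier (band_hat n))"
    unfolding radial_def
  proof (intro allI impI)
    fix x y :: 'a assume "norm x = norm y"
    then show "fourier (band_hat n) x = fourier (band_hat n) y" using fourier_cong[of "- x" "- y"]
      by simp
  qed
  show "fourier (band_hat n) x = (LINT y|lborel. u y * fourier (band n) (y - x))"
    using fourier_cong[of "- x" x] by (simp add: fourier_band_hat_minus)
qed

lemma conv_sq_fourier_band_hat_le:
  "conv_sq \<alpha> (fourier (band_hat n)) \<le>
    ennreal ((2 * (LINT z|lborel. cmod (cutoff_kernel (z::'a))))\<^sup>2) * conv_sq \<alpha> u"
proof -
  have "conv_sq \<alpha> (fourier (band_hat n)) \<le>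
      (\<integral>\<^sup>+(z::'a). cmod (fourier (band n) z) \<partial>lborel)\<^sup>2 * conv_sq \<alpha> u"
  proof (rule conv_sq_convolution_le)
    fix x
    have "ennreal (cmod (fourier (band_hat n) x)) \<le>
        (\<integral>\<^sup>+y. cmod (u y * fourier (band n) (y - x)) \<partial>lborel)"
      unfolding fourier_band_hat by (rule integral_norm_bound_nn_integral)
    also have "\<dots> = (\<integral>\<^sup>+z. cmod (u (z + x) * fourier (band n) ((z + x) - x)) \<partial>lborel)"
      by (rule nn_integral_lborel_translate[symmetric]) measurable
    also have "\<dots> = (\<integral>\<^sup>+z. ennreal (cmod (fourier (band n) z)) * ennreal (cmod (u (x + z))) \<partial>lborel)"
      by (simp add: norm_mult ennreal_mult mult.commute add.commute)
    finally show "ennreal (cmod (fourier (band_hat n) x)) \<le>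
        (\<integral>\<^sup>+z. ennreal (cmod (fourier (band n) z)) * ennreal (cmod (u (x + z))) \<partial>lborel)" .
  qed measurable
  also have "\<dots> \<le> (2 * (\<integral>\<^sup>+(z::'a). cmod (cutoff_kernel z) \<partial>lborel))\<^sup>2 * conv_sq \<alpha> u"
    by (intro mult_right_mono power_mono nn_integral_fourier_band_le) auto
  also have "(\<integral>\<^sup>+(z::'a). cmod (cutoff_kernel z) \<partial>lborel) =
      ennreal (LINT z|lborel. cmod (cutoff_kernel (z::'a)))"
    by (rule nn_integral_eq_integral) (simp_all add: integrable_cutoff_kernel)
  finally show ?thesis by (simp add: ennreal_power power_mult_distrib ennreal_mult)
qed

definition truncated :: "real \<Rightarrow> 'a \<Rightarrow> complex" where
  "truncated R y = indicator (ball 0 R) y *\<^sub>R u y"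

lemma integrable_truncated: "integrable lborel (truncated R)"
  using integrable_on_ball_if_conv_sq_finite[OF u_measurable _ conv_sq_finite, of R] \<alpha>_pos
  by (simp add: set_integrable_def truncated_def[abs_def])

lemma truncated_measurable [measurable]: "truncated R \<in> borel_measurable borel"
  unfolding truncated_def[abs_def] by measurable

lemma
  assumes x: "riesz_conv \<alpha> u x < \<infinity>"
  shows integrable_low_kernel:
    "N > 0 \<Longrightarrow> integrable lborel (\<lambda>y. u y * dilated_kernel (1 / N) (y - x))"
    and low_kernel_tendsto_0:
      "((\<lambda>N. LINT y|lborel. u y * dilated_kernel (1 / N) (y - x)) \<longlongrightarrow> 0) at_top"
proof -
  obtain C where C: "C > 0" "\<And>c (z::'a). c > 0 \<Longrightarrow> z \<noteq> 0 \<Longrightarrow>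
      cmod (dilated_kernel c z) \<le> C * c powr (real DIM('a) - \<alpha>) * norm z powr - \<alpha>"
    using dilated_kernel_decay[where 'a='a, of \<alpha>] \<alpha>_pos by auto
  have kernel: "cmod (u y * dilated_kernel (1 / N) (y - x)) \<le>
      C * N powr (\<alpha> - real DIM('a)) * (norm (x - y) powr - \<alpha> * cmod (u y))"
    if N: "N > 0" and "y \<noteq> x" for N y
  proof -
    have "(1 / N) powr (real DIM('a) - \<alpha>) = N powr (\<alpha> - real DIM('a))"
      using N by (simp add: powr_divide powr_minus_divide[symmetric])
    then show ?thesis
      using mult_left_mono[OF C(2)[of "1 / N" "y - x"], of "cmod (u y)"] that
      by (simp add: norm_mult norm_minus_commute mult_ac)
  qed
  show "N > 0 \<Longrightarrow> integrable lborel (\<lambda>y. u y * dilated_kernel (1 / N) (y - x))"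
    using C(1) x by (intro integrable_le_riesz_conv[OF _ _ kernel]) auto
  have "\<forall>\<^sub>F N in at_top. norm (LINT y|lborel. u y * dilated_kernel (1 / N) (y - x)) \<le>
      C * N powr (\<alpha> - real DIM('a)) * enn2real (riesz_conv \<alpha> u x)"
    using eventually_gt_at_top[of 0]
    by eventually_elim (rule norm_integral_le_riesz_conv[OF _ _ kernel], use C(1) x in auto)
  moreover have "((\<lambda>N. C * N powr (\<alpha> - real DIM('a)) * enn2real (riesz_conv \<alpha> u x)) \<longlongrightarrow> 0) at_top"
    using \<alpha>_less_dim
    by (intro tendsto_mult_left_zero tendsto_mult_right_zero tendsto_neg_powr filterlim_ident) auto
  ultimately show "((\<lambda>N. LINT y|lborel. u y * dilated_kernel (1 / N) (y - x)) \<longlongrightarrow> 0) at_top"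
    by (rule Lim_null_comparison)
qed

lemma
  assumes R: "norm x + 1 \<le> R" and x: "riesz_conv \<alpha> u x < \<infinity>"
  shows integrable_high_kernel_tail:
      "N > 0 \<Longrightarrow> integrable lborel (\<lambda>y. (u y - truncated R y) * dilated_kernel N (y - x))"
    and high_kernel_tail_tendsto_0:
      "((\<lambda>N. LINT y|lborel. (u y - truncated R y) * dilated_kernel N (y - x)) \<longlongrightarrow> 0) at_top"
proof -
  define b where "b = real DIM('a) + 1"
  obtain C where C: "C > 0" "\<And>c (z::'a). c > 0 \<Longrightarrow> z \<noteq> 0 \<Longrightarrow>
      cmod (dilated_kernel c z) \<le> C * c powr (real DIM('a) - b) * norm z powr - b"
    using dilated_kernel_decay[where 'a='a, of b] by (auto simp: b_def)
  have kernel: "cmod ((u y - truncated R y) * dilated_kernel N (y - x)) \<le>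
      C / N * (norm (x - y) powr - \<alpha> * cmod (u y))" if N: "N > 0" for N y
  proof (cases "norm y < R")
    case True
    then show ?thesis using C(1) N by (simp add: truncated_def)
  next
    case False
    have "norm y \<le> norm (y - x) + norm x" using norm_triangle_ineq[of "y - x" x] by simp
    then have far: "norm (y - x) \<ge> 1" using False R by simp
    then have "cmod (dilated_kernel N (y - x)) \<le> C / N * norm (y - x) powr - b"
      using C(2)[OF N, of "y - x"] N by (force simp: b_def powr_minus_divide)
    also have "\<dots> \<le> C / N * norm (y - x) powr - \<alpha>"
      using far C(1) N \<alpha>_less_dim by (intro mult_left_mono powr_mono) (auto simp: b_def)
    finally have "cmod (u y) * cmod (dilated_kernel N (y - x)) \<le>
        cmod (u y) * (C / N * norm (y - x) powr - \<alpha>)"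
      by (rule mult_left_mono) simp
    then show ?thesis
      using False by (simp add: truncated_def norm_mult norm_minus_commute mult_ac)
  qed
  show "N > 0 \<Longrightarrow> integrable lborel (\<lambda>y. (u y - truncated R y) * dilated_kernel N (y - x))"
    using C(1) x by (intro integrable_le_riesz_conv[OF _ _ kernel]) auto
  have "\<forall>\<^sub>F N in at_top. norm (LINT y|lborel. (u y - truncated R y) * dilated_kernel N (y - x)) \<le>
      C / N * enn2real (riesz_conv \<alpha> u x)"
    using eventually_gt_at_top[of 0]
    by eventually_elim (rule norm_integral_le_riesz_conv[OF _ _ kernel], use C(1) x in auto)
  moreover have "((\<lambda>N. C / N * enn2real (riesz_conv \<alpha> u x)) \<longlongrightarrow> 0) at_top"
    by (intro tendsto_mult_left_zero tendsto_divide_0[OF tendsto_const]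
        filterlim_at_top_imp_at_infinity filterlim_ident)
  ultimately show "((\<lambda>N. LINT y|lborel. (u y - truncated R y) *
      dilated_kernel N (y - x)) \<longlongrightarrow> 0) at_top"
    by (rule Lim_null_comparison)
qed

lemma integrable_truncated_dilated_kernel:
  "integrable lborel (\<lambda>y. truncated R y * dilated_kernel c (y - x))"
proof -
  obtain B where B: "\<And>z::'a. cmod (cutoff_kernel z) \<le> B" using cutoff_kernel_bounded by blast
  have "integrable lborel (\<lambda>y. dilated_kernel c (y - x) * truncated R y)"
    by (rule integrable_bounded_mult[OF integrable_truncated, where B="c powr real DIM('a) * B"])
       (auto simp: dilated_kernel_def norm_mult mult_left_mono B)
  then show ?thesis by (simp add: mult.commute)
qed

lemma fourier_band_hat_error_tendsto_0:
  assumes R: "norm x + 1 \<le> R" and x: "riesz_conv \<alpha> u x < \<infinity>"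
  shows "(\<lambda>n. fourier (band_hat n) x -
    (LINT w|lborel. truncated R (x + (1 / real (Suc n)) *\<^sub>R w) * cutoff_kernel w)) \<longlonglongrightarrow> 0"
proof -
  define low where "low N y = u y * dilated_kernel (1 / N) (y - x)" for N y
  define tail where "tail N y = (u y - truncated R y) * dilated_kernel N (y - x)" for N y
  have "fourier (band_hat n) x -
        (LINT w|lborel. truncated R (x + (1 / real (Suc n)) *\<^sub>R w) * cutoff_kernel w) =
      (LINT y|lborel. tail (real (Suc n)) y) - (LINT y|lborel. low (real (Suc n)) y)" for n
  proof -
    define N where "N = real (Suc n)"
    have N: "N > 0" by (simp add: N_def)
    define main where "main y = truncated R y * dilated_kernel N (y - x)" for y
    have parts: "integrable lborel (low N)" "integrable lborel (tail N)" "integrable lborel main"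
      unfolding low_def tail_def main_def
      by (intro integrable_low_kernel integrable_high_kernel_tail
          integrable_truncated_dilated_kernel R x N)+
    have "fourier (band_hat n) x = (LINT y|lborel. main y + tail N y - low N y)"
      unfolding fourier_band_hat fourier_band
      by (simp add: main_def tail_def low_def N_def algebra_simps)
    then have "fourier (band_hat n) x - (LINT y|lborel. main y) =
        (LINT y|lborel. tail N y) - (LINT y|lborel. low N y)"
      using parts by simp
    moreover have "(LINT y|lborel. main y) =
        (LINT w|lborel. truncated R (x + (1 / N) *\<^sub>R w) * cutoff_kernel w)"
      unfolding main_def by (rule integral_dilated_kernel[OF truncated_measurable N])
    ultimately show ?thesis by (simp only: N_def)
  qed
  moreover have N_at_top: "filterlim (\<lambda>n. real (Suc n)) at_top sequentially"
    by (rule filterlim_compose[OF filterlim_real_sequentially filterlim_Suc])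
  moreover have "(\<lambda>n. (LINT y|lborel. tail (real (Suc n)) y) -
      (LINT y|lborel. low (real (Suc n)) y)) \<longlonglongrightarrow> 0 - 0"
    unfolding low_def tail_def
    by (intro tendsto_diff filterlim_compose[OF high_kernel_tail_tendsto_0[OF R x] N_at_top]
        filterlim_compose[OF low_kernel_tendsto_0[OF x] N_at_top])
  ultimately show ?thesis by simp
qed

lemma AE_fourier_band_hat_tendsto:
  obtains r :: "nat \<Rightarrow> nat" where
    "AE x in lborel. norm x < R \<longrightarrow> (\<lambda>n. fourier (band_hat (r n)) x) \<longlonglongrightarrow> u x"
proof -
  define f where "f = truncated (R + 1)"
  define L where "L n x = (LINT w|lborel. f (x + (1 / real (Suc n)) *\<^sub>R w) * cutoff_kernel w)"
    for n x
  have f: "integrable lborel f" unfolding f_def by (rule integrable_truncated)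
  have "integrable lborel (L n)" for n
    unfolding L_def
    using lborel_pair.integrable_snd[OF integrable_pair_translate[OF f integrable_cutoff_kernel]] .
  then have L_f: "integrable lborel (\<lambda>x. L n x - f x)" for n using f by simp
  have "(\<lambda>n. \<integral>\<^sup>+x. norm (L n x - f x) \<partial>lborel) \<longlonglongrightarrow> 0"
    unfolding L_def
    by (intro L1_approximate_identity[OF f integrable_cutoff_kernel integral_cutoff_kernel]
        LIMSEQ_Suc[OF lim_1_over_n])
  then have "(\<lambda>n. enn2real (\<integral>\<^sup>+x. norm (L n x - f x) \<partial>lborel)) \<longlonglongrightarrow> enn2real 0"
    by (intro tendsto_enn2real) auto
  moreover have "enn2real (\<integral>\<^sup>+x. norm (L n x - f x) \<partial>lborel) = (LINT x|lborel. norm (L n x - f x))"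
    for n
    using L_f[of n] by (subst integral_eq_nn_integral) auto
  ultimately have "(\<lambda>n. LINT x|lborel. norm (L n x - f x)) \<longlonglongrightarrow> 0" by simp
  from tendsto_L1_AE_subseq[OF L_f this] obtain r :: "nat \<Rightarrow> nat" where r: "strict_mono r"
    and L_tendsto: "AE x in lborel. (\<lambda>n. L (r n) x - f x) \<longlonglongrightarrow> 0" by blast
  have "AE x in lborel. norm x < R \<longrightarrow> (\<lambda>n. fourier (band_hat (r n)) x) \<longlonglongrightarrow> u x"
    using L_tendsto AE_riesz_conv_finite[OF u_measurable conv_sq_finite]
  proof (eventually_elim, intro impI)
    fix x assume L: "(\<lambda>n. L (r n) x - f x) \<longlonglongrightarrow> 0" and x: "riesz_conv \<alpha> u x < \<infinity>" and R: "norm x < R"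
    have "(\<lambda>n. fourier (band_hat n) x - L n x) \<longlonglongrightarrow> 0"
      using fourier_band_hat_error_tendsto_0[OF _ x, of "R + 1"] R by (simp add: L_def f_def)
    then have "(\<lambda>n. fourier (band_hat (r n)) x - L (r n) x) \<longlonglongrightarrow> 0"
      using LIMSEQ_subseq_LIMSEQ[OF _ r] by (auto simp: o_def)
    from tendsto_add[OF this L] have "(\<lambda>n. fourier (band_hat (r n)) x) \<longlonglongrightarrow> f x"
      by (simp add: LIM_zero_iff)
    then show "(\<lambda>n. fourier (band_hat (r n)) x) \<longlonglongrightarrow> u x" using R by (simp add: f_def truncated_def)
  qed
  then show ?thesis by (rule that)
qed

lemma lp_pow_le_if_fourier_band_hat_le:
  assumes p: "p > 0" and band: "\<And>n. lp_pow p (fourier (band_hat n)) \<le> E"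
  shows "lp_pow p u \<le> E"
proof (rule lp_pow_le_if_balls[OF u_measurable p])
  fix R
  obtain r :: "nat \<Rightarrow> nat" where
    "AE x in lborel. norm x < R \<longrightarrow> (\<lambda>n. fourier (band_hat (r n)) x) \<longlonglongrightarrow> u x"
    by (rule AE_fourier_band_hat_tendsto)
  then show "lp_pow_on (ball 0 R) p u \<le> E"
    using band by (intro lp_pow_on_Fatou[OF _ p, where v="\<lambda>n. fourier (band_hat (r n))"]) auto
qed

lemma lp_pow_eq_0_if_hdot_sq_eq_0:
  assumes p: "p > 0" and hdot: "hdot_sq s uh = 0"
  shows "lp_pow p u = 0"
proof -
  have "AE \<xi> in lborel. ennreal (norm \<xi> powr (2 * s) * (cmod (uh \<xi>))\<^sup>2) = 0"
    using hdot unfolding hdot_sq_def by (subst (asm) nn_integral_0_iff_AE) auto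
  then have "AE \<xi> in lborel. uh \<xi> = 0"
    using AE_lborel_singleton[of 0] by eventually_elim (auto simp: ennreal_eq_0_iff mult_le_0_iff)
  then have "fourier (band_hat n) x = 0" for n x
    unfolding fourier_def by (intro integral_eq_zero_AE) (auto simp: band_hat_def)
  then have "lp_pow p u \<le> 0"
    using p by (intro lp_pow_le_if_fourier_band_hat_le) (simp_all add: lp_pow_def)
  then show ?thesis by simp
qed

end

section \<open>The interpolation inequality\<close>

lemma enn2real_powr_le:
  assumes X: "X \<le> ennreal (C * Y powr p)" and "C \<ge> 0" "Y \<ge> 0" "p > 0"
  shows "X < \<infinity> \<and> enn2real X powr (1/p) \<le> C powr (1/p) * Y"
proof
  show "X < \<infinity>" using X by (rule order_le_less_trans) simp
  have "enn2real X \<le> C * Y powr p" using enn2real_mono[OF X] assms by simp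
  then have "enn2real X powr (1/p) \<le> (C * Y powr p) powr (1/p)"
    using assms by (intro powr_mono2) auto
  also have "\<dots> = C powr (1/p) * Y" using assms by (simp add: powr_mult powr_powr)
  finally show "enn2real X powr (1/p) \<le> C powr (1/p) * Y" .
qed

context riesz_sobolev
begin

definition interpolation_exponent :: "real \<Rightarrow> real" where
  "interpolation_exponent p = (3 * d / 2 - \<alpha> - d / p) / (s + d - \<alpha>)"

lemma interpolation_exponent_iff:
  "d / p = (1 - \<theta>) * ((d - \<alpha>) + d/2) + \<theta> * (- s + d/2) \<longleftrightarrow> \<theta> = interpolation_exponent p"
proof -
  have "s + d - \<alpha> > 0" using s_pos \<alpha>_less by simp
  moreover have "(1 - \<theta>) * ((d - \<alpha>) + d/2) + \<theta> * (- s + d/2) = 3 * d / 2 - \<alpha> - \<theta> * (s + d - \<alpha>)"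
    by (simp add: field_simps)
  ultimately show ?thesis by (auto simp: interpolation_exponent_def eq_divide_eq)
qed

lemma lp_pow_le_if_radial_riesz:
  assumes p: "p_rad d s \<alpha> < p" and sobolev: "s < d/2 \<Longrightarrow> p \<le> 2 * d / (d - 2 * s)"
  defines "\<theta> \<equiv> interpolation_exponent p"
  obtains C where "C \<ge> 0" "\<And>(u :: 'a \<Rightarrow> complex) uh A B. radial_riesz \<alpha> u uh \<Longrightarrow> A > 0 \<Longrightarrow> B > 0 \<Longrightarrow>
    conv_sq \<alpha> u \<le> ennreal (A\<^sup>2) \<Longrightarrow> hdot_sq s uh \<le> ennreal (B\<^sup>2) \<Longrightarrow>
    lp_pow p u \<le> ennreal (C * (A powr (1 - \<theta>) * B powr \<theta>) powr p)"
proof -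
  obtain C where C: "C \<ge> 0" and band_limited: "\<And>(h :: 'a \<Rightarrow> complex) A B. A > 0 \<Longrightarrow> B > 0 \<Longrightarrow>
      integrable lborel h \<Longrightarrow> radial (fourier h) \<Longrightarrow>
      conv_sq \<alpha> (fourier h) \<le> ennreal (A\<^sup>2) \<Longrightarrow> hdot_sq s h \<le> ennreal (B\<^sup>2) \<Longrightarrow>
      lp_pow p (fourier h) \<le> ennreal (C * (A powr (1 - \<theta>) * B powr \<theta>) powr p)"
    using lp_pow_fourier_le[OF p sobolev interpolation_exponent_iff[THEN iffD2, OF refl]]
    unfolding \<theta>_def by blast
  define k where "k = 2 * (LINT z|lborel. cmod (cutoff_kernel (z::'a)))"
  have k: "k \<ge> 0" by (simp add: k_def)
  define c where "c = k + 1"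
  have c: "c > 0" "k \<le> c" using k by (simp_all add: c_def)
  show thesis
  proof (rule that)
    fix u uh :: "'a \<Rightarrow> complex" and A B :: real
    assume "radial_riesz \<alpha> u uh" and A: "A > 0" and B: "B > 0"
      and conv: "conv_sq \<alpha> u \<le> ennreal (A\<^sup>2)" and hdot: "hdot_sq s uh \<le> ennreal (B\<^sup>2)"
    interpret radial_riesz \<alpha> u uh by fact
    have "conv_sq \<alpha> (fourier (band_hat n)) \<le> ennreal ((c * A)\<^sup>2)" for n
    proof -
      have "conv_sq \<alpha> (fourier (band_hat n)) \<le> ennreal (k\<^sup>2) * conv_sq \<alpha> u"
        unfolding k_def by (rule conv_sq_fourier_band_hat_le)
      also have "\<dots> \<le> ennreal (k\<^sup>2) * ennreal (A\<^sup>2)"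
        by (rule mult_left_mono[OF conv]) simp
      also have "\<dots> = ennreal ((k * A)\<^sup>2)"
        by (simp add: power_mult_distrib ennreal_mult)
      also have "\<dots> \<le> ennreal ((c * A)\<^sup>2)"
        using c A k by (intro ennreal_leI power_mono mult_right_mono) auto
      finally show ?thesis .
    qed
    then have "lp_pow p (fourier (band_hat n)) \<le>
        ennreal (C * ((c * A) powr (1 - \<theta>) * B powr \<theta>) powr p)" for n
      using order_trans[OF hdot_sq_band_hat_le hdot] c A B
      by (intro band_limited integrable_band_hat radial_fourier_band_hat) auto
    then have "lp_pow p u \<le> ennreal (C * ((c * A) powr (1 - \<theta>) * B powr \<theta>) powr p)"
      using p p_rad_gt_1 by (intro lp_pow_le_if_fourier_band_hat_le) auto
    also have "C * ((c * A) powr (1 - \<theta>) * B powr \<theta>) powr p =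
        C * (c powr (1 - \<theta>)) powr p * (A powr (1 - \<theta>) * B powr \<theta>) powr p"
      using c A B by (simp add: powr_mult)
    finally show "lp_pow p u \<le>
        ennreal (C * (c powr (1 - \<theta>)) powr p * (A powr (1 - \<theta>) * B powr \<theta>) powr p)" .
  qed (use C in simp)
qed

theorem lp_norm_le:
  assumes p: "p_rad d s \<alpha> < p" and sobolev: "s < d/2 \<Longrightarrow> p \<le> 2 * d / (d - 2 * s)"
  defines "\<theta> \<equiv> interpolation_exponent p"
  shows "\<exists>C. \<forall>(u :: 'a \<Rightarrow> complex) uh. radial_riesz \<alpha> u uh \<longrightarrow> hdot_sq s uh < \<infinity> \<longrightarrow>
    lp_pow p u < \<infinity> \<and> enn2real (lp_pow p u) powr (1/p) \<le>
      C * sqrt (enn2real (conv_sq \<alpha> u)) powr (1 - \<theta>) * sqrt (enn2real (hdot_sq s uh)) powr \<theta>"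
proof -
  have p_pos: "p > 0" using p p_rad_gt_1 by simp
  obtain C where C: "C \<ge> 0" "\<And>(u :: 'a \<Rightarrow> complex) uh A B. radial_riesz \<alpha> u uh \<Longrightarrow> A > 0 \<Longrightarrow> B > 0 \<Longrightarrow>
      conv_sq \<alpha> u \<le> ennreal (A\<^sup>2) \<Longrightarrow> hdot_sq s uh \<le> ennreal (B\<^sup>2) \<Longrightarrow>
      lp_pow p u \<le> ennreal (C * (A powr (1 - \<theta>) * B powr \<theta>) powr p)"
    using lp_pow_le_if_radial_riesz[OF p sobolev] unfolding \<theta>_def by blast
  have "lp_pow p u < \<infinity> \<and> enn2real (lp_pow p u) powr (1/p) \<le>
      C powr (1/p) * sqrt (enn2real (conv_sq \<alpha> u)) powr (1 - \<theta>) * sqrt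
         (enn2real (hdot_sq s uh)) powr \<theta>"
    if u: "radial_riesz \<alpha> u uh" and hdot: "hdot_sq s uh < \<infinity>" for u uh :: "'a \<Rightarrow> complex"
  proof -
    interpret radial_riesz \<alpha> u uh by (rule u)
    define A where "A = sqrt (enn2real (conv_sq \<alpha> u))"
    define B where "B = sqrt (enn2real (hdot_sq s uh))"
    have A_sq: "conv_sq \<alpha> u = ennreal (A\<^sup>2)" and B_sq: "hdot_sq s uh = ennreal (B\<^sup>2)"
      using conv_sq_finite hdot by (auto simp: A_def B_def)
    have nonneg: "A \<ge> 0" "B \<ge> 0" by (simp_all add: A_def B_def)
    show ?thesis
    proof (cases "A = 0 \<or> B = 0")
      case True
      then have "lp_pow p u = 0"
        using lp_pow_eq_0_if_conv_sq_eq_0[OF u_measurable p_pos] A_sq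
          lp_pow_eq_0_if_hdot_sq_eq_0[OF p_pos] B_sq by auto
      then show ?thesis by simp
    next
      case False
      then have "lp_pow p u \<le> ennreal (C * (A powr (1 - \<theta>) * B powr \<theta>) powr p)"
        using nonneg A_sq B_sq by (intro C(2)[OF u]) auto
      from enn2real_powr_le[OF this C(1) _ p_pos] show ?thesis
        by (simp add: mult.assoc flip: A_def B_def)
    qed
  qed
  then show ?thesis by blast
qed

end

theorem theorem2p1:
  fixes s \<alpha> :: real
  defines "d \<equiv> real DIM('a::euclidean_space)"
  assumes "DIM('a) \<ge> 2" and "s > 1/2" and "d/2 < \<alpha>" and "\<alpha> < d - 1/2"
  shows "p_rad d s \<alpha> < 2 \<and>
    (\<forall>p. p_rad d s \<alpha> < p \<and> (if s < d/2 then p \<le> 2 * d / (d - 2 * s) else True) \<longrightarrow>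
      (\<exists>C. \<forall>(u :: 'a \<Rightarrow> complex) uh \<theta>.
         u \<in> borel_measurable lborel \<and> radial u \<and> is_fourier_transform u uh \<and>
         hdot_sq s uh < \<infinity> \<and> conv_sq \<alpha> u < \<infinity> \<and>
         d / p = (1 - \<theta>) * ((d - \<alpha>) + d/2) + \<theta> * (- s + d/2)
         \<longrightarrow> lp_pow p u < \<infinity> \<and>
             (enn2real (lp_pow p u)) powr (1/p)
               \<le> C * (sqrt (enn2real (conv_sq \<alpha> u))) powr (1 - \<theta>)
                   * (sqrt (enn2real (hdot_sq s uh))) powr \<theta>))"
proof -
  interpret riesz_sobolev d s \<alpha> "TYPE('a)"
    using assms by unfold_locales auto
  have radial_riesz: "radial_riesz \<alpha> u uh"
    if "u \<in> borel_measurable lborel" "radial u" "is_fourier_transform u uh" "conv_sq \<alpha> u < \<infinity>"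
    for u uh :: "'a \<Rightarrow> complex"
    using that assms by unfold_locales auto
  show ?thesis
  proof (intro conjI allI impI p_rad_less_2, goal_cases)
    case (1 p)
    then have "p_rad d s \<alpha> < p" "s < d/2 \<Longrightarrow> p \<le> 2 * d / (d - 2 * s)" by auto
    from lp_norm_le[OF this] show ?case
      unfolding interpolation_exponent_iff using radial_riesz by blast
  qed
qed

end
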